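(* Let $\mathbb{K}=\mathbb{R}$ or $\mathbb{K}=\mathbb{C}$, and set $\beta=1$ if $\mathbb{K}=\mathbb{R}$ and $\beta=2$ if $\mathbb{K}=\mathbb{C}$. For every $n\ge 1$ let $m_n\ge n$ be an integer, such that $n/m_n\to\lambda\in[0,1]$ as $n\to\infty$; if $\lambda=0$, assume moreover that there is $\alpha<2$ such that $m_n\le n^{\alpha}$ for all $n$ large enough. Let $K>0$ and, for every $n\ge1$, let $M_n$ be a deterministic $n\times m_n$ matrix with entries in $\mathbb{K}$ all of whose singular values are $<K$. Suppose that the singular law of $M_n$ converges weakly, as $n\to\infty$, to a probability measure $\mu$. For every $n$, let $E_n$ be an $m_n\times n$ elementary matrix, let $U_n,V_n$ be independent Haar-distributed orthogonal (if $\mathbb{K}=\mathbb{R}$) or unitary (if $\mathbb{K}=\mathbb{C}$) random matrices of respective sizes $n\times n$ and $m_n\times m_n$, and define, for $\theta\in\mathbb{R}$, $$I_n(\theta)=\frac1n\log\mathbb{E}\left\{\exp\left[\sqrt{nm_n}\,\theta\,\Re\left(\operatorname{Tr}(E_nU_nM_nV_n)\right)\right]\right\}.$$ Then, as $n\to\infty$, $I_n$ converges uniformly on every compact subset of $(-\beta K^{-1},\beta K^{-1})$ to the function $$I(\theta)=\beta\int_0^{\theta/\beta}\frac{C^{(\lambda)}_\mu(t^2)}{t}\,dt,$$ where $C_\mu^{(\lambda)}$ is the rectangular $R$-transform of $\mu$ with ratio $\lambda$.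
   Context: The singular law of an $n\times m$ matrix with $n\le m$ is the uniform probability distribution $\frac1n\sum_{k=1}^n\delta_{s_k}$ on its $n$ singular values $s_1,\dots,s_n\geq 0$ (counted with multiplicity). An elementary matrix is a matrix all of whose entries are zero except one, which equals one. $\Re$ denotes the real part. Rectangular $R$-transform. Let $\mu$ be a probability measure with support contained in $[-K,K]$, $K>0$, and let $\lambda\in[0,1]$. For $z\in[0,K^{-2})$ put $$M_{\mu^2}(z)=\int\frac{t^2z}{1-t^2z}\,d\mu(t),\qquad T^{(\lambda)}(z)=(\lambda z+1)(z+1),\qquad H_\mu^{(\lambda)}(z)=z\,T^{(\lambda)}(M_{\mu^2}(z)).$$ $H^{(\lambda)}_\mu$ is an increasing analytic bijection from $[0,K^{-2})$ onto $[0,L)$ with $L=\lim_{z\uparrow K^{-2}}H_\mu^{(\lambda)}(z)\in[K^{-2},+\infty]$; its inverse is denoted ${H_\mu^{(\lambda)}}^{-1}$. $T^{(\lambda)}$ is an increasing bijection from $[-1,+\infty)$ onto $[0,+\infty)$; its inverse is denoted ${T^{(\lambda)}}^{-1}$. The rectangular $R$-transform of $\mu$ with ratio $\lambda$ is the function on $[0,L)\supseteq[0,K^{-2})$ given by $$C_\mu^{(\lambda)}(z)={T^{(\lambda)}}^{-1}\left(\frac{z}{{H_\mu^{(\lambda)}}^{-1}(z)}\right)\ (z\ne0),\qquad C_\mu^{(\lambda)}(0)=0.$$ It is analytic and nonnegative, so $t\mapsto C_\mu^{(\lambda)}(t^2)/t$ extends continuously by $0$ at $t=0$ and the integral defining $I$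 makes sense. *)

theory Defs
  imports "HOL-Probability.Probability" "Jordan_Normal_Form.Schur_Decomposition"
begin

text \<open>
  Matrices are Jordan-Normal-Form matrices over the complex numbers, because their dimensions vary
  with \<open>n\<close>. Both base fields are treated at once as a set \<open>F\<close> of complex scalars, either
  \<open>\<real>\<close> or \<open>UNIV\<close>: a real matrix is a complex matrix with entries in \<open>\<real>\<close>, and
  the orthogonal matrices are the unitary matrices with entries in \<open>\<real>\<close>.
\<close>

definition mat_trace :: "complex mat \<Rightarrow> complex" where
  "mat_trace A = (\<Sum>i<dim_row A. A $$ (i, i))"

definition elementary_mats :: "nat \<Rightarrow> nat \<Rightarrow> complex mat set" where
  "elementary_mats p q =
     {mat p q (\<lambda>kl. if kl = (i, j) then 1 else 0) | i j. i < p \<and> j < q}"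

definition unitary_group :: "complex set \<Rightarrow> nat \<Rightarrow> complex mat set" where
  "unitary_group F n =
     {A \<in> carrier_mat n n. elements_mat A \<subseteq> F \<and>
        A * mat_adjoint A = 1\<^sub>m n \<and> mat_adjoint A * A = 1\<^sub>m n}"

text \<open>
  The singular values of an \<open>n \<times> m\<close> matrix with \<open>n \<le> m\<close>, with multiplicity: the square
  roots of the eigenvalues (with multiplicity, real and nonnegative) of the \<open>n \<times> n\<close> matrix
  \<open>A A\<^sup>*\<close>.
\<close>

definition singular_values :: "complex mat \<Rightarrow> real multiset" where
  "singular_values A = image_mset (\<lambda>z. sqrt (Re z)) (proots (char_poly (A * mat_adjoint A)))"

definition singular_law :: "complex mat \<Rightarrow> real measure" where
  "singular_law A = distr (measure_pmf (pmf_of_multiset (singular_values A))) borel (\<lambda>x. x)"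

text \<open>
  The entrywise Borel sigma algebra, i.e. the Borel sigma algebra of the \<open>p \<times> q\<close> matrices
  as a finite-dimensional space.
\<close>

definition mat_borel :: "nat \<Rightarrow> nat \<Rightarrow> complex mat measure" where
  "mat_borel p q = sigma (carrier_mat p q)
     {{A \<in> carrier_mat p q. A $$ (i, j) \<in> S} | i j S. i < p \<and> j < q \<and> S \<in> sets borel}"

definition unitary_space :: "complex set \<Rightarrow> nat \<Rightarrow> complex mat measure" where
  "unitary_space F n = restrict_space (mat_borel n n) (unitary_group F n)"

text \<open>
  Left invariance characterizes the Haar probability measure; on a compact group it implies right
  invariance, and regularity is automatic for a finite Borel measure here.
\<close>

definition is_haar_measure :: "complex set \<Rightarrow> nat \<Rightarrow> complex mat measure \<Rightarrow> bool" where
  "is_haar_measure F n \<nu> \<longleftrightarrow>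
     prob_space \<nu> \<and> sets \<nu> = sets (unitary_space F n) \<and>
     (\<forall>A \<in> unitary_group F n. distr \<nu> \<nu> (\<lambda>B. A * B) = \<nu>)"

definition haar_distributed ::
  "complex set \<Rightarrow> nat \<Rightarrow> 'w measure \<Rightarrow> ('w \<Rightarrow> complex mat) \<Rightarrow> bool" where
  "haar_distributed F n P X \<longleftrightarrow>
     X \<in> measurable P (unitary_space F n) \<and>
     is_haar_measure F n (distr P (unitary_space F n) X)"

definition M_sq :: "real measure \<Rightarrow> real \<Rightarrow> real" where
  "M_sq \<mu> z = (LINT t|\<mu>. t\<^sup>2 * z / (1 - t\<^sup>2 * z))"

definition T_rect :: "real \<Rightarrow> real \<Rightarrow> real" where
  "T_rect l z = (l * z + 1) * (z + 1)"

definition H_rect :: "real \<Rightarrow> real measure \<Rightarrow> real \<Rightarrow> real" where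
  "H_rect l \<mu> z = z * T_rect l (M_sq \<mu> z)"

text \<open>
  The rectangular R-transform with ratio \<open>l\<close> of a measure \<open>\<mu>\<close> supported in \<open>[-K, K]\<close>.
  It is meaningful on \<open>[0, L)\<close>, where \<open>L\<close> is the supremum of \<open>H_rect l \<mu>\<close> on
  \<open>[0, 1/K\<^sup>2)\<close>; this contains \<open>[0, 1/K\<^sup>2)\<close>. Elsewhere its values are arbitrary.
\<close>

definition rect_R :: "real \<Rightarrow> real \<Rightarrow> real measure \<Rightarrow> real \<Rightarrow> real" where
  "rect_R K l \<mu> z =
     (if z = 0 then 0
      else the_inv_into {-1..} (T_rect l) (z / the_inv_into {0..<1 / K\<^sup>2} (H_rect l \<mu>) z))"

end

theory Submission
  imports Defs "HOL-Complex_Analysis.Cauchy_Integral_Formula"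
begin

text \<open>
  Let \<open>g\<close> be a standard Gaussian vector over \<open>F\<close> and \<open>c j = E |g M|^(2j) / (2^j j!)\<close>. A Gaussian
  vector is the product of its norm and an independent uniform direction, so comparing moments turns
  the Haar expectation into the exact formula
  \<open>Z(\<theta>) = (\<Sum>j. c j * \<tau>^(2j) / (\<Prod>i<j. (1 + 2i/(\<beta>n)) (1 + 2i/(\<beta>m))))\<close> with \<open>\<tau> = \<theta>/\<beta>\<close>, where
  \<open>(\<Sum>j. c j * x^j) = (\<Prod>k. (1 - s\<^sub>k\<^sup>2 x) powr (-\<beta>/2))\<close>. For \<open>x > 0\<close>, \<open>y\<close> the mean of
  \<open>s\<^sub>k\<^sup>2 x / (1 - s\<^sub>k\<^sup>2 x)\<close> and \<open>\<tau>\<^sup>2 = x T(y)\<close>, the weights \<open>c j * x^j\<close> have mean \<open>\<beta>n y / 2\<close> and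
  variance \<open>O(n)\<close>, and they are multiplied by the exponential of a concave function of \<open>j\<close> that is
  maximal near that mean and has second derivative \<open>O(1/n)\<close>. This determines \<open>ln Z\<close> up to \<open>O(1)\<close>.
  In the limit \<open>\<tau>\<^sup>2 = H(x)\<close>, and a saddle point argument identifies the derivative of the limit in
  \<open>\<tau>\<close> as \<open>M(x) / \<tau> = C(\<tau>\<^sup>2) / \<tau>\<close>. Convergence is locally uniform because \<open>ln Z\<close> is monotone in
  \<open>|\<theta>|\<close> and the limit is continuous.
\<close>

section \<open>Unitary matrices and the spectral theorem\<close>

text \<open>Independence of norm and direction is used only through moments: left invariance of the
  Haar measure and Tonelli's theorem produce two power series with nonnegative coefficients, which
  must then agree termwise. Nonnegative integrals carry this computation without integrability side
  conditions; the odd terms are removed beforehand by passing from \<open>exp\<close> to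
  \<open>cosh\<close>. The real case avoids a real spectral theorem: two independent real Gaussian
  vectors form a complex one, so the real transform is the square root of the complex one. The
  weights are never shown to concentrate. A pointwise maximum bounds the sum above, and Jensen's
  inequality bounds it below by mass and variance alone. The tilt is built from the empirical mean
  and the ratio \<open>n / m n\<close> at each \<open>n\<close>, which makes the error explicit. The
  price is that the estimate holds at \<open>\<tau> = sqrt (x * z n)\<close>, a point that moves
  with \<open>n\<close>; monotonicity absorbs the motion. Every
  \<open>\<tau>\<^sup>2 < 1 / K\<^sup>2\<close> is reached in the limit because
  \<open>x \<le> H x\<close>.\<close>

lemma dim_mat_adjoint [simp]:
  "dim_row (mat_adjoint A) = dim_col A" "dim_col (mat_adjoint A) = dim_row A"
  by (simp_all add: mat_adjoint_def)

lemma mat_adjoint_carrier [simp]: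
  "A \<in> carrier_mat n m \<Longrightarrow> mat_adjoint A \<in> carrier_mat m n"
  by (rule carrier_matI) auto

lemma index_mat_adjoint [simp]:
  fixes A :: "complex mat"
  assumes "i < dim_col A" "j < dim_row A"
  shows "mat_adjoint A $$ (i, j) = cnj (A $$ (j, i))"
  using assms by (simp add: mat_adjoint_def mat_of_rows_index)

lemma mat_adjoint_adjoint [simp]: "mat_adjoint (mat_adjoint A) = (A :: complex mat)"
  by (rule eq_matI) auto

lemma index_mult_sum:
  assumes "A \<in> carrier_mat n p" "B \<in> carrier_mat p m" "i < n" "j < m"
  shows "(A * B) $$ (i, j) = (\<Sum>k<p. A $$ (i, k) * B $$ (k, j))"
  using assms by (simp add: scalar_prod_def atLeast0LessThan)

lemma mat_adjoint_mult:
  fixes A :: "complex mat"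
  assumes A: "A \<in> carrier_mat n p" and B: "B \<in> carrier_mat p m"
  shows "mat_adjoint (A * B) = mat_adjoint B * mat_adjoint A"
proof (rule eq_matI)
  fix i j assume "i < dim_row (mat_adjoint B * mat_adjoint A)"
    "j < dim_col (mat_adjoint B * mat_adjoint A)"
  hence i: "i < m" and j: "j < n" using A B by auto
  have "mat_adjoint (A * B) $$ (i, j) = cnj ((A * B) $$ (j, i))"
    using A B i j by simp
  also have "\<dots> = (\<Sum>k<p. cnj (A $$ (j, k)) * cnj (B $$ (k, i)))"
    by (simp add: index_mult_sum[OF A B j i])
  also have "\<dots> = (mat_adjoint B * mat_adjoint A) $$ (i, j)"
    using index_mult_sum[OF mat_adjoint_carrier[OF B] mat_adjoint_carrier[OF A] i j] A B i j
    by (simp add: mult.commute)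
  finally show "mat_adjoint (A * B) $$ (i, j) = (mat_adjoint B * mat_adjoint A) $$ (i, j)" .
qed (use A B in auto)

lemma mat_adjoint_one [simp]: "mat_adjoint (1\<^sub>m n :: complex mat) = 1\<^sub>m n"
  by (rule eq_matI) auto

lemma unitary_groupI:
  assumes A: "A \<in> carrier_mat n n" and F: "\<And>i j. i < n \<Longrightarrow> j < n \<Longrightarrow> A $$ (i, j) \<in> F"
    and 1: "A * mat_adjoint A = 1\<^sub>m n"
  shows "A \<in> unitary_group F n"
proof -
  have "mat_adjoint A * A = 1\<^sub>m n"
    using mat_mult_left_right_inverse[OF A mat_adjoint_carrier[OF A] 1] .
  moreover have "elements_mat A \<subseteq> F" using A F by auto
  ultimately show ?thesis using A 1 by (simp add: unitary_group_def)
qed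

lemma unitary_groupD:
  assumes "A \<in> unitary_group F n"
  shows "A \<in> carrier_mat n n" "A * mat_adjoint A = 1\<^sub>m n" "mat_adjoint A * A = 1\<^sub>m n"
    "\<And>i j. i < n \<Longrightarrow> j < n \<Longrightarrow> A $$ (i, j) \<in> F"
proof -
  show "A $$ (i, j) \<in> F" if "i < n" "j < n" for i j
    using assms that elements_matI[of A n n i j "A $$ (i, j)"] by (auto simp: unitary_group_def)
qed (use assms in \<open>auto simp: unitary_group_def\<close>)

lemma unitary_group_UNIV_adjoint:
  assumes "A \<in> unitary_group F n"
  shows "mat_adjoint A \<in> unitary_group UNIV n"
  using assms by (auto simp: unitary_group_def)

lemma mat_mult_assoc5:
  fixes X :: "'a :: semiring_0 mat"
  assumes "X \<in> carrier_mat n n" "Y \<in> carrier_mat n n" "Z \<in> carrier_mat n n"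
    "W \<in> carrier_mat n n" "V \<in> carrier_mat n n"
  shows "X * (Y * Z * W) * V = X * Y * Z * (W * V)"
  using assms by (simp add: assoc_mult_mat[of _ n n _ n _ n] mult_carrier_mat[of _ n n])

lemma unitary_group_UNIV_mult:
  assumes "A \<in> unitary_group UNIV n" "B \<in> unitary_group UNIV n"
  shows "A * B \<in> unitary_group UNIV n"
proof (rule unitary_groupI)
  note [simp] = unitary_groupD(1)[OF assms(1)] unitary_groupD(1)[OF assms(2)]
  show "A * B \<in> carrier_mat n n" by (rule mult_carrier_mat[of _ n n]) simp_all
  have "A * B * mat_adjoint (A * B) = A * B * (mat_adjoint B * mat_adjoint A)"
    by (subst mat_adjoint_mult[of _ n n _ n]) simp_all
  also have "\<dots> = A * (B * mat_adjoint B) * mat_adjoint A"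
    by (simp add: assoc_mult_mat[of _ n n _ n _ n] mult_carrier_mat[of _ n n])
  also have "\<dots> = 1\<^sub>m n"
    by (simp add: unitary_groupD(2)[OF assms(1)] unitary_groupD(2)[OF assms(2)] right_mult_one_mat[of A n n])
  finally show "A * B * mat_adjoint (A * B) = 1\<^sub>m n" .
qed simp

section \<open>Householder reflections and unitary matrices with a prescribed row\<close>

text \<open>A reflection times a phase: the two terms linear in \<open>c\<close> cancel the
  quadratic one because \<open>c\<close> times the squared norm of \<open>v\<close> is 2. Leaving
  \<open>c\<close> free avoids normalising \<open>v\<close>; the phase \<open>w\<close> makes it
  possible to prescribe a complex row.\<close>

lemma householder_unitary:
  fixes v :: "nat \<Rightarrow> complex" and c :: real and w :: complex
  assumes F: "F = \<real> \<or> F = UNIV" and v: "\<And>k. k < n \<Longrightarrow> v k \<in> F" and w: "w \<in> F" "cmod w = 1"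
    and c: "c * (\<Sum>k<n. (cmod (v k))\<^sup>2) = 2"
  shows "mat n n (\<lambda>(k, l). w * ((if k = l then 1 else 0) - of_real c * cnj (v k) * v l))
    \<in> unitary_group F n" (is "?A \<in> _")
proof (rule unitary_groupI)
  show A: "?A \<in> carrier_mat n n" by simp
  show "?A $$ (i, j) \<in> F" if "i < n" "j < n" for i j
    using F that v[of i] v[of j] w(1)
    by (auto intro!: Reals_mult Reals_diff simp: Reals_cnj_iff)
  have c': "of_real c * (\<Sum>k<n. v k * cnj (v k)) = 2"
    using arg_cong[OF c, of complex_of_real] by (simp only: complex_norm_square of_real_mult of_real_sum) simp
  have ww: "w * cnj w = 1" using w(2) by (simp add: complex_norm_square[symmetric])
  show "?A * mat_adjoint ?A = 1\<^sub>m n"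
  proof (rule eq_matI)
    fix i j assume "i < dim_row (1\<^sub>m n :: complex mat)" "j < dim_col (1\<^sub>m n :: complex mat)"
    hence i: "i < n" and j: "j < n" by auto
    let ?d = "\<lambda>a b :: nat. if a = b then 1 else 0 :: complex"
    have "(?A * mat_adjoint ?A) $$ (i, j) = (\<Sum>s<n. ?A $$ (i, s) * mat_adjoint ?A $$ (s, j))"
      by (rule index_mult_sum) (use i j in auto)
    also have "\<dots> = (\<Sum>s<n. (w * cnj w) * ((?d i s - of_real c * cnj (v i) * v s)
        * (?d j s - of_real c * v j * cnj (v s))))"
      by (rule sum.cong) (use i j in auto)
    also have "\<dots> = (\<Sum>s<n. ?d i s * ?d j s - ?d i s * (of_real c * v j * cnj (v s))
        - ?d j s * (of_real c * cnj (v i) * v s)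
        + (of_real c * cnj (v i) * v j) * (of_real c * (v s * cnj (v s))))"
      by (rule sum.cong) (auto simp: ww algebra_simps)
    also have "\<dots> = ?d i j - of_real c * v j * cnj (v i) - of_real c * cnj (v i) * v j
        + (of_real c * cnj (v i) * v j) * (of_real c * (\<Sum>s<n. v s * cnj (v s)))"
      using i j by (simp add: sum.distrib sum_subtractf sum_distrib_left if_distrib[where f="\<lambda>x. x * _"]
          cong: if_cong)
    also have "\<dots> = 1\<^sub>m n $$ (i, j)" using i j by (simp add: c')
    finally show "(?A * mat_adjoint ?A) $$ (i, j) = 1\<^sub>m n $$ (i, j)" .
  qed auto
qed

text \<open>A reflection can exchange a basis vector with a given unit vector only if their inner
  product is real, so \<open>a\<close> is first rotated by the phase of \<open>a j\<close>.
  Transitivity on the unit sphere is what later lets left invariance determine the law of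
  \<open>g U\<close> for a fixed vector \<open>g\<close>.\<close>

lemma unitary_group_with_row:
  fixes a :: "nat \<Rightarrow> complex"
  assumes F: "F = \<real> \<or> F = UNIV" and j: "j < n" and a: "\<And>k. k < n \<Longrightarrow> a k \<in> F"
    and norm: "(\<Sum>k<n. (cmod (a k))\<^sup>2) = 1"
  obtains A where "A \<in> unitary_group F n" "\<And>k. k < n \<Longrightarrow> A $$ (j, k) = a k"
proof (cases "cmod (a j) = 1")
  case True
  have 0: "a k = 0" if "k < n" "k \<noteq> j" for k
  proof -
    have "(\<Sum>k\<in>{..<n} - {j}. (cmod (a k))\<^sup>2) = 0"
      using norm True j by (simp add: sum.remove[of "{..<n}" j])
    thus ?thesis using that by (subst (asm) sum_nonneg_eq_0_iff) auto
  qed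
  have "mat n n (\<lambda>(k, l). a j * ((if k = l then 1 else 0) - of_real 2 * cnj (if k = j then 1 else 0) * (if l = j then 1 else 0)))
      \<in> unitary_group F n"
    using F a[OF j] True j
    by (intro householder_unitary) (auto simp: if_distrib[where f="\<lambda>x. cmod x ^ 2"] cong: if_cong)
  \<comment> \<open>The reflection negates coordinate \<open>j\<close>; the phase
    \<open>- a j\<close> restores the sign.\<close>
  hence "mat n n (\<lambda>(k, l). (- a j) * ((if k = l then 1 else 0) - of_real 2 * cnj (if k = j then 1 else 0) * (if l = j then 1 else 0)))
      \<in> unitary_group F n"
    using F a[OF j] True j
    by (intro householder_unitary) (auto simp: if_distrib[where f="\<lambda>x. cmod x ^ 2"] cong: if_cong)
  thus thesis by (rule that) (use j 0 in auto)
next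
  case False
  define r where "r = cmod (a j)"
  \<comment> \<open>The phase of \<open>a j\<close>. Dividing it out makes entry \<open>j\<close>
    the real number \<open>r\<close>, so that \<open>v\<close> has squared norm
    \<open>2 * (1 - r)\<close>.\<close>
  define w where "w = (if a j = 0 then 1 else a j / of_real r)"
  have w: "w \<in> F" "cmod w = 1" "cnj w * a j = of_real r"
    using F a[OF j] by (auto simp: w_def r_def norm_divide complex_norm_square[symmetric] power2_eq_square
        mult.commute[of "cnj _"] intro!: Reals_divide)
  define v where "v = (\<lambda>k. (if k = j then 1 else 0) - cnj w * a k)"
  have cw: "cnj w * w = 1" using w(2) complex_norm_square[of w] by (simp add: mult.commute)
  have vj: "v j = of_real (1 - r)" by (simp add: v_def w)
  have "(\<Sum>k<n. (cmod (v k))\<^sup>2) = (1 - r)\<^sup>2 + (\<Sum>k\<in>{..<n} - {j}. (cmod (v k))\<^sup>2)"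
    using j by (simp add: sum.remove[of _ j] vj norm_of_real del: of_real_diff)
  also have "(\<Sum>k\<in>{..<n} - {j}. (cmod (v k))\<^sup>2) = (\<Sum>k\<in>{..<n} - {j}. (cmod (a k))\<^sup>2)"
    by (rule sum.cong) (auto simp: v_def norm_mult w)
  also have "\<dots> = 1 - r\<^sup>2" using norm j by (simp add: sum.remove[of _ j] r_def)
  also have "(1 - r)\<^sup>2 + (1 - r\<^sup>2) = 2 * (1 - r)" by (simp add: power2_eq_square algebra_simps)
  finally have vs: "1 / (1 - r) * (\<Sum>k<n. (cmod (v k))\<^sup>2) = 2" using False by (simp add: r_def field_simps)
  show thesis
  proof (rule that)
    show "mat n n (\<lambda>(k, l). w * ((if k = l then 1 else 0) - of_real (1 / (1 - r)) * cnj (v k) * v l))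
        \<in> unitary_group F n"
      by (rule householder_unitary[OF F _ w(1,2) vs])
        (use F a w in \<open>auto simp: v_def Reals_cnj_iff intro!: Reals_diff Reals_mult\<close>)
    fix k assume k: "k < n"
    have "complex_of_real (1 / (1 - r)) * cnj (v j) = 1"
      using False unfolding vj r_def[symmetric] by (simp flip: of_real_mult)
    hence "mat n n (\<lambda>(k, l). w * ((if k = l then 1 else 0) - of_real (1 / (1 - r)) * cnj (v k) * v l)) $$ (j, k)
        = w * ((if j = k then 1 else 0) - v k)"
      using k j by simp
    also have "\<dots> = (cnj w * w) * a k" by (simp add: v_def algebra_simps)
    finally show "mat n n (\<lambda>(k, l). w * ((if k = l then 1 else 0) - of_real (1 / (1 - r)) * cnj (v k) * v l)) $$ (j, k) = a k"
      by (simp only: cw mult_1)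
  qed
qed

section \<open>Diagonalization of Hermitian matrices and singular values\<close>

lemma mat_adjoint_four_block_diag:
  fixes A B :: "complex mat"
  assumes "A \<in> carrier_mat p p" "B \<in> carrier_mat q q"
  shows "mat_adjoint (four_block_mat A (0\<^sub>m p q) (0\<^sub>m q p) B)
    = four_block_mat (mat_adjoint A) (0\<^sub>m p q) (0\<^sub>m q p) (mat_adjoint B)"
  by (rule eq_matI) (use assms in \<open>auto simp: index_mat_four_block\<close>)

lemma four_block_diag_mult:
  fixes A B :: "complex mat"
  assumes "A \<in> carrier_mat p p" "B \<in> carrier_mat q q" "A' \<in> carrier_mat p p" "B' \<in> carrier_mat q q"
  shows "four_block_mat A (0\<^sub>m p q) (0\<^sub>m q p) B * four_block_mat A' (0\<^sub>m p q) (0\<^sub>m q p) B'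
    = four_block_mat (A * A') (0\<^sub>m p q) (0\<^sub>m q p) (B * B')"
  by (subst mult_four_block_mat[of _ p p _ q _ q _ _ p _ q])
    (use assms in \<open>auto simp: left_add_zero_mat right_add_zero_mat mult_carrier_mat[of _ _ p] mult_carrier_mat[of _ _ q]\<close>)

text \<open>Row 0 of \<open>H\<close> is the conjugate of a unit eigenvector, so column 0 of
  \<open>mat_adjoint H\<close> is the eigenvector and column 0 of the conjugated matrix is a
  multiple of the first basis vector. Being Hermitian then clears row 0 and makes the eigenvalue
  real.\<close>

lemma hermitian_deflation:
  fixes A :: "complex mat"
  assumes A: "A \<in> carrier_mat (Suc k) (Suc k)" and h: "mat_adjoint A = A"
  obtains H e B where "H \<in> unitary_group UNIV (Suc k)" "B \<in> carrier_mat k k" "mat_adjoint B = B"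
    "H * A * mat_adjoint H = four_block_mat (mat 1 1 (\<lambda>_. complex_of_real e)) (0\<^sub>m 1 k) (0\<^sub>m k 1) B"
proof -
  let ?n = "Suc k"
  obtain es where es: "char_poly A = (\<Prod>a\<leftarrow>es. [:- a, 1:])" "length es = ?n"
    using char_poly_factorized[OF A] by auto
  then obtain e es' where "es = e # es'" by (cases es) auto
  hence "poly (char_poly A) e = 0" using es by simp
  hence "eigenvalue A e" using eigenvalue_root_char_poly[OF A] by simp
  then obtain v where "eigenvector A v e" by (auto simp: eigenvalue_def)
  hence v: "v \<in> carrier_vec ?n" "v \<noteq> 0\<^sub>v ?n" "A *\<^sub>v v = e \<cdot>\<^sub>v v"
    using A by (auto simp: eigenvector_def)
  define s where "s = (\<Sum>i<?n. (cmod (v $ i))\<^sup>2)"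
  have "s > 0"
  proof -
    obtain i where "i < ?n" "v $ i \<noteq> 0" using v(1,2) by (metis eq_vecI carrier_vecD index_zero_vec)
    thus ?thesis unfolding s_def by (intro sum_pos2[of _ i]) auto
  qed
  define r where "r = sqrt s"
  have r: "r > 0" "r\<^sup>2 = s" using \<open>s > 0\<close> by (auto simp: r_def)
  obtain H where H: "H \<in> unitary_group UNIV ?n" "\<And>l. l < ?n \<Longrightarrow> H $$ (0, l) = cnj (v $ l) / of_real r"
  proof (rule unitary_group_with_row[of UNIV 0 ?n "\<lambda>l. cnj (v $ l) / of_real r"])
    show "(\<Sum>l<?n. (cmod (cnj (v $ l) / of_real r))\<^sup>2) = 1"
      using r \<open>s > 0\<close> by (simp add: norm_divide power_divide sum_divide_distrib[symmetric] s_def del: sum.lessThan_Suc)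
  qed auto
  note [simp] = unitary_groupD(1)[OF H(1)] A
  let ?W = "mat_adjoint H"
  define A' where "A' = H * A * mat_adjoint H"
  have W: "?W \<in> carrier_mat ?n ?n" by simp
  have A'c: "A' \<in> carrier_mat ?n ?n" unfolding A'_def by (intro mult_carrier_mat[of _ _ ?n]) simp_all
  have A'h: "mat_adjoint A' = A'"
    unfolding A'_def
    by (subst mat_adjoint_mult[of _ ?n ?n _ ?n], simp add: mult_carrier_mat[of _ _ ?n], simp,
        subst mat_adjoint_mult[of _ ?n ?n _ ?n], simp, simp)
      (simp add: h assoc_mult_mat[of _ ?n ?n _ ?n _ ?n])
  have colW: "col ?W 0 = of_real (1 / r) \<cdot>\<^sub>v v"
    by (rule eq_vecI) (use H(2) v(1) carrier_matD[OF unitary_groupD(1)[OF H(1)]] in auto)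
  have "col A' 0 = (H * A) *\<^sub>v col ?W 0"
    unfolding A'_def by (rule col_mult2[of _ ?n ?n _ ?n]) (auto intro!: mult_carrier_mat[of _ _ ?n])
  also have "\<dots> = H *\<^sub>v (A *\<^sub>v col ?W 0)"
    by (rule assoc_mult_mat_vec[of _ ?n ?n _ ?n]) (auto simp: colW v)
  also have "A *\<^sub>v col ?W 0 = e \<cdot>\<^sub>v col ?W 0"
    using v by (simp add: colW mult_mat_vec[of A ?n ?n] smult_smult_assoc mult.commute)
  also have "H *\<^sub>v (e \<cdot>\<^sub>v col ?W 0) = e \<cdot>\<^sub>v (H *\<^sub>v col ?W 0)"
    by (rule mult_mat_vec[of H ?n ?n]) (auto simp: colW v)
  also have "H *\<^sub>v col ?W 0 = col (H * ?W) 0"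
    by (rule col_mult2[of _ ?n ?n _ ?n, symmetric]) auto
  also have "H * ?W = 1\<^sub>m ?n" using unitary_groupD(2)[OF H(1)] .
  finally have col0: "col A' 0 = e \<cdot>\<^sub>v col (1\<^sub>m ?n) 0" .
  have A'0: "A' $$ (i, 0) = (if i = 0 then e else 0)" if "i < ?n" for i
  proof -
    have "A' $$ (i, 0) = col A' 0 $ i" using that A'c by auto
    thus ?thesis using that unfolding col0 by auto
  qed
  have A'sym: "A' $$ (i, j) = cnj (A' $$ (j, i))" if "i < ?n" "j < ?n" for i j
  proof -
    have "mat_adjoint A' $$ (i, j) = cnj (A' $$ (j, i))"
      by (rule index_mat_adjoint) (use that A'c in auto)
    thus ?thesis by (simp only: A'h)
  qed
  define B where "B = mat k k (\<lambda>(i, j). A' $$ (Suc i, Suc j))"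
  show thesis
  proof (rule that)
    show "H \<in> unitary_group UNIV (Suc k)" by fact
    show B: "B \<in> carrier_mat k k" by (simp add: B_def)
    show "mat_adjoint B = B"
      by (rule eq_matI) (auto simp: B_def A'sym[symmetric])
    have "cnj e = e" using A'sym[of 0 0] A'0[of 0] by (metis zero_less_Suc)
    hence e: "complex_of_real (Re e) = e" by (simp add: complex_eq_iff)
    show "H * A * mat_adjoint H = four_block_mat (mat 1 1 (\<lambda>_. complex_of_real (Re e))) (0\<^sub>m 1 k) (0\<^sub>m k 1) B"
      (is "_ = ?R")
      unfolding A'_def[symmetric]
    proof (rule eq_matI)
      show dims: "dim_row A' = dim_row ?R" "dim_col A' = dim_col ?R" using A'c B by auto
      fix i j assume "i < dim_row ?R" "j < dim_col ?R"
      hence i: "i < ?n" and j: "j < ?n" using B by auto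
      have R: "?R $$ (i, j) = (if i < 1 then if j < 1 then e else 0 else if j < 1 then 0 else A' $$ (i, j))"
        using i j e by (auto simp: B_def)
      have "A' $$ (0, j) = cnj (A' $$ (j, 0))" by (rule A'sym) (use j in auto)
      hence "A' $$ (0, j) = (if j = 0 then e else 0)"
        using A'0[OF j] \<open>cnj e = e\<close> by simp
      thus "A' $$ (i, j) = ?R $$ (i, j)"
        unfolding R using A'0[OF i] by auto
    qed
  qed
qed

lemma hermitian_diagonalization:
  fixes A :: "complex mat"
  assumes A: "A \<in> carrier_mat n n" and h: "mat_adjoint A = A"
  obtains Q and d :: "nat \<Rightarrow> real" where "Q \<in> unitary_group UNIV n"
    "A = Q * mat n n (\<lambda>(i, j). if i = j then complex_of_real (d i) else 0) * mat_adjoint Q"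
proof -
  have "\<exists>Q \<in> unitary_group UNIV n. \<exists>d. A = Q * mat n n (\<lambda>(i, j). if i = j then complex_of_real (d i) else 0) * mat_adjoint Q"
    using A h
  proof (induction n arbitrary: A)
    case 0
    have "1\<^sub>m 0 \<in> unitary_group UNIV 0" by (rule unitary_groupI) auto
    thus ?case using 0 by (intro bexI[of _ "1\<^sub>m 0"] exI[of _ "\<lambda>_. 0"] eq_matI) auto
  next
    case (Suc k)
    let ?n = "Suc k"
    obtain H e B where HB: "H \<in> unitary_group UNIV (Suc k)" "B \<in> carrier_mat k k" "mat_adjoint B = B"
      "H * A * mat_adjoint H = four_block_mat (mat 1 1 (\<lambda>_. complex_of_real e)) (0\<^sub>m 1 k) (0\<^sub>m k 1) B"
      using hermitian_deflation[OF Suc.prems] by metis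
    obtain Q d where Q: "Q \<in> unitary_group UNIV k"
      and B: "B = Q * mat k k (\<lambda>(i, j). if i = j then complex_of_real (d i) else 0) * mat_adjoint Q"
      using Suc.IH[OF HB(2,3)] by auto
    let ?D = "mat k k (\<lambda>(i, j). if i = j then complex_of_real (d i) else 0)"
    let ?e = "mat 1 1 (\<lambda>_. complex_of_real e)"
    let ?b = "\<lambda>X Y :: complex mat. four_block_mat X (0\<^sub>m 1 k) (0\<^sub>m k 1) Y"
    let ?Q = "?b (1\<^sub>m 1) Q"
    let ?d = "\<lambda>i. if i = 0 then e else d (i - 1)"
    let ?DD = "mat ?n ?n (\<lambda>(i, j). if i = j then complex_of_real (?d i) else 0)"
    note [simp] = unitary_groupD(1,2)[OF Q] unitary_groupD(1)[OF HB(1)]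
    have [simp]: "?Q \<in> carrier_mat ?n ?n"
      using four_block_carrier_mat[of "1\<^sub>m 1" 1 1 Q k k] by simp
    have Qu: "?Q \<in> unitary_group UNIV ?n"
    proof (rule unitary_groupI)
      show "?Q * mat_adjoint ?Q = 1\<^sub>m ?n"
        by (subst mat_adjoint_four_block_diag, simp, simp, subst four_block_diag_mult, simp_all) 
    qed (use \<open>?Q \<in> carrier_mat ?n ?n\<close> in auto)
    have DD: "?DD = ?b ?e ?D"
      by (rule eq_matI) auto
    have "?b ?e B = ?Q * ?DD * mat_adjoint ?Q"
      unfolding DD B
      by (subst mat_adjoint_four_block_diag, simp, simp, subst four_block_diag_mult, simp_all,
          subst four_block_diag_mult, simp_all add: mult_carrier_mat[of _ _ 1] mult_carrier_mat[of _ _ k])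
    hence eq: "H * A * mat_adjoint H = ?Q * ?DD * mat_adjoint ?Q" using HB(4) by simp
    let ?P = "mat_adjoint H * ?Q"
    have Pu: "?P \<in> unitary_group UNIV ?n"
      by (intro unitary_group_UNIV_mult unitary_group_UNIV_adjoint[OF HB(1)] Qu)
    have "A = (mat_adjoint H * H) * A * (mat_adjoint H * H)"
      using unitary_groupD(3)[OF HB(1)] Suc.prems(1) by simp
    also have "\<dots> = mat_adjoint H * (H * A * mat_adjoint H) * H"
      using Suc.prems(1) by (simp add: assoc_mult_mat[of _ ?n ?n _ ?n _ ?n] mult_carrier_mat[of _ ?n ?n])
    also have "\<dots> = mat_adjoint H * (?Q * ?DD * mat_adjoint ?Q) * H" by (simp only: eq)
    also have "\<dots> = ?P * ?DD * (mat_adjoint ?Q * H)"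
      by (rule mat_mult_assoc5[OF mat_adjoint_carrier[OF unitary_groupD(1)[OF HB(1)]] unitary_groupD(1)[OF Qu]
            _ mat_adjoint_carrier[OF unitary_groupD(1)[OF Qu]] unitary_groupD(1)[OF HB(1)]]) simp
    also have "mat_adjoint ?Q * H = mat_adjoint ?P"
      by (subst mat_adjoint_mult[OF mat_adjoint_carrier[OF unitary_groupD(1)[OF HB(1)]] unitary_groupD(1)[OF Qu]]) simp
    finally have "A = ?P * ?DD * mat_adjoint ?P" .
    thus ?case using Pu by (intro bexI[of _ ?P] exI[of _ ?d])
  qed
  thus thesis using that by blast
qed

lemma char_poly_conjugate_diag:
  fixes d :: "nat \<Rightarrow> complex"
  assumes Q: "Q \<in> unitary_group UNIV n"
  shows "char_poly (Q * mat n n (\<lambda>(i, j). if i = j then d i else 0) * mat_adjoint Q)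
    = (\<Prod>i<n. [:- d i, 1:])"
proof -
  note [simp] = unitary_groupD(1)[OF Q]
  let ?D = "mat n n (\<lambda>(i, j). if i = j then d i else 0)"
  have "similar_mat (Q * ?D * mat_adjoint Q) ?D"
    by (rule similar_matI[of _ _ Q "mat_adjoint Q" n])
      (use unitary_groupD(2,3)[OF Q] in \<open>auto intro!: mult_carrier_mat[of _ n n]\<close>)
  hence "char_poly (Q * ?D * mat_adjoint Q) = char_poly ?D" by (rule char_poly_similar)
  also have "\<dots> = (\<Prod>a\<leftarrow>diag_mat ?D. [:- a, 1:])"
    by (rule char_poly_upper_triangular[of _ n]) auto
  also have "\<dots> = (\<Prod>i\<leftarrow>[0..<n]. [:- d i, 1:])"
    by (rule arg_cong[of _ _ prod_list]) (auto simp: diag_mat_def)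
  also have "\<dots> = (\<Prod>i<n. [:- d i, 1:])"
    by (subst prod.distinct_set_conv_list[symmetric]) (simp_all add: atLeast0LessThan)
  finally show ?thesis .
qed

text \<open>Only the left factor is produced: later computations see \<open>M\<close> only through
  \<open>M * mat_adjoint M\<close>. Conjugation preserves the characteristic polynomial, so the
  \<open>e k\<close> come with the multiplicities of the multiset
  \<open>singular_values M\<close>.\<close>

lemma singular_value_decomposition:
  fixes M :: "complex mat"
  assumes M: "M \<in> carrier_mat n m"
  obtains Q and e :: "nat \<Rightarrow> real" where "Q \<in> unitary_group UNIV n" "\<And>k. k < n \<Longrightarrow> 0 \<le> e k"
    "M * mat_adjoint M = Q * mat n n (\<lambda>(i, j). if i = j then complex_of_real (e i) else 0) * mat_adjoint Q"
    "singular_values M = image_mset (\<lambda>k. sqrt (e k)) (mset_set {..<n})"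
proof -
  let ?A = "M * mat_adjoint M"
  have A: "?A \<in> carrier_mat n n" by (rule mult_carrier_mat[OF M mat_adjoint_carrier[OF M]])
  have h: "mat_adjoint ?A = ?A"
    by (subst mat_adjoint_mult[OF M mat_adjoint_carrier[OF M]]) simp
  obtain Q and e :: "nat \<Rightarrow> real" where Q: "Q \<in> unitary_group UNIV n"
    and eq: "?A = Q * mat n n (\<lambda>(i, j). if i = j then complex_of_real (e i) else 0) * mat_adjoint Q"
    using hermitian_diagonalization[OF A h] by blast
  let ?D = "mat n n (\<lambda>(i, j). if i = j then complex_of_real (e i) else 0)"
  note Qc = unitary_groupD(1)[OF Q]
  let ?B = "mat_adjoint Q * M"
  have B: "?B \<in> carrier_mat n m" by (rule mult_carrier_mat[OF mat_adjoint_carrier[OF Qc] M])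
  have "?B * mat_adjoint ?B = mat_adjoint Q * ?A * Q"
    using Qc M by (simp add: mat_adjoint_mult[OF mat_adjoint_carrier[OF Qc] M]
      assoc_mult_mat[of _ n n _ m _ n] assoc_mult_mat[of _ n n _ n _ n] assoc_mult_mat[of _ n m _ m _ n]
      assoc_mult_mat[of _ n m _ n _ n]
      mult_carrier_mat[of _ n m] mult_carrier_mat[of _ m n] mult_carrier_mat[of _ n n])
  also have "\<dots> = mat_adjoint Q * Q * ?D * (mat_adjoint Q * Q)"
    unfolding eq by (rule mat_mult_assoc5[of _ n]) (use Qc in auto)
  also have "\<dots> = ?D" by (simp add: unitary_groupD(3)[OF Q] right_mult_one_mat[of _ n n])
  finally have BB: "?B * mat_adjoint ?B = ?D" .
  \<comment> \<open>Diagonal entry \<open>k\<close> is the squared norm of row \<open>k\<close> of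
    \<open>mat_adjoint Q * M\<close>.\<close>
  have pos: "0 \<le> e k" if k: "k < n" for k
  proof -
    have "complex_of_real (e k) = (?B * mat_adjoint ?B) $$ (k, k)" using k by (simp add: BB)
    also have "\<dots> = (\<Sum>s<m. ?B $$ (k, s) * mat_adjoint ?B $$ (s, k))"
      by (rule index_mult_sum[OF B mat_adjoint_carrier[OF B] k k])
    also have "\<dots> = (\<Sum>s<m. of_real ((cmod (?B $$ (k, s)))\<^sup>2))"
    proof (rule sum.cong[OF refl])
      fix s assume "s \<in> {..<m}"
      hence "mat_adjoint ?B $$ (s, k) = cnj (?B $$ (k, s))"
        using k B by (intro index_mat_adjoint) auto
      thus "?B $$ (k, s) * mat_adjoint ?B $$ (s, k) = of_real ((cmod (?B $$ (k, s)))\<^sup>2)"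
        by (simp only: complex_norm_square)
    qed
    also have "\<dots> = of_real (\<Sum>s<m. (cmod (?B $$ (k, s)))\<^sup>2)" by (simp only: of_real_sum)
    finally have "e k = (\<Sum>s<m. (cmod (?B $$ (k, s)))\<^sup>2)" by (simp only: of_real_eq_iff)
    thus ?thesis by (simp add: sum_nonneg)
  qed
  have "proots (char_poly ?A) = (\<Sum>i<n. proots [:- complex_of_real (e i), 1:])"
    unfolding eq char_poly_conjugate_diag[OF Q] by (rule proots_prod) auto
  also have "\<dots> = (\<Sum>i<n. {#complex_of_real (e i)#})"
    using proots_linear_factor[of "complex_of_real (e _)"] by (intro sum.cong) auto
  also have "\<dots> = image_mset (\<lambda>i. complex_of_real (e i)) (mset_set {..<n})"
    by (simp add: sum_unfold_sum_mset)
  finally have "singular_values M = image_mset (\<lambda>k. sqrt (e k)) (mset_set {..<n})"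
    by (simp add: singular_values_def multiset.map_comp o_def)
  with Q pos eq show thesis by (rule that)
qed

section \<open>Gaussian vectors\<close>

text \<open>Vectors are total functions on indices. Values from index \<open>n\<close> on are junk,
  which is why some later statements require invariance under changing them.\<close>

definition nsq :: "nat \<Rightarrow> (nat \<Rightarrow> complex) \<Rightarrow> real" where
  "nsq n v = (\<Sum>k<n. (cmod (v k))\<^sup>2)"

definition rowmul :: "nat \<Rightarrow> (nat \<Rightarrow> complex) \<Rightarrow> complex mat \<Rightarrow> nat \<Rightarrow> complex" where
  "rowmul n g A k = (\<Sum>i<n. g i * A $$ (i, k))"

definition colmul :: "nat \<Rightarrow> complex mat \<Rightarrow> (nat \<Rightarrow> complex) \<Rightarrow> nat \<Rightarrow> complex" where
  "colmul m A h i = (\<Sum>k<m. A $$ (i, k) * h k)"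

lemma nsq_nonneg [simp]: "0 \<le> nsq n v"
  by (simp add: nsq_def sum_nonneg)

lemma nsq_scale: "nsq n (\<lambda>k. c * v k) = (cmod c)\<^sup>2 * nsq n v"
  by (simp add: nsq_def norm_mult power_mult_distrib sum_distrib_left)

lemma rowmul_scale: "rowmul n (\<lambda>k. c * g k) A = (\<lambda>k. c * rowmul n g A k)"
  by (rule ext) (simp add: rowmul_def sum_distrib_left mult.assoc)

text \<open>The norm sees \<open>A\<close> only through \<open>A * mat_adjoint A\<close>, so a
  rectangular matrix may be traded for a square one with the same product.\<close>

lemma nsq_rowmul:
  assumes A: "A \<in> carrier_mat n m"
  shows "complex_of_real (nsq m (rowmul n g A))
    = (\<Sum>i<n. \<Sum>j<n. g i * cnj (g j) * (A * mat_adjoint A) $$ (i, j))"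
proof -
  have "complex_of_real (nsq m (rowmul n g A))
      = (\<Sum>k<m. (\<Sum>i<n. g i * A $$ (i, k)) * cnj (\<Sum>j<n. g j * A $$ (j, k)))"
    by (simp only: nsq_def rowmul_def of_real_sum complex_norm_square)
  also have "\<dots> = (\<Sum>k<m. \<Sum>i<n. \<Sum>j<n. g i * cnj (g j) * (A $$ (i, k) * cnj (A $$ (j, k))))"
    by (simp only: cnj_sum sum_product complex_cnj_mult) (simp only: mult_ac)
  also have "\<dots> = (\<Sum>i<n. \<Sum>k<m. \<Sum>j<n. g i * cnj (g j) * (A $$ (i, k) * cnj (A $$ (j, k))))"
    by (rule sum.swap)
  also have "\<dots> = (\<Sum>i<n. \<Sum>j<n. \<Sum>k<m. g i * cnj (g j) * (A $$ (i, k) * cnj (A $$ (j, k))))"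
    by (intro sum.cong refl sum.swap)
  also have "\<dots> = (\<Sum>i<n. \<Sum>j<n. g i * cnj (g j) * (A * mat_adjoint A) $$ (i, j))"
  proof (intro sum.cong refl)
    fix i j assume ij: "i \<in> {..<n}" "j \<in> {..<n}"
    have "(A * mat_adjoint A) $$ (i, j) = (\<Sum>k<m. A $$ (i, k) * mat_adjoint A $$ (k, j))"
      by (rule index_mult_sum[OF A mat_adjoint_carrier[OF A]]) (use ij in auto)
    also have "\<dots> = (\<Sum>k<m. A $$ (i, k) * cnj (A $$ (j, k)))"
      by (rule sum.cong) (use ij A in auto)
    finally show "(\<Sum>k<m. g i * cnj (g j) * (A $$ (i, k) * cnj (A $$ (j, k))))
        = g i * cnj (g j) * (A * mat_adjoint A) $$ (i, j)"
      by (simp add: sum_distrib_left)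
  qed
  finally show ?thesis .
qed

text \<open>Here only \<open>mat_adjoint A * A\<close> enters, which is unchanged when
  \<open>A\<close> is multiplied on the left by a unitary matrix.\<close>

lemma nsq_colmul:
  assumes A: "A \<in> carrier_mat n m"
  shows "complex_of_real (nsq n (colmul m A h))
    = (\<Sum>i<m. \<Sum>j<m. cnj (h i) * h j * (mat_adjoint A * A) $$ (i, j))"
proof -
  have "complex_of_real (nsq n (colmul m A h))
      = (\<Sum>k<n. cnj (\<Sum>i<m. A $$ (k, i) * h i) * (\<Sum>j<m. A $$ (k, j) * h j))"
    by (simp only: nsq_def colmul_def of_real_sum complex_norm_square mult.commute)
  also have "\<dots> = (\<Sum>k<n. \<Sum>i<m. \<Sum>j<m. cnj (h i) * h j * (cnj (A $$ (k, i)) * A $$ (k, j)))"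
    by (simp only: cnj_sum sum_product complex_cnj_mult) (simp only: mult_ac)
  also have "\<dots> = (\<Sum>i<m. \<Sum>k<n. \<Sum>j<m. cnj (h i) * h j * (cnj (A $$ (k, i)) * A $$ (k, j)))"
    by (rule sum.swap)
  also have "\<dots> = (\<Sum>i<m. \<Sum>j<m. \<Sum>k<n. cnj (h i) * h j * (cnj (A $$ (k, i)) * A $$ (k, j)))"
    by (intro sum.cong refl sum.swap)
  also have "\<dots> = (\<Sum>i<m. \<Sum>j<m. cnj (h i) * h j * (mat_adjoint A * A) $$ (i, j))"
  proof (intro sum.cong refl)
    fix i j assume ij: "i \<in> {..<m}" "j \<in> {..<m}"
    have "(mat_adjoint A * A) $$ (i, j) = (\<Sum>k<n. mat_adjoint A $$ (i, k) * A $$ (k, j))"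
      by (rule index_mult_sum[OF mat_adjoint_carrier[OF A] A]) (use ij in auto)
    also have "\<dots> = (\<Sum>k<n. cnj (A $$ (k, i)) * A $$ (k, j))"
      by (rule sum.cong) (use ij A in auto)
    finally show "(\<Sum>k<n. cnj (h i) * h j * (cnj (A $$ (k, i)) * A $$ (k, j)))
        = cnj (h i) * h j * (mat_adjoint A * A) $$ (i, j)"
      by (simp add: sum_distrib_left)
  qed
  finally show ?thesis .
qed

section \<open>Standard Gaussian laws and their exponential integrals\<close>

definition std_gauss :: "real measure" where
  "std_gauss = density lborel std_normal_density"

lemma sets_std_gauss [simp, measurable_cong]: "sets std_gauss = sets borel"
  and space_std_gauss [simp]: "space std_gauss = UNIV"
  by (simp_all add: std_gauss_def)

interpretation std_gauss: prob_space std_gauss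
  unfolding std_gauss_def by (rule prob_space_normal_density) simp

lemma nn_integral_normal_density:
  assumes "\<sigma> > 0"
  shows "(\<integral>\<^sup>+x. ennreal (normal_density \<mu> \<sigma> x) \<partial>lborel) = 1"
  using prob_space.emeasure_space_1[OF prob_space_normal_density[OF assms, of \<mu>]]
  by (simp add: emeasure_density)

lemma std_gauss_exp_linear:
  "(\<integral>\<^sup>+t. ennreal (exp (t * a)) \<partial>std_gauss) = ennreal (exp (a\<^sup>2 / 2))"
proof -
  have "(\<integral>\<^sup>+t. ennreal (exp (t * a)) \<partial>std_gauss)
      = (\<integral>\<^sup>+t. ennreal (std_normal_density t) * ennreal (exp (t * a)) \<partial>lborel)"
    unfolding std_gauss_def by (subst nn_integral_density) auto
  also have "\<dots> = (\<integral>\<^sup>+t. ennreal (exp (a\<^sup>2 / 2)) * ennreal (normal_density a 1 t) \<partial>lborel)"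
  proof (rule nn_integral_cong)
    fix t :: real
    have "std_normal_density t * exp (t * a) = exp (a\<^sup>2 / 2) * normal_density a 1 t"
    proof -
      have "- t\<^sup>2 / 2 + t * a = a\<^sup>2 / 2 + - (t - a)\<^sup>2 / 2" by (simp add: power2_eq_square field_simps)
      hence "exp (- t\<^sup>2 / 2) * exp (t * a) = exp (a\<^sup>2 / 2) * exp (- (t - a)\<^sup>2 / 2)"
        by (simp only: mult_exp_exp)
      thus ?thesis by (simp add: normal_density_def)
    qed
    thus "ennreal (std_normal_density t) * ennreal (exp (t * a))
        = ennreal (exp (a\<^sup>2 / 2)) * ennreal (normal_density a 1 t)"
      by (simp flip: ennreal_mult)
  qed
  also have "\<dots> = ennreal (exp (a\<^sup>2 / 2))"
    by (simp add: nn_integral_cmult nn_integral_normal_density)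
  finally show ?thesis .
qed

text \<open>Up to the factor \<open>s\<close>, the integrand is the centred normal density with
  variance \<open>1 / (1 - x)\<close>.\<close>

lemma std_gauss_exp_square:
  assumes "x < 1"
  shows "(\<integral>\<^sup>+t. ennreal (exp (x * t\<^sup>2 / 2)) \<partial>std_gauss) = ennreal ((1 - x) powr (- (1 / 2)))"
proof -
  define s where "s = 1 / sqrt (1 - x)"
  have s: "s > 0" "s\<^sup>2 = 1 / (1 - x)" using assms by (auto simp: s_def power_divide)
  have "(\<integral>\<^sup>+t. ennreal (exp (x * t\<^sup>2 / 2)) \<partial>std_gauss)
      = (\<integral>\<^sup>+t. ennreal (std_normal_density t) * ennreal (exp (x * t\<^sup>2 / 2)) \<partial>lborel)"
    unfolding std_gauss_def by (subst nn_integral_density) auto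
  also have "\<dots> = (\<integral>\<^sup>+t. ennreal s * ennreal (normal_density 0 s t) \<partial>lborel)"
  proof (rule nn_integral_cong)
    fix t :: real
    have "exp (- t\<^sup>2 / 2) * exp (x * t\<^sup>2 / 2) = exp (- t\<^sup>2 / (2 * s\<^sup>2))"
      using assms by (simp add: mult_exp_exp s(2) field_simps)
    hence "std_normal_density t * exp (x * t\<^sup>2 / 2) = s * normal_density 0 s t"
      using s(1) by (simp add: normal_density_def real_sqrt_mult)
    thus "ennreal (std_normal_density t) * ennreal (exp (x * t\<^sup>2 / 2))
        = ennreal s * ennreal (normal_density 0 s t)"
      using s(1) by (simp flip: ennreal_mult)
  qed
  also have "\<dots> = ennreal s" using s(1) by (simp add: nn_integral_cmult nn_integral_normal_density)
  also have "s = (1 - x) powr (- (1 / 2))"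
    using assms powr_minus_divide[of "1 - x" "1 / 2"] powr_half_sqrt[of "1 - x"] by (simp add: s_def)
  finally show ?thesis .
qed

text \<open>
  A Gaussian vector over the field \<open>F\<close> has independent standard normal real coordinates,
  indexed by pairs; the second component marks imaginary parts and is absent over \<open>\<real>\<close>.
\<close>

definition parts :: "complex set \<Rightarrow> bool set" where
  "parts F = (if F = \<real> then {False} else UNIV)"

definition gauss :: "complex set \<Rightarrow> nat \<Rightarrow> (nat \<times> bool \<Rightarrow> real) measure" where
  "gauss F n = Pi\<^sub>M ({..<n} \<times> parts F) (\<lambda>_. std_gauss)"

definition gvec :: "complex set \<Rightarrow> (nat \<times> bool \<Rightarrow> real) \<Rightarrow> nat \<Rightarrow> complex" where
  "gvec F \<omega> k = (\<Sum>b\<in>parts F. (if b then \<i> else 1) * of_real (\<omega> (k, b)))"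

lemma UNIV_neq_Reals: "(UNIV :: complex set) \<noteq> \<real>"
  by (metis UNIV_I complex_is_Real_iff imaginary_unit.simps(2) zero_neq_one)

lemma parts_Reals [simp]: "parts \<real> = {False}"
  and parts_UNIV [simp]: "parts UNIV = UNIV"
  by (auto simp: parts_def UNIV_neq_Reals)

lemma finite_parts [simp]: "finite (parts F)"
  by (simp add: parts_def)

lemma UNIV_bool_sum: "sum f (UNIV :: bool set) = f False + f True"
  by (simp add: UNIV_bool)

lemma gvec_Reals: "gvec \<real> \<omega> k = of_real (\<omega> (k, False))"
  and gvec_UNIV: "gvec UNIV \<omega> k = of_real (\<omega> (k, False)) + \<i> * of_real (\<omega> (k, True))"
  by (simp_all add: gvec_def UNIV_bool_sum)

lemma gvec_in: "F = \<real> \<or> F = UNIV \<Longrightarrow> gvec F \<omega> k \<in> F"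
  by (auto simp: gvec_Reals)

lemma prob_space_gauss: "prob_space (gauss F n)"
  unfolding gauss_def by (intro prob_space_PiM std_gauss.prob_space_axioms)

lemma measurable_gvec [measurable]:
  assumes "k < n"
  shows "(\<lambda>\<omega>. gvec F \<omega> k) \<in> borel_measurable (gauss F n)"
proof -
  have [measurable]: "(\<lambda>\<omega>. \<omega> (k, b)) \<in> borel_measurable (gauss F n)" if "b \<in> parts F" for b
    unfolding gauss_def using measurable_component_singleton[of "(k, b)" "{..<n} \<times> parts F" "\<lambda>_. std_gauss"] assms that
    by simp
  show ?thesis unfolding gvec_def by (intro borel_measurable_sum) (measurable; simp)
qed

lemma cmod_gvec: "F = \<real> \<or> F = UNIV \<Longrightarrow> (cmod (gvec F \<omega> k))\<^sup>2 = (\<Sum>b\<in>parts F. (\<omega> (k, b))\<^sup>2)"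
  by (auto simp: gvec_Reals gvec_UNIV UNIV_bool_sum cmod_power2)

lemma product_sigma_finite_std_gauss: "product_sigma_finite (\<lambda>_ :: 'i. std_gauss)"
  by standard

text \<open>The exponent is a real linear form in the independent coordinates, with coefficient
  \<open>- Im (a k)\<close> on the imaginary ones. Over the reals \<open>a\<close> has to be real,
  since otherwise part of its norm would be invisible to the form.\<close>

lemma gauss_exp_linear:
  assumes F: "F = \<real> \<or> F = UNIV" and a: "\<And>k. k < n \<Longrightarrow> a k \<in> F"
  shows "(\<integral>\<^sup>+\<omega>. ennreal (exp (Re (\<Sum>k<n. gvec F \<omega> k * a k))) \<partial>gauss F n) = ennreal (exp (nsq n a / 2))"
proof -
  interpret product_sigma_finite "\<lambda>_ :: nat \<times> bool. std_gauss" by (rule product_sigma_finite_std_gauss)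
  define c where "c = (\<lambda>(k, b). if b then - Im (a k) else Re (a k))"
  let ?I = "{..<n} \<times> parts F"
  have "Re (\<Sum>k<n. gvec F \<omega> k * a k) = (\<Sum>i\<in>?I. \<omega> i * c i)" for \<omega>
    using F by (auto simp: sum.cartesian_product' gvec_Reals gvec_UNIV UNIV_bool_sum c_def)
  hence "(\<integral>\<^sup>+\<omega>. ennreal (exp (Re (\<Sum>k<n. gvec F \<omega> k * a k))) \<partial>gauss F n)
      = (\<integral>\<^sup>+\<omega>. (\<Prod>i\<in>?I. ennreal (exp (\<omega> i * c i))) \<partial>gauss F n)"
    by (simp add: exp_sum prod_ennreal)
  also have "\<dots> = (\<Prod>i\<in>?I. \<integral>\<^sup>+t. ennreal (exp (t * c i)) \<partial>std_gauss)"
    unfolding gauss_def by (rule product_nn_integral_prod) auto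
  also have "\<dots> = ennreal (\<Prod>i\<in>?I. exp ((c i)\<^sup>2 / 2))"
    by (simp add: std_gauss_exp_linear prod_ennreal)
  also have "(\<Prod>i\<in>?I. exp ((c i)\<^sup>2 / 2)) = exp (\<Sum>i\<in>?I. (c i)\<^sup>2 / 2)"
    by (simp add: exp_sum)
  also have "(\<Sum>i\<in>?I. (c i)\<^sup>2 / 2) = nsq n a / 2"
  proof -
    have "(\<Sum>b\<in>parts F. (c (k, b))\<^sup>2 / 2) = (cmod (a k))\<^sup>2 / 2" if "k < n" for k
      using F a[OF that] by (auto simp: c_def UNIV_bool_sum cmod_power2 complex_is_Real_iff add_divide_distrib)
    thus ?thesis
      unfolding nsq_def sum.cartesian_product' sum_divide_distrib by (intro sum.cong) auto
  qed
  finally show ?thesis .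
qed

text \<open>Each index carries \<open>card (parts F)\<close> independent real coordinates; this is
  where \<beta> enters the exponent.\<close>

lemma gauss_exp_diagonal:
  assumes F: "F = \<real> \<or> F = UNIV" and e: "\<And>k. k < n \<Longrightarrow> e k < 1"
  shows "(\<integral>\<^sup>+\<omega>. ennreal (exp ((\<Sum>k<n. e k * (cmod (gvec F \<omega> k))\<^sup>2) / 2)) \<partial>gauss F n)
    = ennreal (\<Prod>k<n. (1 - e k) powr (- card (parts F) / 2))"
proof -
  interpret product_sigma_finite "\<lambda>_ :: nat \<times> bool. std_gauss" by (rule product_sigma_finite_std_gauss)
  let ?I = "{..<n} \<times> parts F"
  have "(\<Sum>k<n. e k * (cmod (gvec F \<omega> k))\<^sup>2) / 2 = (\<Sum>i\<in>?I. e (fst i) * (\<omega> i)\<^sup>2 / 2)" for \<omega>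
    by (simp add: sum.cartesian_product' cmod_gvec[OF F] sum_distrib_left sum_divide_distrib)
  hence "(\<integral>\<^sup>+\<omega>. ennreal (exp ((\<Sum>k<n. e k * (cmod (gvec F \<omega> k))\<^sup>2) / 2)) \<partial>gauss F n)
      = (\<integral>\<^sup>+\<omega>. (\<Prod>i\<in>?I. ennreal (exp (e (fst i) * (\<omega> i)\<^sup>2 / 2))) \<partial>gauss F n)"
    by (simp add: exp_sum prod_ennreal)
  also have "\<dots> = (\<Prod>i\<in>?I. \<integral>\<^sup>+t. ennreal (exp (e (fst i) * t\<^sup>2 / 2)) \<partial>std_gauss)"
    unfolding gauss_def by (rule product_nn_integral_prod) auto
  also have "\<dots> = (\<Prod>i\<in>?I. ennreal ((1 - e (fst i)) powr (- (1 / 2))))"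
    by (rule prod.cong) (auto intro!: std_gauss_exp_square e)
  also have "\<dots> = ennreal (\<Prod>i\<in>?I. (1 - e (fst i)) powr (- (1 / 2)))"
    by (simp add: prod_ennreal)
  also have "(\<Prod>i\<in>?I. (1 - e (fst i)) powr (- (1 / 2))) = (\<Prod>k<n. \<Prod>b\<in>parts F. (1 - e k) powr (- (1 / 2)))"
    by (simp add: prod.cartesian_product')
  also have "\<dots> = (\<Prod>k<n. (1 - e k) powr (- card (parts F) / 2))"
    using e by (intro prod.cong) (auto simp: powr_realpow[symmetric] powr_powr less_imp_neq)
  finally show ?thesis .
qed

section \<open>Exchange, rotation invariance and Gaussian quadratic forms\<close>

lemma measurable_rowmul [measurable]:
  "(\<lambda>\<omega>. rowmul n (gvec F \<omega>) A k) \<in> borel_measurable (gauss F n)"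
  unfolding rowmul_def by measurable

lemma measurable_colmul [measurable]:
  "(\<lambda>\<omega>. colmul n A (gvec F \<omega>) k) \<in> borel_measurable (gauss F n)"
  unfolding colmul_def by measurable

text \<open>
  Both sides are the integral of \<open>exp (Re (g A h))\<close> over independent Gaussian vectors
  \<open>g\<close> and \<open>h\<close>, in the two orders of integration.
\<close>

lemma gauss_exchange:
  assumes F: "F = \<real> \<or> F = UNIV"
    and AF: "\<And>i k. i < n \<Longrightarrow> k < m \<Longrightarrow> A $$ (i, k) \<in> F"
  shows "(\<integral>\<^sup>+\<omega>. ennreal (exp (nsq m (rowmul n (gvec F \<omega>) A) / 2)) \<partial>gauss F n)
    = (\<integral>\<^sup>+\<omega>. ennreal (exp (nsq n (colmul m A (gvec F \<omega>)) / 2)) \<partial>gauss F m)"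
proof -
  interpret gn: prob_space "gauss F n" by (rule prob_space_gauss)
  interpret gm: prob_space "gauss F m" by (rule prob_space_gauss)
  interpret pair_sigma_finite "gauss F n" "gauss F m" ..
  have inF: "(\<Sum>i\<in>I. x i * y i) \<in> F" if "\<And>i. i \<in> I \<Longrightarrow> x i \<in> F" "\<And>i. i \<in> I \<Longrightarrow> y i \<in> F"
    for I and x y :: "nat \<Rightarrow> complex"
    using F that by (auto intro!: sum_in_Reals Reals_mult)
  let ?f = "\<lambda>\<omega> \<omega>'. ennreal (exp (Re (\<Sum>k<m. gvec F \<omega>' k * rowmul n (gvec F \<omega>) A k)))"
  have f2: "?f \<omega> \<omega>' = ennreal (exp (Re (\<Sum>i<n. gvec F \<omega> i * colmul m A (gvec F \<omega>') i)))" for \<omega> \<omega>'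
  proof -
    have "(\<Sum>k<m. gvec F \<omega>' k * rowmul n (gvec F \<omega>) A k) = (\<Sum>k<m. \<Sum>i<n. gvec F \<omega> i * (A $$ (i, k) * gvec F \<omega>' k))"
      by (simp add: rowmul_def sum_distrib_left mult_ac)
    also have "\<dots> = (\<Sum>i<n. gvec F \<omega> i * colmul m A (gvec F \<omega>') i)"
      unfolding colmul_def sum_distrib_left by (rule sum.swap)
    finally show ?thesis by simp
  qed
  have "(\<integral>\<^sup>+\<omega>. ennreal (exp (nsq m (rowmul n (gvec F \<omega>) A) / 2)) \<partial>gauss F n)
      = (\<integral>\<^sup>+\<omega>. \<integral>\<^sup>+\<omega>'. ?f \<omega> \<omega>' \<partial>gauss F m \<partial>gauss F n)"
    by (subst gauss_exp_linear[OF F])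
      (auto simp: rowmul_def intro!: inF gvec_in[OF F] AF)
  also have "\<dots> = (\<integral>\<^sup>+\<omega>'. \<integral>\<^sup>+\<omega>. ?f \<omega> \<omega>' \<partial>gauss F n \<partial>gauss F m)"
    by (rule Fubini'[symmetric]) measurable
  also have "\<dots> = (\<integral>\<^sup>+\<omega>'. ennreal (exp (nsq n (colmul m A (gvec F \<omega>')) / 2)) \<partial>gauss F m)"
    unfolding f2
    by (subst gauss_exp_linear[OF F])
      (auto simp: colmul_def intro!: inF gvec_in[OF F] AF)
  finally show ?thesis .
qed

text \<open>Rotation invariance without a change of variables: after \<open>gauss_exchange\<close>
  only \<open>mat_adjoint A * A\<close> matters, and the unitary factor cancels in it.\<close>

lemma gauss_rotation:
  assumes F: "F = \<real> \<or> F = UNIV" and U: "U \<in> unitary_group F n" and A: "A \<in> carrier_mat n m"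
    and AF: "\<And>i k. i < n \<Longrightarrow> k < m \<Longrightarrow> A $$ (i, k) \<in> F"
  shows "(\<integral>\<^sup>+\<omega>. ennreal (exp (nsq m (rowmul n (gvec F \<omega>) (U * A)) / 2)) \<partial>gauss F n)
    = (\<integral>\<^sup>+\<omega>. ennreal (exp (nsq m (rowmul n (gvec F \<omega>) A) / 2)) \<partial>gauss F n)"
proof -
  note Uc = unitary_groupD(1)[OF U]
  have UA: "U * A \<in> carrier_mat n m" by (rule mult_carrier_mat[OF Uc A])
  have "mat_adjoint (U * A) * (U * A) = mat_adjoint A * ((mat_adjoint U * U) * A)"
    using Uc A by (simp add: mat_adjoint_mult[OF Uc A] assoc_mult_mat[of _ m n _ n _ m]
      assoc_mult_mat[of _ n n _ n _ m])
  also have "\<dots> = mat_adjoint A * A" using A by (simp add: unitary_groupD(3)[OF U])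
  finally have "complex_of_real (nsq n (colmul m (U * A) h)) = complex_of_real (nsq n (colmul m A h))" for h
    by (simp only: nsq_colmul[OF UA] nsq_colmul[OF A])
  hence eq: "nsq n (colmul m (U * A) h) = nsq n (colmul m A h)" for h by (simp only: of_real_eq_iff)
  have UAF: "(U * A) $$ (i, k) \<in> F" if "i < n" "k < m" for i k
    using F that unitary_groupD(4)[OF U] AF
    by (subst index_mult_sum[OF Uc A]) (auto intro!: sum_in_Reals Reals_mult)
  show ?thesis
    using gauss_exchange[OF F UAF] gauss_exchange[OF F AF] by (simp add: eq)
qed

text \<open>With \<open>S\<close> the square root of the diagonal matrix \<open>D\<close>, the
  matrix \<open>B = Q * S\<close> satisfies \<open>B * mat_adjoint B = M * mat_adjoint M\<close>,
  but \<open>mat_adjoint B * B = D\<close>. The exchange passes from the first product to the second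
  and so diagonalizes the quadratic form.\<close>

lemma gauss_exp_quadratic_complex:
  fixes M :: "complex mat" and e :: "nat \<Rightarrow> real"
  assumes M: "M \<in> carrier_mat n m" and Q: "Q \<in> unitary_group UNIV n"
    and e: "\<And>k. k < n \<Longrightarrow> 0 \<le> e k"
    and MM: "M * mat_adjoint M = Q * mat n n (\<lambda>(i, j). if i = j then complex_of_real (e i) else 0) * mat_adjoint Q"
    and x: "0 \<le> x" "\<And>k. k < n \<Longrightarrow> x * e k < 1"
  shows "(\<integral>\<^sup>+\<omega>. ennreal (exp (x * nsq m (rowmul n (gvec UNIV \<omega>) M) / 2)) \<partial>gauss UNIV n)
    = ennreal (\<Prod>k<n. (1 - x * e k) powr (- 1))"
proof -
  let ?D = "mat n n (\<lambda>(i, j). if i = j then complex_of_real (e i) else 0)"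
  let ?S = "mat n n (\<lambda>(i, j). if i = j then complex_of_real (sqrt (e i)) else 0)"
  let ?T = "mat n n (\<lambda>(i, j). if i = j then complex_of_real (sqrt x) else 0)"
  note Qc = unitary_groupD(1)[OF Q]
  have S: "?S \<in> carrier_mat n n" by simp
  have Sa: "mat_adjoint ?S = ?S" by (rule eq_matI) auto
  have SS: "?S * ?S = ?D"
  proof (rule eq_matI)
    fix i j assume "i < dim_row ?D" "j < dim_col ?D"
    hence i: "i < n" and j: "j < n" by auto
    have "(?S * ?S) $$ (i, j) = (\<Sum>k<n. ?S $$ (i, k) * ?S $$ (k, j))"
      by (rule index_mult_sum[OF S S i j])
    also have "\<dots> = (\<Sum>k<n. if k = i then if i = j then complex_of_real (e i) else 0 else 0)"
      by (rule sum.cong) (use i j e in \<open>auto simp flip: of_real_mult\<close>)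
    also have "\<dots> = ?D $$ (i, j)" using i j by simp
    finally show "(?S * ?S) $$ (i, j) = ?D $$ (i, j)" .
  qed auto
  let ?B = "Q * ?S"
  have B: "?B \<in> carrier_mat n n" by (rule mult_carrier_mat[OF Qc S])
  have "?B * mat_adjoint ?B = Q * ?S * (?S * mat_adjoint Q)"
    by (simp add: mat_adjoint_mult[OF Qc S] Sa)
  also have "\<dots> = Q * (?S * ?S) * mat_adjoint Q"
    using Qc by (simp add: assoc_mult_mat[of _ n n _ n _ n] mult_carrier_mat[of _ n n])
  finally have BB: "?B * mat_adjoint ?B = M * mat_adjoint M" by (simp only: SS MM)
  have "mat_adjoint ?B * ?B = ?S * ((mat_adjoint Q * Q) * ?S)"
    using Qc by (simp add: mat_adjoint_mult[OF Qc S] Sa assoc_mult_mat[of _ n n _ n _ n] mult_carrier_mat[of _ n n])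
  hence B'B: "mat_adjoint ?B * ?B = ?D" by (simp add: unitary_groupD(3)[OF Q] SS)
  have "complex_of_real (nsq m (rowmul n g M)) = complex_of_real (nsq n (rowmul n g ?B))" for g
    by (simp only: nsq_rowmul[OF M] nsq_rowmul[OF B] BB)
  hence eq1: "nsq m (rowmul n g M) = nsq n (rowmul n g ?B)" for g by (simp only: of_real_eq_iff)
  have "complex_of_real (nsq n (colmul n ?B h)) = complex_of_real (\<Sum>k<n. e k * (cmod (h k))\<^sup>2)" for h
  proof -
    have "complex_of_real (nsq n (colmul n ?B h)) = (\<Sum>i<n. \<Sum>j<n. cnj (h i) * h j * ?D $$ (i, j))"
      by (simp only: nsq_colmul[OF B] B'B)
    also have "\<dots> = (\<Sum>i<n. complex_of_real (e i * (cmod (h i))\<^sup>2))"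
    proof (rule sum.cong[OF refl])
      fix i assume i: "i \<in> {..<n}"
      have "(\<Sum>j<n. cnj (h i) * h j * ?D $$ (i, j)) = (\<Sum>j<n. if j = i then cnj (h i) * h i * e i else 0)"
        by (rule sum.cong) (use i in auto)
      also have "\<dots> = cnj (h i) * h i * e i" using i by simp
      finally show "(\<Sum>j<n. cnj (h i) * h j * ?D $$ (i, j)) = complex_of_real (e i * (cmod (h i))\<^sup>2)"
        by (simp only: of_real_mult complex_norm_square mult_ac)
    qed
    finally show ?thesis by (simp only: of_real_sum)
  qed
  hence eq2: "nsq n (colmul n ?B h) = (\<Sum>k<n. e k * (cmod (h k))\<^sup>2)" for h by (simp only: of_real_eq_iff)
  \<comment> \<open>The exchange has no scalar parameter, so the factor \<open>x\<close> is moved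
    into the matrix as \<open>sqrt x\<close>.\<close>
  let ?C = "mat n n (\<lambda>(i, j). complex_of_real (sqrt x) * ?B $$ (i, j))"
  have r: "rowmul n g ?C k = complex_of_real (sqrt x) * rowmul n g ?B k" if "k < n" for g k
    using that by (simp add: rowmul_def sum_distrib_left mult_ac del: index_mult_mat)
  have c: "colmul n ?C h k = complex_of_real (sqrt x) * colmul n ?B h k" if "k < n" for h k
    using that by (simp add: colmul_def sum_distrib_left mult_ac del: index_mult_mat)
  have nr: "nsq n (rowmul n g ?C) = x * nsq m (rowmul n g M)" for g
  proof -
    have "nsq n (rowmul n g ?C) = nsq n (\<lambda>k. complex_of_real (sqrt x) * rowmul n g ?B k)"
      unfolding nsq_def by (intro sum.cong refl) (simp only: r lessThan_iff)
    also have "\<dots> = x * nsq n (rowmul n g ?B)" using x(1) by (subst nsq_scale) simp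
    finally show ?thesis by (simp only: eq1)
  qed
  have nc: "nsq n (colmul n ?C h) = (\<Sum>k<n. x * e k * (cmod (h k))\<^sup>2)" for h
  proof -
    have "nsq n (colmul n ?C h) = nsq n (\<lambda>k. complex_of_real (sqrt x) * colmul n ?B h k)"
      unfolding nsq_def by (intro sum.cong refl) (simp only: c lessThan_iff)
    also have "\<dots> = x * nsq n (colmul n ?B h)" using x(1) by (subst nsq_scale) simp
    finally show ?thesis by (simp only: eq2 sum_distrib_left mult.assoc)
  qed
  have "(\<integral>\<^sup>+\<omega>. ennreal (exp (nsq n (rowmul n (gvec UNIV \<omega>) ?C) / 2)) \<partial>gauss UNIV n)
      = (\<integral>\<^sup>+\<omega>. ennreal (exp (nsq n (colmul n ?C (gvec UNIV \<omega>)) / 2)) \<partial>gauss UNIV n)"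
    by (rule gauss_exchange) auto
  also have "\<dots> = ennreal (\<Prod>k<n. (1 - x * e k) powr (- card (parts UNIV) / 2))"
    unfolding nc by (rule gauss_exp_diagonal) (use x in auto)
  finally show ?thesis by (simp add: nr UNIV_bool)
qed

text \<open>For a real matrix the real and imaginary parts of the vector contribute separately to
  the squared norm, so the complex integral splits into two equal real ones. This transfers the
  complex diagonalization, whose \<open>Q\<close> need not be real, to the real case.\<close>

lemma gauss_complex_eq_real_square:
  fixes M :: "complex mat"
  assumes MR: "\<And>i k. i < n \<Longrightarrow> k < m \<Longrightarrow> M $$ (i, k) \<in> \<real>"
  shows "(\<integral>\<^sup>+\<omega>. ennreal (exp (x * nsq m (rowmul n (gvec UNIV \<omega>) M) / 2)) \<partial>gauss UNIV n)
    = (\<integral>\<^sup>+\<omega>. ennreal (exp (x * nsq m (rowmul n (gvec \<real> \<omega>) M) / 2)) \<partial>gauss \<real> n)\<^sup>2"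
proof -
  interpret product_sigma_finite "\<lambda>_ :: nat \<times> bool. std_gauss" by (rule product_sigma_finite_std_gauss)
  define I where "I = {..<n} \<times> {False}"
  define J where "J = {..<n} \<times> {True}"
  have IJ: "I \<inter> J = {}" "finite I" "finite J" "{..<n} \<times> UNIV = I \<union> J" by (auto simp: I_def J_def)
  let ?P = "\<lambda>I. Pi\<^sub>M I (\<lambda>_. std_gauss)"
  have gR: "gauss \<real> n = ?P I" and gC: "gauss UNIV n = ?P (I \<union> J)"
    by (simp_all add: gauss_def IJ(4)[symmetric]) (simp add: I_def)
  define f where "f = (\<lambda>v :: nat \<Rightarrow> real. ennreal (exp (x * nsq m (rowmul n (\<lambda>k. of_real (v k)) M) / 2)))"
  have f_cong: "f v = f v'" if "\<And>k. k < n \<Longrightarrow> v k = v' k" for v v'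
    unfolding f_def rowmul_def using that by simp
  have fmeas: "(\<lambda>\<omega>. f (\<lambda>k. \<omega> (k, b))) \<in> borel_measurable (?P ({..<n} \<times> {b}))" for b
  proof -
    have [measurable]: "(\<lambda>\<omega>. \<omega> (k, b)) \<in> borel_measurable (?P ({..<n} \<times> {b}))" if "k < n" for k
      using measurable_component_singleton[of "(k, b)" "{..<n} \<times> {b}" "\<lambda>_. std_gauss"] that by simp
    show ?thesis unfolding f_def rowmul_def nsq_def by measurable
  qed
  have split: "ennreal (exp (x * nsq m (rowmul n (gvec UNIV \<omega>) M) / 2))
      = f (\<lambda>k. \<omega> (k, False)) * f (\<lambda>k. \<omega> (k, True))" for \<omega>
  proof -
    have "nsq m (rowmul n (gvec UNIV \<omega>) M)
        = nsq m (rowmul n (\<lambda>k. of_real (\<omega> (k, False))) M) + nsq m (rowmul n (\<lambda>k. of_real (\<omega> (k, True))) M)"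
      unfolding nsq_def sum.distrib[symmetric]
    proof (rule sum.cong[OF refl])
      fix k assume k: "k \<in> {..<m}"
      have "rowmul n (\<lambda>k. of_real (\<omega> (k, b))) M k \<in> \<real>" for b
        using MR k unfolding rowmul_def by (intro sum_in_Reals Reals_mult) auto
      hence im: "Im (rowmul n (\<lambda>k. of_real (\<omega> (k, b))) M k) = 0" for b
        by (simp add: complex_is_Real_iff)
      have "rowmul n (gvec UNIV \<omega>) M k
          = rowmul n (\<lambda>k. of_real (\<omega> (k, False))) M k + \<i> * rowmul n (\<lambda>k. of_real (\<omega> (k, True))) M k"
        by (simp add: rowmul_def gvec_UNIV sum.distrib sum_distrib_left algebra_simps)
      thus "(cmod (rowmul n (gvec UNIV \<omega>) M k))\<^sup>2 = (cmod (rowmul n (\<lambda>k. of_real (\<omega> (k, False))) M k))\<^sup>2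
          + (cmod (rowmul n (\<lambda>k. of_real (\<omega> (k, True))) M k))\<^sup>2"
        by (simp add: cmod_power2 im)
    qed
    thus ?thesis by (simp add: f_def distrib_left add_divide_distrib exp_add ennreal_mult')
  qed
  have meas2: "(\<lambda>\<omega>. f (\<lambda>k. \<omega> (k, False)) * f (\<lambda>k. \<omega> (k, True))) \<in> borel_measurable (?P (I \<union> J))"
  proof -
    have [measurable]: "(\<lambda>\<omega>. \<omega> (k, b)) \<in> borel_measurable (?P (I \<union> J))" if "k < n" for k b
      using measurable_component_singleton[of "(k, b)" "I \<union> J" "\<lambda>_. std_gauss"] that
      by (cases b) (auto simp: I_def J_def)
    show ?thesis unfolding f_def rowmul_def nsq_def by measurable
  qed
  \<comment> \<open>Relabelling the flag of each coordinate carries one product measure to the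
    other.\<close>
  have re: "(\<integral>\<^sup>+\<omega>. f (\<lambda>k. \<omega> (k, True)) \<partial>?P J) = (\<integral>\<^sup>+\<omega>. f (\<lambda>k. \<omega> (k, False)) \<partial>?P I)"
  proof -
    let ?h = "\<lambda>i :: nat \<times> bool. (fst i, False)"
    have d: "distr (?P I) (?P J) (\<lambda>\<omega>. \<lambda>i\<in>J. \<omega> (?h i)) = ?P J"
      by (rule distr_PiM_reindex[where M="\<lambda>_. std_gauss"]) (auto simp: inj_on_def I_def J_def std_gauss.prob_space_axioms)
    have "(\<integral>\<^sup>+\<omega>. f (\<lambda>k. \<omega> (k, True)) \<partial>?P J)
        = (\<integral>\<^sup>+\<omega>. f (\<lambda>k. \<omega> (k, True)) \<partial>distr (?P I) (?P J) (\<lambda>\<omega>. \<lambda>i\<in>J. \<omega> (?h i)))"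
      by (simp only: d)
    also have "\<dots> = (\<integral>\<^sup>+\<omega>. f (\<lambda>k. (\<lambda>i\<in>J. \<omega> (?h i)) (k, True)) \<partial>?P I)"
    proof (rule nn_integral_distr)
      show "(\<lambda>\<omega>. \<lambda>i\<in>J. \<omega> (?h i)) \<in> measurable (?P I) (?P J)"
      proof (rule measurable_restrict)
        fix i assume "i \<in> J"
        hence "?h i \<in> I" by (auto simp: I_def J_def)
        from measurable_component_singleton[OF this, of "\<lambda>_. std_gauss"]
        show "(\<lambda>\<omega>. \<omega> (?h i)) \<in> measurable (?P I) std_gauss" .
      qed
      show "(\<lambda>\<omega>. f (\<lambda>k. \<omega> (k, True))) \<in> borel_measurable (distr (?P I) (?P J) (\<lambda>\<omega>. \<lambda>i\<in>J. \<omega> (?h i)))"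
        using fmeas[of True] by (simp add: J_def)
    qed
    also have "\<dots> = (\<integral>\<^sup>+\<omega>. f (\<lambda>k. \<omega> (k, False)) \<partial>?P I)"
      by (intro nn_integral_cong f_cong) (auto simp: J_def)
    finally show ?thesis .
  qed
  have "(\<integral>\<^sup>+\<omega>. ennreal (exp (x * nsq m (rowmul n (gvec UNIV \<omega>) M) / 2)) \<partial>gauss UNIV n)
      = (\<integral>\<^sup>+\<omega>. f (\<lambda>k. \<omega> (k, False)) * f (\<lambda>k. \<omega> (k, True)) \<partial>?P (I \<union> J))"
    by (simp only: split gC)
  also have "\<dots> = (\<integral>\<^sup>+\<omega>. \<integral>\<^sup>+\<omega>'. f (\<lambda>k. merge I J (\<omega>, \<omega>') (k, False)) * f (\<lambda>k. merge I J (\<omega>, \<omega>') (k, True)) \<partial>?P J \<partial>?P I)"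
    by (rule product_nn_integral_fold[OF IJ(1-3) meas2])
  also have "\<dots> = (\<integral>\<^sup>+\<omega>. \<integral>\<^sup>+\<omega>'. f (\<lambda>k. \<omega> (k, False)) * f (\<lambda>k. \<omega>' (k, True)) \<partial>?P J \<partial>?P I)"
    by (intro nn_integral_cong arg_cong2[of _ _ _ _ "(*)"] f_cong) (auto simp: I_def J_def merge_def)
  also have "\<dots> = (\<integral>\<^sup>+\<omega>. f (\<lambda>k. \<omega> (k, False)) \<partial>?P I) * (\<integral>\<^sup>+\<omega>. f (\<lambda>k. \<omega> (k, True)) \<partial>?P J)"
    using fmeas[of False] fmeas[of True]
    by (simp add: nn_integral_cmult nn_integral_multc I_def[symmetric] J_def[symmetric])
  also have "\<dots> = (\<integral>\<^sup>+\<omega>. f (\<lambda>k. \<omega> (k, False)) \<partial>?P I)\<^sup>2" by (simp only: re power2_eq_square)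
  finally show ?thesis by (simp add: gR f_def gvec_Reals[abs_def])
qed

lemma ennreal_square_cancel:
  assumes "a\<^sup>2 = (ennreal p)\<^sup>2" "0 \<le> p"
  shows "a = ennreal p"
proof (cases a)
  case (real r)
  hence "ennreal (r\<^sup>2) = ennreal (p\<^sup>2)" using assms by (simp add: ennreal_power)
  hence "r\<^sup>2 = p\<^sup>2" by (subst (asm) ennreal_inj) auto
  thus ?thesis using real assms(2) by (simp add: power2_eq_iff_nonneg)
next
  case top
  thus ?thesis using assms by (simp add: ennreal_power ennreal_top_mult power2_eq_square ennreal_mult[symmetric])
qed

lemma gauss_exp_quadratic:
  fixes M :: "complex mat"
  assumes F: "F = \<real> \<or> F = UNIV" and M: "M \<in> carrier_mat n m"
    and MF: "\<And>i k. i < n \<Longrightarrow> k < m \<Longrightarrow> M $$ (i, k) \<in> F"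
  obtains e :: "nat \<Rightarrow> real" where "\<And>k. k < n \<Longrightarrow> 0 \<le> e k"
    "singular_values M = image_mset (\<lambda>k. sqrt (e k)) (mset_set {..<n})"
    "\<And>x. 0 \<le> x \<Longrightarrow> (\<And>k. k < n \<Longrightarrow> x * e k < 1) \<Longrightarrow>
      (\<integral>\<^sup>+\<omega>. ennreal (exp (x * nsq m (rowmul n (gvec F \<omega>) M) / 2)) \<partial>gauss F n)
        = ennreal (\<Prod>k<n. (1 - x * e k) powr (- card (parts F) / 2))"
proof -
  obtain Q e where Q: "Q \<in> unitary_group UNIV n" and e: "\<And>k. k < n \<Longrightarrow> 0 \<le> e k"
    and MM: "M * mat_adjoint M = Q * mat n n (\<lambda>(i, j). if i = j then complex_of_real (e i) else 0) * mat_adjoint Q"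
    and sv: "singular_values M = image_mset (\<lambda>k. sqrt (e k)) (mset_set {..<n})"
    using singular_value_decomposition[OF M] by blast
  show thesis
  proof (rule that[OF e sv])
    fix x :: real assume x: "0 \<le> x" "\<And>k. k < n \<Longrightarrow> x * e k < 1"
    have C: "(\<integral>\<^sup>+\<omega>. ennreal (exp (x * nsq m (rowmul n (gvec UNIV \<omega>) M) / 2)) \<partial>gauss UNIV n)
        = ennreal (\<Prod>k<n. (1 - x * e k) powr (- 1))"
      by (rule gauss_exp_quadratic_complex[OF M Q e MM x])
    show "(\<integral>\<^sup>+\<omega>. ennreal (exp (x * nsq m (rowmul n (gvec F \<omega>) M) / 2)) \<partial>gauss F n)
        = ennreal (\<Prod>k<n. (1 - x * e k) powr (- card (parts F) / 2))"
      using F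
    proof
      assume "F = UNIV" thus ?thesis using C by (simp add: UNIV_bool)
    next
      assume FR: "F = \<real>"
      let ?R = "\<integral>\<^sup>+\<omega>. ennreal (exp (x * nsq m (rowmul n (gvec \<real> \<omega>) M) / 2)) \<partial>gauss \<real> n"
      let ?p = "\<Prod>k<n. (1 - x * e k) powr (- (1 / 2))"
      have "?p * ?p = (\<Prod>k<n. (1 - x * e k) powr (- 1))"
        by (simp add: prod.distrib[symmetric] powr_add[symmetric])
      moreover have "?R\<^sup>2 = ennreal (\<Prod>k<n. (1 - x * e k) powr (- 1))"
        using C gauss_complex_eq_real_square[of n m M x] MF FR by simp
      ultimately have "?R\<^sup>2 = (ennreal ?p)\<^sup>2"
        by (simp add: power2_eq_square ennreal_mult[symmetric] prod_nonneg)
      hence "?R = ennreal ?p"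
        by (rule ennreal_square_cancel) (simp add: prod_nonneg)
      thus ?thesis by (simp add: FR)
    qed
  qed
qed

section \<open>Moments of Gaussian and Haar distributed vectors\<close>

text \<open>Zeros of a nontrivial power series are isolated, while the difference of the two series
  vanishes on an interval. Finiteness at an interior point makes all coefficients finite, so that
  the difference makes sense.\<close>

lemma ennreal_power_series_unique:
  fixes a b :: "nat \<Rightarrow> ennreal" and s :: real
  assumes s: "s > 0"
    and eq: "\<And>x. 0 \<le> x \<Longrightarrow> x < s \<Longrightarrow> (\<Sum>j. a j * ennreal (x ^ j)) = (\<Sum>j. b j * ennreal (x ^ j))"
    and fin: "\<And>x. 0 \<le> x \<Longrightarrow> x < s \<Longrightarrow> (\<Sum>j. b j * ennreal (x ^ j)) \<noteq> \<top>"
  shows "a = b"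
proof -
  define r where "r = s / 2"
  have r: "0 < r" "r < s" using s by (auto simp: r_def)
  have fin': "c j \<noteq> \<top>" if "(\<Sum>j. c j * ennreal (r ^ j)) \<noteq> \<top>" for c :: "nat \<Rightarrow> ennreal" and j
  proof
    assume "c j = \<top>"
    hence "c j * ennreal (r ^ j) = \<top>" using r(1) by (simp add: ennreal_top_mult)
    moreover have "c j * ennreal (r ^ j) \<le> (\<Sum>j. c j * ennreal (r ^ j))"
      using sum_le_suminf[of "\<lambda>j. c j * ennreal (r ^ j)" "{j}"] by simp
    ultimately show False using that by (simp add: top_unique)
  qed
  define a' where "a' = (\<lambda>j. enn2real (a j))"
  define b' where "b' = (\<lambda>j. enn2real (b j))"
  have fb: "(\<Sum>j. b j * ennreal (r ^ j)) \<noteq> \<top>" by (rule fin) (use r in auto)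
  hence fa: "(\<Sum>j. a j * ennreal (r ^ j)) \<noteq> \<top>" using eq[of r] r by simp
  have ab: "a j = ennreal (a' j)" "b j = ennreal (b' j)" for j
    using fin'[OF fa, of j] fin'[OF fb, of j] by (simp_all add: a'_def b'_def less_top)
  have nn: "0 \<le> a' j" "0 \<le> b' j" for j by (simp_all add: a'_def b'_def)
  have em: "ennreal (c j) * ennreal (x ^ j) = ennreal (c j * x ^ j)" if "0 \<le> x" "\<And>j. 0 \<le> c j"
    for c and x :: real and j
    using that by (simp add: ennreal_mult)
  have sa: "summable (\<lambda>j. a' j * x ^ j)" if "0 \<le> x" "x < s" for x
  proof (rule summable_suminf_not_top)
    show "(\<Sum>j. ennreal (a' j * x ^ j)) \<noteq> \<top>"
      using fin[OF that] eq[OF that] em[of x a'] that nn by (simp add: ab)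
  qed (use nn that in auto)
  have sb: "summable (\<lambda>j. b' j * x ^ j)" if "0 \<le> x" "x < s" for x
  proof (rule summable_suminf_not_top)
    show "(\<Sum>j. ennreal (b' j * x ^ j)) \<noteq> \<top>"
      using fin[OF that] em[of x b'] that nn by (simp add: ab)
  qed (use nn that in auto)
  have sumeq: "(\<Sum>j. a' j * x ^ j) = (\<Sum>j. b' j * x ^ j)" if x: "0 \<le> x" "x < s" for x
  proof -
    have "ennreal (\<Sum>j. a' j * x ^ j) = (\<Sum>j. a j * ennreal (x ^ j))"
      using em[of x a'] nn x by (simp add: ab suminf_ennreal2[OF _ sa[OF x]])
    also have "\<dots> = (\<Sum>j. b j * ennreal (x ^ j))" by (rule eq[OF x])
    also have "\<dots> = ennreal (\<Sum>j. b' j * x ^ j)"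
      using em[of x b'] nn x by (simp add: ab suminf_ennreal2[OF _ sb[OF x]])
    finally show ?thesis
      using nn x by (subst (asm) ennreal_inj) (auto intro!: suminf_nonneg sa sb)
  qed
  define d where "d = (\<lambda>j. a' j - b' j)"
  define f where "f = (\<lambda>x. \<Sum>j. d j * x ^ j)"
  have sd: "(\<lambda>j. d j * x ^ j) sums f x" if "\<bar>x\<bar> < r" for x
  proof -
    have "summable (\<lambda>j. d j * r ^ j)"
      using summable_diff[OF sa[of r] sb[of r]] r by (simp add: d_def left_diff_distrib)
    hence "summable (\<lambda>j. d j * x ^ j)" by (rule powser_inside) (use that r in auto)
    thus ?thesis by (simp add: f_def summable_sums)
  qed
  have f0: "f x = 0" if "0 \<le> x" "x < s" for x
    using suminf_diff[OF sa[OF that] sb[OF that]] sumeq[OF that]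
    by (simp add: f_def d_def left_diff_distrib)
  have "d j = 0" for j
  proof (rule ccontr)
    assume dj: "d j \<noteq> 0"
    have "d 0 = 0" using f0[of 0] s powser_sums_zero[of d] by (simp add: f_def)
    hence "j > 0" using dj by (cases j) auto
    \<comment> \<open>A nonzero coefficient of positive index forces a punctured neighbourhood of 0
      without zeros.\<close>
    obtain s' where s': "0 < s'" "\<And>z. z \<in> cball 0 s' - {0} \<Longrightarrow> f z \<noteq> 0"
      by (rule powser_0_nonzero[of r 0 d f j]) (use r sd f0[of 0] s dj \<open>j > 0\<close> in auto)
    have "f (min s' r) \<noteq> 0" using s'(1) r by (intro s'(2)) (auto simp: min_def)
    thus False using f0[of "min s' r"] s'(1) r by auto
  qed
  thus ?thesis using ab by (auto simp: d_def fun_eq_iff)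
qed

lemma ennreal_exp_series:
  assumes "0 \<le> u"
  shows "ennreal (exp u) = (\<Sum>j. ennreal (u ^ j / fact j))"
  using exp_converges[of u] assms
  by (intro suminf_ennreal_eq[symmetric]) (auto simp: divide_inverse mult.commute)

text \<open>All terms are nonnegative, so sum and integral commute even where the value is
  infinite.\<close>

lemma nn_integral_exp_series:
  assumes [measurable]: "X \<in> borel_measurable N" and X: "\<And>\<omega>. 0 \<le> X \<omega>" and x: "0 \<le> x"
  shows "(\<integral>\<^sup>+\<omega>. ennreal (exp (x * X \<omega>)) \<partial>N)
    = (\<Sum>j. (\<integral>\<^sup>+\<omega>. ennreal (X \<omega> ^ j / fact j) \<partial>N) * ennreal (x ^ j))"
proof -
  have "ennreal (exp (x * X \<omega>)) = (\<Sum>j. ennreal (X \<omega> ^ j / fact j) * ennreal (x ^ j))" for \<omega>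
  proof -
    have "ennreal ((x * X \<omega>) ^ j / fact j) = ennreal (X \<omega> ^ j / fact j) * ennreal (x ^ j)" for j
    proof -
      have "(x * X \<omega>) ^ j / fact j = X \<omega> ^ j / fact j * x ^ j" by (simp add: power_mult_distrib)
      thus ?thesis using x X[of \<omega>] by (simp only: ennreal_mult zero_le_power zero_le_divide_iff fact_ge_zero simp_thms)
    qed
    thus ?thesis by (simp only: ennreal_exp_series[OF mult_nonneg_nonneg[OF x X]])
  qed
  hence "(\<integral>\<^sup>+\<omega>. ennreal (exp (x * X \<omega>)) \<partial>N)
      = (\<integral>\<^sup>+\<omega>. (\<Sum>j. ennreal (X \<omega> ^ j / fact j) * ennreal (x ^ j)) \<partial>N)" by simp
  also have "\<dots> = (\<Sum>j. \<integral>\<^sup>+\<omega>. ennreal (X \<omega> ^ j / fact j) * ennreal (x ^ j) \<partial>N)"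
    by (rule nn_integral_suminf) measurable
  finally show ?thesis by (simp add: nn_integral_multc)
qed

lemma measurable_nsq [measurable (raw)]:
  assumes "\<And>k. k < n \<Longrightarrow> (\<lambda>\<omega>. v \<omega> k) \<in> borel_measurable N"
  shows "(\<lambda>\<omega>. nsq n (v \<omega>)) \<in> borel_measurable N"
  unfolding nsq_def using assms by measurable

lemma binomial_series_neg:
  fixes a x :: real
  assumes "\<bar>x\<bar> < 1"
  shows "(\<lambda>j. pochhammer a j / fact j * x ^ j) sums (1 - x) powr (- a)"
proof -
  have "((- a) gchoose j) * (- x) ^ j = pochhammer a j / fact j * x ^ j" for j
  proof -
    have "(- x) ^ j = (- 1) ^ j * x ^ j" by (rule power_minus)
    moreover have "(- 1) ^ j * (- 1) ^ j = (1 :: real)" by (simp add: power_mult_distrib[symmetric])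
    ultimately show ?thesis by (simp add: gbinomial_pochhammer)
  qed
  thus ?thesis using gen_binomial_real[of "- x" "- a"] assms by simp
qed

lemma pochhammer_nonneg_real: "0 \<le> (a :: real) \<Longrightarrow> 0 \<le> pochhammer a j"
  by (simp add: pochhammer_prod prod_nonneg)

text \<open>Chi-squared moments, read off from the expansion of \<open>(1 - x) powr (- N)\<close>,
  where \<open>N\<close> is half the real dimension.\<close>

lemma gauss_norm_moment:
  assumes F: "F = \<real> \<or> F = UNIV"
  shows "(\<integral>\<^sup>+\<omega>. ennreal (nsq n (gvec F \<omega>) ^ j) \<partial>gauss F n)
    = ennreal (2 ^ j * pochhammer (real (n * card (parts F)) / 2) j)"
proof -
  let ?N = "real (n * card (parts F)) / 2"
  have "(\<lambda>j. \<integral>\<^sup>+\<omega>. ennreal ((nsq n (gvec F \<omega>) / 2) ^ j / fact j) \<partial>gauss F n)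
      = (\<lambda>j. ennreal (pochhammer ?N j / fact j))"
  proof (rule ennreal_power_series_unique[where s=1])
    fix x :: real assume x: "0 \<le> x" "x < 1"
    have "(\<Sum>j. ennreal (pochhammer ?N j / fact j) * ennreal (x ^ j))
        = (\<Sum>j. ennreal (pochhammer ?N j / fact j * x ^ j))"
      using x by (simp add: ennreal_mult[symmetric] pochhammer_nonneg_real)
    also have "\<dots> = ennreal ((1 - x) powr (- ?N))"
      using x binomial_series_neg[of x ?N] by (intro suminf_ennreal_eq) (auto simp: pochhammer_nonneg_real)
    finally have R: "(\<Sum>j. ennreal (pochhammer ?N j / fact j) * ennreal (x ^ j)) = ennreal ((1 - x) powr (- ?N))" .
    have "(\<Sum>j. (\<integral>\<^sup>+\<omega>. ennreal ((nsq n (gvec F \<omega>) / 2) ^ j / fact j) \<partial>gauss F n) * ennreal (x ^ j))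
        = (\<integral>\<^sup>+\<omega>. ennreal (exp (x * (nsq n (gvec F \<omega>) / 2))) \<partial>gauss F n)"
      by (rule nn_integral_exp_series[symmetric]) (use x in auto)
    also have "\<dots> = ennreal (\<Prod>k<n. (1 - x) powr (- card (parts F) / 2))"
      using gauss_exp_diagonal[OF F, of n "\<lambda>_. x"] x by (simp add: nsq_def sum_distrib_left)
    also have "(\<Prod>k<n. (1 - x) powr (- card (parts F) / 2)) = (1 - x) powr (- ?N)"
      using x by (simp add: powr_realpow[symmetric] powr_powr mult.commute)
    finally show "(\<Sum>j. (\<integral>\<^sup>+\<omega>. ennreal ((nsq n (gvec F \<omega>) / 2) ^ j / fact j) \<partial>gauss F n) * ennreal (x ^ j))
        = (\<Sum>j. ennreal (pochhammer ?N j / fact j) * ennreal (x ^ j))"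
      by (simp only: R)
    show "(\<Sum>j. ennreal (pochhammer ?N j / fact j) * ennreal (x ^ j)) \<noteq> \<top>" unfolding R by simp
  qed simp
  from fun_cong[OF this, of j]
  have 1: "(\<integral>\<^sup>+\<omega>. ennreal ((nsq n (gvec F \<omega>) / 2) ^ j / fact j) \<partial>gauss F n) = ennreal (pochhammer ?N j / fact j)" .
  have "(\<integral>\<^sup>+\<omega>. ennreal (nsq n (gvec F \<omega>) ^ j) \<partial>gauss F n)
      = (\<integral>\<^sup>+\<omega>. ennreal (2 ^ j * fact j) * ennreal ((nsq n (gvec F \<omega>) / 2) ^ j / fact j) \<partial>gauss F n)"
    by (intro nn_integral_cong) (simp add: ennreal_mult[symmetric] power_divide)
  also have "\<dots> = ennreal (2 ^ j * fact j) * ennreal (pochhammer ?N j / fact j)"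
    by (subst nn_integral_cmult) (auto simp: 1)
  also have "\<dots> = ennreal (2 ^ j * pochhammer ?N j)"
    by (simp add: ennreal_mult[symmetric] pochhammer_nonneg_real)
  finally show ?thesis .
qed

subsection \<open>Haar measures\<close>

lemma space_unitary_space: "space (unitary_space F n) = unitary_group F n"
proof -
  have "space (mat_borel n n) = carrier_mat n n" by (simp add: mat_borel_def space_measure_of_conv)
  thus ?thesis by (auto simp: unitary_space_def space_restrict_space unitary_group_def)
qed

lemma measurable_mat_borel_entry:
  assumes "i < p" "j < q"
  shows "(\<lambda>A. A $$ (i, j)) \<in> borel_measurable (mat_borel p q)"
proof (rule measurableI)
  fix S :: "complex set" assume "S \<in> sets borel"
  hence "{A \<in> carrier_mat p q. A $$ (i, j) \<in> S} \<in> sets (mat_borel p q)"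
    unfolding mat_borel_def using assms
    by (subst sets_measure_of) (auto intro!: sigma_sets.Basic)
  also have "{A \<in> carrier_mat p q. A $$ (i, j) \<in> S} = (\<lambda>A. A $$ (i, j)) -` S \<inter> space (mat_borel p q)"
    by (auto simp: mat_borel_def space_measure_of_conv)
  finally show "(\<lambda>A. A $$ (i, j)) -` S \<inter> space (mat_borel p q) \<in> sets (mat_borel p q)" .
qed simp

lemma measurable_unitary_entry [measurable (raw)]:
  assumes "X \<in> measurable N (unitary_space F n)" "i < n" "j < n"
  shows "(\<lambda>\<omega>. X \<omega> $$ (i, j)) \<in> borel_measurable N"
  by (rule measurable_compose[OF assms(1)])
    (auto simp: unitary_space_def intro!: measurable_restrict_space1 measurable_mat_borel_entry assms)

lemma measurable_unitary_spaceI: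
  assumes "\<And>\<omega>. \<omega> \<in> space N \<Longrightarrow> X \<omega> \<in> unitary_group F n"
    and "\<And>i j. i < n \<Longrightarrow> j < n \<Longrightarrow> (\<lambda>\<omega>. X \<omega> $$ (i, j)) \<in> borel_measurable N"
  shows "X \<in> measurable N (unitary_space F n)"
  unfolding unitary_space_def
proof (rule measurable_restrict_space2)
  show "X \<in> space N \<rightarrow> unitary_group F n" using assms(1) by auto
  show "X \<in> measurable N (mat_borel n n)"
    unfolding mat_borel_def
  proof (rule measurable_measure_of)
    fix y assume "y \<in> {{A \<in> carrier_mat n n. A $$ (i, j) \<in> S} | i j S. i < n \<and> j < n \<and> S \<in> sets (borel :: complex measure)}"
    then obtain i j S where ij: "i < n" "j < n" "S \<in> sets (borel :: complex measure)"
      and y: "y = {A \<in> carrier_mat n n. A $$ (i, j) \<in> S}" by blast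
    have "X -` y \<inter> space N = (\<lambda>\<omega>. X \<omega> $$ (i, j)) -` S \<inter> space N"
      using assms(1) by (auto simp: y dest: unitary_groupD(1))
    also have "\<dots> \<in> sets N" by (rule measurable_sets[OF assms(2)[OF ij(1,2)] ij(3)])
    finally show "X -` y \<inter> space N \<in> sets N" .
  qed (use assms(1) in \<open>auto dest: unitary_groupD(1)\<close>)
qed

lemma unitary_group_mult:
  assumes F: "F = \<real> \<or> F = UNIV" and A: "A \<in> unitary_group F n" and B: "B \<in> unitary_group F n"
  shows "A * B \<in> unitary_group F n"
proof -
  have "A * B \<in> unitary_group UNIV n"
    by (rule unitary_group_UNIV_mult) (use A B in \<open>auto simp: unitary_group_def\<close>)
  moreover have "(A * B) $$ (i, j) \<in> F" if "i < n" "j < n" for i j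
    using F that unitary_groupD(4)[OF A] unitary_groupD(4)[OF B]
    by (subst index_mult_sum[OF unitary_groupD(1)[OF A] unitary_groupD(1)[OF B]])
      (auto intro!: sum_in_Reals Reals_mult)
  ultimately show ?thesis by (intro unitary_groupI) (auto dest: unitary_groupD)
qed

context
  fixes F :: "complex set" and n :: nat and \<nu> :: "complex mat measure"
  assumes F: "F = \<real> \<or> F = UNIV" and haar: "is_haar_measure F n \<nu>"
begin

lemma haar_prob: "prob_space \<nu>" and sets_haar: "sets \<nu> = sets (unitary_space F n)"
  using haar by (auto simp: is_haar_measure_def)

lemma space_haar: "space \<nu> = unitary_group F n"
  using sets_eq_imp_space_eq[OF sets_haar] by (simp add: space_unitary_space)

lemma measurable_haar_id: "(\<lambda>U. U) \<in> measurable \<nu> (unitary_space F n)"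
  by (rule measurable_ident_sets[OF sets_haar])

lemma measurable_haar_entry:
  "i < n \<Longrightarrow> j < n \<Longrightarrow> (\<lambda>U. U $$ (i, j)) \<in> borel_measurable \<nu>"
  by (rule measurable_unitary_entry[OF measurable_haar_id])

lemma haar_left_invariant:
  assumes A: "A \<in> unitary_group F n" and f: "f \<in> borel_measurable \<nu>"
  shows "(\<integral>\<^sup>+U. f (A * U) \<partial>\<nu>) = (\<integral>\<^sup>+U. f U \<partial>\<nu>)"
proof -
  have "(\<lambda>U. A * U) \<in> measurable \<nu> (unitary_space F n)"
  proof (rule measurable_unitary_spaceI)
    fix U assume "U \<in> space \<nu>"
    thus "A * U \<in> unitary_group F n" using unitary_group_mult[OF F A] by (simp add: space_haar)
  next
    fix i j assume ij: "i < n" "j < n"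
    have "(\<lambda>U. \<Sum>k<n. A $$ (i, k) * U $$ (k, j)) \<in> borel_measurable \<nu>"
      using ij by (intro borel_measurable_sum borel_measurable_times measurable_haar_entry) auto
    also have "?this \<longleftrightarrow> (\<lambda>U. (A * U) $$ (i, j)) \<in> borel_measurable \<nu>"
      by (intro measurable_cong index_mult_sum[OF unitary_groupD(1)[OF A] _ ij, symmetric])
        (auto simp: space_haar dest: unitary_groupD(1))
    finally show "(\<lambda>U. (A * U) $$ (i, j)) \<in> borel_measurable \<nu>" .
  qed
  hence m: "(\<lambda>U. A * U) \<in> measurable \<nu> \<nu>" by (simp add: measurable_cong_sets[OF refl sets_haar])
  have "(\<integral>\<^sup>+U. f U \<partial>\<nu>) = (\<integral>\<^sup>+U. f U \<partial>distr \<nu> \<nu> (\<lambda>U. A * U))"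
    using haar A by (simp add: is_haar_measure_def)
  also have "\<dots> = (\<integral>\<^sup>+U. f (A * U) \<partial>\<nu>)" by (rule nn_integral_distr[OF m]) (use f in simp)
  finally show ?thesis by simp
qed

text \<open>
  Some unitary matrix \<open>A\<close> has \<open>g / |g|\<close> as its row \<open>j\<close>, so \<open>g U\<close> is
  \<open>|g|\<close> times row \<open>j\<close> of \<open>A U\<close>.
\<close>

lemma haar_rowmul:
  assumes j: "j < n" and g: "\<And>k. k < n \<Longrightarrow> g k \<in> F"
    and cong: "\<And>v v' :: nat \<Rightarrow> complex. (\<And>k. k < n \<Longrightarrow> v k = v' k) \<Longrightarrow> h v = h v'"
    and meas: "\<And>r :: real. (\<lambda>U. h (\<lambda>k. of_real r * U $$ (j, k))) \<in> borel_measurable \<nu>"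
  shows "(\<integral>\<^sup>+U. h (rowmul n g U) \<partial>\<nu>) = (\<integral>\<^sup>+U. h (\<lambda>k. of_real (sqrt (nsq n g)) * U $$ (j, k)) \<partial>\<nu>)"
proof (cases "nsq n g = 0")
  case True
  hence "g k = 0" if "k < n" for k
    using that by (simp add: nsq_def sum_nonneg_eq_0_iff)
  hence "rowmul n g U = (\<lambda>_. 0)" for U by (simp add: rowmul_def fun_eq_iff)
  thus ?thesis by (simp add: True)
next
  case False
  define r where "r = sqrt (nsq n g)"
  have r: "r > 0" using False by (simp add: r_def order_less_le)
  have r2: "r\<^sup>2 = nsq n g" by (simp add: r_def)
  obtain A where A: "A \<in> unitary_group F n" "\<And>k. k < n \<Longrightarrow> A $$ (j, k) = g k / of_real r"
  proof (rule unitary_group_with_row[OF F j, of "\<lambda>k. g k / of_real r"])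
    show "(\<Sum>k<n. (cmod (g k / of_real r))\<^sup>2) = 1"
      using r r2 False by (simp add: norm_divide power_divide sum_divide_distrib[symmetric] nsq_def[symmetric])
  qed (use F g in auto)
  have "(\<integral>\<^sup>+U. h (rowmul n g U) \<partial>\<nu>) = (\<integral>\<^sup>+U. h (\<lambda>k. of_real r * (A * U) $$ (j, k)) \<partial>\<nu>)"
  proof (intro nn_integral_cong cong)
    fix U k assume U: "U \<in> space \<nu>" and k: "k < n"
    have "of_real r * (A * U) $$ (j, k) = (\<Sum>i<n. of_real r * (A $$ (j, i) * U $$ (i, k)))"
      using U k j unitary_groupD(1)[OF A(1)]
      by (subst index_mult_sum[of A n n U n]) (auto simp: space_haar sum_distrib_left dest: unitary_groupD(1))
    also have "\<dots> = rowmul n g U k"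
      unfolding rowmul_def by (rule sum.cong) (use r A(2) in auto)
    finally show "rowmul n g U k = of_real r * (A * U) $$ (j, k)" by simp
  qed
  also have "\<dots> = (\<integral>\<^sup>+U. h (\<lambda>k. of_real r * U $$ (j, k)) \<partial>\<nu>)"
    by (rule haar_left_invariant[OF A(1) meas])
  finally show ?thesis by (simp add: r_def)
qed

end

section \<open>Moments of Haar columns and Haar rows\<close>

lemma cosh_series: "(\<lambda>j. x ^ (2 * j) / fact (2 * j)) sums cosh (x :: real)"
proof -
  have "(\<lambda>j. if even (2 * j) then x ^ (2 * j) /\<^sub>R fact (2 * j) else 0) sums cosh x"
    by (rule sums_mono_reindex[THEN iffD2, OF _ _ cosh_converges])
      (auto simp: strict_mono_def elim!: evenE)
  thus ?thesis by (simp add: divide_inverse mult.commute)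
qed

lemma nsq_unitary_col:
  assumes A: "A \<in> unitary_group F n" and i: "i < n"
  shows "nsq n (\<lambda>k. A $$ (k, i)) = 1"
proof -
  note Ac = unitary_groupD(1)[OF A]
  have "complex_of_real (nsq n (\<lambda>k. A $$ (k, i))) = (\<Sum>k<n. mat_adjoint A $$ (i, k) * A $$ (k, i))"
    unfolding nsq_def of_real_sum complex_norm_square
    by (rule sum.cong) (use Ac i in \<open>auto simp: mult.commute\<close>)
  also have "\<dots> = (mat_adjoint A * A) $$ (i, i)"
    by (rule index_mult_sum[OF mat_adjoint_carrier[OF Ac] Ac i i, symmetric])
  also have "\<dots> = 1" using i by (simp add: unitary_groupD(3)[OF A])
  finally show ?thesis by (metis of_real_eq_1_iff)
qed

lemma rowmul_mult:
  assumes A: "A \<in> carrier_mat n p" and B: "B \<in> carrier_mat p m" and k: "k < m"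
  shows "rowmul n g (A * B) k = rowmul p (rowmul n g A) B k"
proof -
  have "rowmul n g (A * B) k = (\<Sum>i<n. \<Sum>l<p. g i * (A $$ (i, l) * B $$ (l, k)))"
    unfolding rowmul_def
    by (rule sum.cong) (use index_mult_sum[OF A B _ k] in \<open>auto simp: sum_distrib_left\<close>)
  also have "\<dots> = (\<Sum>l<p. \<Sum>i<n. g i * (A $$ (i, l) * B $$ (l, k)))" by (rule sum.swap)
  also have "\<dots> = rowmul p (rowmul n g A) B k"
    by (simp add: rowmul_def sum_distrib_right mult.assoc)
  finally show ?thesis .
qed

lemma nsq_cong: "(\<And>k. k < n \<Longrightarrow> v k = v' k) \<Longrightarrow> nsq n v = nsq n v'"
  by (simp add: nsq_def)

lemma rowmul_cong: "(\<And>k. k < n \<Longrightarrow> v k = v' k) \<Longrightarrow> rowmul n v A = rowmul n v' A"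
  by (rule ext) (simp add: rowmul_def)

context
  fixes F :: "complex set" and n :: nat and \<nu> :: "complex mat measure"
  assumes F: "F = \<real> \<or> F = UNIV" and haar: "is_haar_measure F n \<nu>"
begin

text \<open>By \<open>haar_rowmul\<close> the integral depends on \<open>w\<close> only through its
  norm, so it is invariant under a change of sign and \<open>exp\<close> may be averaged to
  \<open>cosh\<close>. The resulting expansion has only even, nonnegative terms.\<close>

lemma haar_exp_eq_cosh:
  assumes i: "i < n" and w: "\<And>k. k < n \<Longrightarrow> w k \<in> F"
  shows "(\<integral>\<^sup>+V. ennreal (exp (Re (rowmul n w V i))) \<partial>\<nu>)
    = (\<integral>\<^sup>+V. ennreal (cosh (sqrt (nsq n w) * Re (V $$ (i, i)))) \<partial>\<nu>)"
proof -
  have [measurable]: "(\<lambda>V. V $$ (i, i)) \<in> borel_measurable \<nu>" by (rule measurable_haar_entry[OF F haar i i])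
  define \<phi> where "\<phi> = (\<lambda>r. \<integral>\<^sup>+V. ennreal (exp (r * Re (V $$ (i, i)))) \<partial>\<nu>)"
  have main: "(\<integral>\<^sup>+V. ennreal (exp (Re (rowmul n w V i))) \<partial>\<nu>) = \<phi> (sqrt (nsq n w))"
    if "\<And>k. k < n \<Longrightarrow> w k \<in> F" for w
    unfolding \<phi>_def using haar_rowmul[OF F haar i that, where h="\<lambda>v. ennreal (exp (Re (v i)))"] i by simp
  \<comment> \<open>The vector whose only nonzero entry is \<open>- r\<close> at position
    \<open>i\<close> has norm \<open>\<bar>r\<bar>\<close>.\<close>
  have neg: "\<phi> (- r) = \<phi> \<bar>r\<bar>" for r
  proof -
    let ?w = "\<lambda>k. if k = i then - complex_of_real r else 0"
    have "rowmul n ?w V i = - complex_of_real r * V $$ (i, i)" for V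
    proof -
      have "rowmul n ?w V i = (\<Sum>k<n. if k = i then - complex_of_real r * V $$ (i, i) else 0)"
        unfolding rowmul_def by (rule sum.cong) auto
      thus ?thesis using i by simp
    qed
    moreover have "nsq n ?w = r\<^sup>2"
    proof -
      have "nsq n ?w = (\<Sum>k<n. if k = i then r\<^sup>2 else 0)"
        unfolding nsq_def by (rule sum.cong) auto
      thus ?thesis using i by simp
    qed
    ultimately show ?thesis
      using main[of ?w] F by (auto simp: \<phi>_def)
  qed
  let ?s = "sqrt (nsq n w)"
  have "\<phi> ?s + \<phi> ?s = \<phi> ?s + \<phi> (- ?s)" by (simp add: neg)
  also have "\<dots> = (\<integral>\<^sup>+V. ennreal (exp (?s * Re (V $$ (i, i)))) + ennreal (exp (- ?s * Re (V $$ (i, i)))) \<partial>\<nu>)"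
    unfolding \<phi>_def by (rule nn_integral_add[symmetric]) measurable
  also have "\<dots> = (\<integral>\<^sup>+V. 2 * ennreal (cosh (?s * Re (V $$ (i, i)))) \<partial>\<nu>)"
  proof (rule nn_integral_cong)
    fix V
    have "ennreal (exp (?s * Re (V $$ (i, i)))) + ennreal (exp (- ?s * Re (V $$ (i, i))))
        = ennreal (2 * cosh (?s * Re (V $$ (i, i))))"
      by (simp add: cosh_def ennreal_plus[symmetric] del: ennreal_plus)
    thus "ennreal (exp (?s * Re (V $$ (i, i)))) + ennreal (exp (- ?s * Re (V $$ (i, i))))
        = 2 * ennreal (cosh (?s * Re (V $$ (i, i))))"
      by (simp add: ennreal_mult' del: ennreal_plus)
  qed
  also have "\<dots> = 2 * (\<integral>\<^sup>+V. ennreal (cosh (?s * Re (V $$ (i, i)))) \<partial>\<nu>)"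
    by (rule nn_integral_cmult) (simp add: cosh_def)
  finally have "2 * \<phi> ?s = 2 * (\<integral>\<^sup>+V. ennreal (cosh (?s * Re (V $$ (i, i)))) \<partial>\<nu>)"
    by (simp add: mult_2)
  hence "\<phi> ?s = (\<integral>\<^sup>+V. ennreal (cosh (?s * Re (V $$ (i, i)))) \<partial>\<nu>)"
    by (subst (asm) ennreal_mult_cancel_left) auto
  thus ?thesis using main[OF w] by simp
qed

lemma haar_exp_series:
  assumes i: "i < n" and w: "\<And>k. k < n \<Longrightarrow> w k \<in> F"
  shows "(\<integral>\<^sup>+V. ennreal (exp (Re (rowmul n w V i))) \<partial>\<nu>)
    = (\<Sum>j. ennreal (nsq n w ^ j) * (\<integral>\<^sup>+V. ennreal (Re (V $$ (i, i)) ^ (2 * j) / fact (2 * j)) \<partial>\<nu>))"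
proof -
  have [measurable]: "(\<lambda>V. V $$ (i, i)) \<in> borel_measurable \<nu>" by (rule measurable_haar_entry[OF F haar i i])
  have "ennreal (cosh (sqrt (nsq n w) * y)) = (\<Sum>j. ennreal (nsq n w ^ j) * ennreal (y ^ (2 * j) / fact (2 * j)))"
    for y :: real
  proof -
    have "(sqrt (nsq n w) * y) ^ (2 * j) / fact (2 * j) = nsq n w ^ j * (y ^ (2 * j) / fact (2 * j))" for j
      by (simp add: power_mult_distrib power_mult)
    hence "(\<lambda>j. nsq n w ^ j * (y ^ (2 * j) / fact (2 * j))) sums cosh (sqrt (nsq n w) * y)"
      using cosh_series[of "sqrt (nsq n w) * y"] by simp
    hence "(\<Sum>j. ennreal (nsq n w ^ j * (y ^ (2 * j) / fact (2 * j)))) = ennreal (cosh (sqrt (nsq n w) * y))"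
      by (intro suminf_ennreal_eq) (auto simp: power_mult)
    moreover have "ennreal (nsq n w ^ j * (y ^ (2 * j) / fact (2 * j)))
        = ennreal (nsq n w ^ j) * ennreal (y ^ (2 * j) / fact (2 * j))" for j
      by (rule ennreal_mult) (auto simp: power_mult)
    ultimately show ?thesis by simp
  qed
  hence "(\<integral>\<^sup>+V. ennreal (exp (Re (rowmul n w V i))) \<partial>\<nu>)
      = (\<integral>\<^sup>+V. (\<Sum>j. ennreal (nsq n w ^ j) * ennreal (Re (V $$ (i, i)) ^ (2 * j) / fact (2 * j))) \<partial>\<nu>)"
    by (simp only: haar_exp_eq_cosh[OF i w])
  also have "\<dots> = (\<Sum>j. \<integral>\<^sup>+V. ennreal (nsq n w ^ j) * ennreal (Re (V $$ (i, i)) ^ (2 * j) / fact (2 * j)) \<partial>\<nu>)"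
    by (rule nn_integral_suminf) measurable
  also have "\<dots> = (\<Sum>j. ennreal (nsq n w ^ j) * (\<integral>\<^sup>+V. ennreal (Re (V $$ (i, i)) ^ (2 * j) / fact (2 * j)) \<partial>\<nu>))"
    by (intro suminf_cong nn_integral_cmult) measurable
  finally show ?thesis .
qed

lemma measurable_rowmul_prod [measurable]:
  assumes "k < n"
  shows "(\<lambda>x. rowmul n (gvec F (fst x)) (snd x) k) \<in> borel_measurable (gauss F n \<Otimes>\<^sub>M \<nu>)"
proof -
  have [measurable]: "(\<lambda>x. snd x $$ (i, k)) \<in> borel_measurable (gauss F n \<Otimes>\<^sub>M \<nu>)" if "i < n" for i
    by (rule measurable_compose[OF measurable_snd measurable_haar_entry[OF F haar that assms]])
  have [measurable]: "(\<lambda>x. gvec F (fst x) i) \<in> borel_measurable (gauss F n \<Otimes>\<^sub>M \<nu>)" if "i < n" for i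
    by (rule measurable_compose[OF measurable_fst measurable_gvec[OF that]])
  show ?thesis unfolding rowmul_def by measurable
qed

text \<open>A scaled Gaussian vector is paired with column \<open>i\<close> of \<open>V\<close>. For
  fixed \<open>V\<close> the column has norm 1, so the Gaussian integral is
  \<open>exp (x / 2)\<close>; for fixed Gaussian vector the Haar integral is a series in its squared
  norm with the unknown moments as coefficients. Comparing the two power series in \<open>x\<close>
  yields the moments.\<close>

lemma haar_entry_moment:
  assumes i: "i < n"
  shows "(\<integral>\<^sup>+V. ennreal (Re (V $$ (i, i)) ^ (2 * j) / fact (2 * j)) \<partial>\<nu>)
    = ennreal (1 / (4 ^ j * fact j * pochhammer (real (n * card (parts F)) / 2) j))"
proof -
  let ?N = "real (n * card (parts F)) / 2"
  let ?a = "\<lambda>j. \<integral>\<^sup>+V. ennreal (Re (V $$ (i, i)) ^ (2 * j) / fact (2 * j)) \<partial>\<nu>"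
  interpret g: prob_space "gauss F n" by (rule prob_space_gauss)
  interpret h: prob_space \<nu> by (rule haar_prob[OF F haar])
  interpret pair_sigma_finite "gauss F n" \<nu> ..
  have cpos: "card (parts F) > 0" using F by (auto simp: UNIV_bool)
  hence N: "?N > 0" using i by simp
  have "(\<lambda>j. ?a j * ennreal (2 ^ j * pochhammer ?N j)) = (\<lambda>j. ennreal ((1 / 2) ^ j / fact j))"
  proof (rule ennreal_power_series_unique[where s=1])
    fix x :: real assume x: "0 \<le> x" "x < 1"
    have R: "(\<Sum>j. ennreal ((1 / 2) ^ j / fact j) * ennreal (x ^ j)) = ennreal (exp (x / 2))"
    proof -
      have "ennreal ((1 / 2) ^ j / fact j) * ennreal (x ^ j) = ennreal ((x / 2) ^ j / fact j)" for j
        using x by (simp add: ennreal_mult[symmetric] power_divide)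
      thus ?thesis using x by (simp add: ennreal_exp_series)
    qed
    let ?f = "\<lambda>\<omega> V. ennreal (exp (Re (rowmul n (\<lambda>k. of_real (sqrt x) * gvec F \<omega> k) V i)))"
    have "(\<Sum>j. ?a j * ennreal (2 ^ j * pochhammer ?N j) * ennreal (x ^ j))
        = (\<Sum>j. \<integral>\<^sup>+\<omega>. ennreal (nsq n (gvec F \<omega>) ^ j) * (ennreal (x ^ j) * ?a j) \<partial>gauss F n)"
      by (subst nn_integral_multc) (auto simp: gauss_norm_moment[OF F] mult_ac)
    also have "\<dots> = (\<integral>\<^sup>+\<omega>. (\<Sum>j. ennreal (nsq n (gvec F \<omega>) ^ j) * (ennreal (x ^ j) * ?a j)) \<partial>gauss F n)"
      by (rule nn_integral_suminf[symmetric]) measurable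
    also have "\<dots> = (\<integral>\<^sup>+\<omega>. \<integral>\<^sup>+V. ?f \<omega> V \<partial>\<nu> \<partial>gauss F n)"
    proof (rule nn_integral_cong)
      fix \<omega>
      have "nsq n (\<lambda>k. of_real (sqrt x) * gvec F \<omega> k) ^ j = x ^ j * nsq n (gvec F \<omega>) ^ j" for j
        using x by (simp add: nsq_scale power_mult_distrib)
      hence e: "ennreal (nsq n (\<lambda>k. of_real (sqrt x) * gvec F \<omega> k) ^ j) = ennreal (nsq n (gvec F \<omega>) ^ j) * ennreal (x ^ j)" for j
        using x by (simp only: ennreal_mult zero_le_power nsq_nonneg mult.commute)
      show "(\<Sum>j. ennreal (nsq n (gvec F \<omega>) ^ j) * (ennreal (x ^ j) * ?a j)) = (\<integral>\<^sup>+V. ?f \<omega> V \<partial>\<nu>)"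
        by (subst haar_exp_series[OF i]) (use F gvec_in[OF F] in \<open>auto simp only: e mult.assoc intro!: Reals_mult\<close>, simp_all)
    qed
    also have "\<dots> = (\<integral>\<^sup>+V. \<integral>\<^sup>+\<omega>. ?f \<omega> V \<partial>gauss F n \<partial>\<nu>)"
      by (rule Fubini'[symmetric]) (simp add: rowmul_scale split_beta' i)
    also have "\<dots> = (\<integral>\<^sup>+V. ennreal (exp (x / 2)) \<partial>\<nu>)"
    proof (rule nn_integral_cong)
      fix V assume "V \<in> space \<nu>"
      hence V: "V \<in> unitary_group F n" by (simp add: space_haar[OF F haar])
      have "rowmul n (\<lambda>k. of_real (sqrt x) * gvec F \<omega> k) V i = (\<Sum>k<n. gvec F \<omega> k * (of_real (sqrt x) * V $$ (k, i)))" for \<omega>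
        by (simp add: rowmul_def mult_ac)
      hence "(\<integral>\<^sup>+\<omega>. ?f \<omega> V \<partial>gauss F n)
          = (\<integral>\<^sup>+\<omega>. ennreal (exp (Re (\<Sum>k<n. gvec F \<omega> k * (of_real (sqrt x) * V $$ (k, i))))) \<partial>gauss F n)"
        by simp
      also have "\<dots> = ennreal (exp (nsq n (\<lambda>k. of_real (sqrt x) * V $$ (k, i)) / 2))"
        using F unitary_groupD(4)[OF V] i by (intro gauss_exp_linear) (auto intro!: Reals_mult)
      also have "nsq n (\<lambda>k. of_real (sqrt x) * V $$ (k, i)) = x"
        using x by (simp add: nsq_scale nsq_unitary_col[OF V i])
      finally show "(\<integral>\<^sup>+\<omega>. ?f \<omega> V \<partial>gauss F n) = ennreal (exp (x / 2))" .
    qed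
    also have "\<dots> = ennreal (exp (x / 2))" by (simp add: h.emeasure_space_1)
    finally show "(\<Sum>j. ?a j * ennreal (2 ^ j * pochhammer ?N j) * ennreal (x ^ j))
        = (\<Sum>j. ennreal ((1 / 2) ^ j / fact j) * ennreal (x ^ j))" by (simp only: R)
    show "(\<Sum>j. ennreal ((1 / 2) ^ j / fact j) * ennreal (x ^ j)) \<noteq> \<top>" unfolding R by simp
  qed simp
  from fun_cong[OF this, of j]
  have eq: "?a j * ennreal (2 ^ j * pochhammer ?N j) = ennreal ((1 / 2) ^ j / fact j)" .
  have p: "2 ^ j * pochhammer ?N j > 0" using pochhammer_pos[OF N, of j] by simp
  have "ennreal q * ennreal (1 / q) = 1" if "q > 0" for q :: real
    using that by (simp add: ennreal_mult[symmetric])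
  from this[OF p] have "?a j = ?a j * ennreal (2 ^ j * pochhammer ?N j) * ennreal (1 / (2 ^ j * pochhammer ?N j))"
    by (simp only: mult.assoc mult_1_right)
  also have "\<dots> = ennreal ((1 / 2) ^ j / fact j * (1 / (2 ^ j * pochhammer ?N j)))"
    unfolding eq using p by (intro ennreal_mult[symmetric]) auto
  also have "(1 / 2) ^ j / fact j * (1 / (2 ^ j * pochhammer ?N j)) = 1 / (4 ^ j * fact j * pochhammer ?N j)"
  proof -
    have "(4 :: real) ^ j = 2 ^ j * 2 ^ j" by (simp add: power_mult_distrib[symmetric])
    thus ?thesis by (simp add: power_divide mult_ac)
  qed
  finally show ?thesis .
qed

text \<open>The right-hand side is the hypergeometric function 0F1 at \<open>nsq n w / 4\<close>,
  with parameter half the real dimension.\<close>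

lemma haar_col_laplace:
  assumes i: "i < n" and w: "\<And>k. k < n \<Longrightarrow> w k \<in> F"
  shows "(\<integral>\<^sup>+V. ennreal (exp (Re (rowmul n w V i))) \<partial>\<nu>)
    = (\<Sum>j. ennreal (nsq n w ^ j) * ennreal (1 / (4 ^ j * fact j * pochhammer (real (n * card (parts F)) / 2) j)))"
  by (simp only: haar_exp_series[OF i w] haar_entry_moment[OF i])

text \<open>
  The norm of a Gaussian vector and its direction are independent, and the direction has the law of
  a row of a Haar matrix.
\<close>

lemma haar_row_moment:
  assumes i: "i < n" and M: "M \<in> carrier_mat n m"
    and MF: "\<And>i k. i < n \<Longrightarrow> k < m \<Longrightarrow> M $$ (i, k) \<in> F"
    and s: "s > 0"
    and fin: "\<And>x. 0 \<le> x \<Longrightarrow> x < s \<Longrightarrow>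
      (\<integral>\<^sup>+\<omega>. ennreal (exp (x * nsq m (rowmul n (gvec F \<omega>) M) / 2)) \<partial>gauss F n) \<noteq> \<top>"
  shows "ennreal (pochhammer (real (n * card (parts F)) / 2) j / fact j)
      * (\<integral>\<^sup>+U. ennreal (nsq m (rowmul n (\<lambda>k. U $$ (i, k)) M) ^ j) \<partial>\<nu>)
    = (\<integral>\<^sup>+\<omega>. ennreal ((nsq m (rowmul n (gvec F \<omega>) M) / 2) ^ j / fact j) \<partial>gauss F n)"
proof -
  let ?N = "real (n * card (parts F)) / 2"
  let ?b = "\<lambda>j. \<integral>\<^sup>+U. ennreal (nsq m (rowmul n (\<lambda>k. U $$ (i, k)) M) ^ j) \<partial>\<nu>"
  interpret g: prob_space "gauss F n" by (rule prob_space_gauss)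
  interpret h: prob_space \<nu> by (rule haar_prob[OF F haar])
  interpret pair_sigma_finite "gauss F n" \<nu> ..
  have [measurable]: "(\<lambda>U. U $$ (i, k)) \<in> borel_measurable \<nu>" if "k < n" for k by (rule measurable_haar_entry[OF F haar i that])
  have mrow [measurable]: "(\<lambda>U. rowmul n (\<lambda>k. of_real r * U $$ (i, k)) M l) \<in> borel_measurable \<nu>" for l and r :: real
    unfolding rowmul_def by measurable
  have [measurable]: "(\<lambda>U. rowmul n (\<lambda>k. U $$ (i, k)) M l) \<in> borel_measurable \<nu>" for l
    unfolding rowmul_def by measurable
  have "(\<lambda>j. ennreal (pochhammer ?N j / fact j) * ?b j)
      = (\<lambda>j. \<integral>\<^sup>+\<omega>. ennreal ((nsq m (rowmul n (gvec F \<omega>) M) / 2) ^ j / fact j) \<partial>gauss F n)"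
  proof (rule ennreal_power_series_unique[OF s])
    fix x :: real assume x: "0 \<le> x" "x < s"
    let ?D = "\<integral>\<^sup>+\<omega>. ennreal (exp (x * (nsq m (rowmul n (gvec F \<omega>) M) / 2))) \<partial>gauss F n"
    have R: "(\<Sum>j. (\<integral>\<^sup>+\<omega>. ennreal ((nsq m (rowmul n (gvec F \<omega>) M) / 2) ^ j / fact j) \<partial>gauss F n) * ennreal (x ^ j)) = ?D"
      by (rule nn_integral_exp_series[symmetric]) (use x in auto)
    show "(\<Sum>j. (\<integral>\<^sup>+\<omega>. ennreal ((nsq m (rowmul n (gvec F \<omega>) M) / 2) ^ j / fact j) \<partial>gauss F n) * ennreal (x ^ j)) \<noteq> \<top>"
      unfolding R using fin[OF x] by simp
    let ?h = "\<lambda>v. ennreal (exp (x * (nsq m (rowmul n v M) / 2)))"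
    let ?T = "\<lambda>\<omega> U j. ennreal (nsq n (gvec F \<omega>) ^ j) * (ennreal (nsq m (rowmul n (\<lambda>k. U $$ (i, k)) M) ^ j)
        * ennreal ((x / 2) ^ j / fact j))"
    have "(\<Sum>j. ennreal (pochhammer ?N j / fact j) * ?b j * ennreal (x ^ j))
        = (\<Sum>j. \<integral>\<^sup>+\<omega>. ennreal (nsq n (gvec F \<omega>) ^ j) * (?b j * ennreal ((x / 2) ^ j / fact j)) \<partial>gauss F n)"
    proof (rule suminf_cong)
      fix j
      have e: "ennreal (pochhammer ?N j / fact j) * ennreal (x ^ j)
          = ennreal (2 ^ j * pochhammer ?N j) * ennreal ((x / 2) ^ j / fact j)"
        using x by (simp add: ennreal_mult[symmetric] pochhammer_nonneg_real power_divide)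
      have "ennreal (pochhammer ?N j / fact j) * ?b j * ennreal (x ^ j)
          = (ennreal (pochhammer ?N j / fact j) * ennreal (x ^ j)) * ?b j"
        by (simp only: mult_ac)
      also have "\<dots> = ennreal (2 ^ j * pochhammer ?N j) * ennreal ((x / 2) ^ j / fact j) * ?b j"
        by (simp only: e)
      also have "\<dots> = (\<integral>\<^sup>+\<omega>. ennreal (nsq n (gvec F \<omega>) ^ j) \<partial>gauss F n) * (?b j * ennreal ((x / 2) ^ j / fact j))"
        by (simp only: gauss_norm_moment[OF F] mult_ac)
      also have "\<dots> = (\<integral>\<^sup>+\<omega>. ennreal (nsq n (gvec F \<omega>) ^ j) * (?b j * ennreal ((x / 2) ^ j / fact j)) \<partial>gauss F n)"
        by (rule nn_integral_multc[symmetric]) measurable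
      finally show "ennreal (pochhammer ?N j / fact j) * ?b j * ennreal (x ^ j)
          = (\<integral>\<^sup>+\<omega>. ennreal (nsq n (gvec F \<omega>) ^ j) * (?b j * ennreal ((x / 2) ^ j / fact j)) \<partial>gauss F n)" .
    qed
    also have "\<dots> = (\<integral>\<^sup>+\<omega>. (\<Sum>j. ennreal (nsq n (gvec F \<omega>) ^ j) * (?b j * ennreal ((x / 2) ^ j / fact j))) \<partial>gauss F n)"
      by (rule nn_integral_suminf[symmetric]) measurable
    also have "\<dots> = (\<integral>\<^sup>+\<omega>. \<integral>\<^sup>+U. ?h (rowmul n (gvec F \<omega>) U) \<partial>\<nu> \<partial>gauss F n)"
    proof (rule nn_integral_cong)
      fix \<omega>
      \<comment> \<open>For fixed \<open>g\<close>, the vector \<open>g U\<close> has the law of the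
        norm of \<open>g\<close> times row \<open>i\<close> of \<open>U\<close>; this separates norm
        from direction.\<close>
      have "(\<integral>\<^sup>+U. ?h (rowmul n (gvec F \<omega>) U) \<partial>\<nu>) = (\<integral>\<^sup>+U. ?h (\<lambda>k. of_real (sqrt (nsq n (gvec F \<omega>))) * U $$ (i, k)) \<partial>\<nu>)"
      proof (rule haar_rowmul[OF F haar i gvec_in[OF F]])
        fix v v' :: "nat \<Rightarrow> complex" assume "\<And>k. k < n \<Longrightarrow> v k = v' k"
        hence "rowmul n v M = rowmul n v' M" by (rule rowmul_cong)
        thus "?h v = ?h v'" by simp
      qed measurable
      also have "\<dots> = (\<integral>\<^sup>+U. (\<Sum>j. ?T \<omega> U j) \<partial>\<nu>)"
      proof (rule nn_integral_cong)
        fix U :: "complex mat"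
        have "x * (nsq m (rowmul n (\<lambda>k. of_real (sqrt (nsq n (gvec F \<omega>))) * U $$ (i, k)) M) / 2)
            = nsq n (gvec F \<omega>) * nsq m (rowmul n (\<lambda>k. U $$ (i, k)) M) * (x / 2)"
          by (simp add: rowmul_scale nsq_scale)
        hence "?h (\<lambda>k. of_real (sqrt (nsq n (gvec F \<omega>))) * U $$ (i, k))
            = (\<Sum>j. ennreal ((nsq n (gvec F \<omega>) * nsq m (rowmul n (\<lambda>k. U $$ (i, k)) M) * (x / 2)) ^ j / fact j))"
          using x by (simp add: ennreal_exp_series del: times_divide_eq_right)
        also have "\<dots> = (\<Sum>j. ?T \<omega> U j)"
        proof (rule suminf_cong)
          fix j
          have "(nsq n (gvec F \<omega>) * nsq m (rowmul n (\<lambda>k. U $$ (i, k)) M) * (x / 2)) ^ j / fact j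
              = nsq n (gvec F \<omega>) ^ j * (nsq m (rowmul n (\<lambda>k. U $$ (i, k)) M) ^ j * ((x / 2) ^ j / fact j))"
            by (simp add: power_mult_distrib power_divide)
          thus "ennreal ((nsq n (gvec F \<omega>) * nsq m (rowmul n (\<lambda>k. U $$ (i, k)) M) * (x / 2)) ^ j / fact j) = ?T \<omega> U j"
            using x by (simp add: ennreal_mult del: times_divide_eq_right)
        qed
        finally show "?h (\<lambda>k. of_real (sqrt (nsq n (gvec F \<omega>))) * U $$ (i, k)) = (\<Sum>j. ?T \<omega> U j)" .
      qed
      also have "\<dots> = (\<Sum>j. \<integral>\<^sup>+U. ?T \<omega> U j \<partial>\<nu>)"
        by (rule nn_integral_suminf) measurable
      also have "\<dots> = (\<Sum>j. ennreal (nsq n (gvec F \<omega>) ^ j) * (?b j * ennreal ((x / 2) ^ j / fact j)))"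
        by (intro suminf_cong, subst nn_integral_cmult, measurable, subst nn_integral_multc, measurable)
      finally show "(\<Sum>j. ennreal (nsq n (gvec F \<omega>) ^ j) * (?b j * ennreal ((x / 2) ^ j / fact j)))
          = (\<integral>\<^sup>+U. ?h (rowmul n (gvec F \<omega>) U) \<partial>\<nu>)" by simp
    qed
    also have "\<dots> = (\<integral>\<^sup>+U. \<integral>\<^sup>+\<omega>. ?h (rowmul n (gvec F \<omega>) U) \<partial>gauss F n \<partial>\<nu>)"
    proof (rule Fubini'[symmetric])
      have [measurable]: "(\<lambda>z. rowmul n (rowmul n (gvec F (fst z)) (snd z)) M l) \<in> borel_measurable (gauss F n \<Otimes>\<^sub>M \<nu>)" for l
        unfolding rowmul_def[of n "rowmul n _ _"] by measurable
      show "(\<lambda>(\<omega>, U). ?h (rowmul n (gvec F \<omega>) U)) \<in> borel_measurable (gauss F n \<Otimes>\<^sub>M \<nu>)"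
        unfolding split_beta' by measurable
    qed
    \<comment> \<open>For fixed \<open>U\<close>, rotation invariance removes \<open>U\<close> from
      the Gaussian integral.\<close>
    also have "\<dots> = (\<integral>\<^sup>+U. ?D \<partial>\<nu>)"
    proof (rule nn_integral_cong)
      fix U assume "U \<in> space \<nu>"
      hence U: "U \<in> unitary_group F n" by (simp add: space_haar[OF F haar])
      let ?M = "of_real (sqrt x) \<cdot>\<^sub>m M"
      have xM: "?M \<in> carrier_mat n m" using M by simp
      have sc: "nsq m (rowmul n v ?M) = x * nsq m (rowmul n v M)" for v
      proof -
        have "rowmul n v ?M k = of_real (sqrt x) * rowmul n v M k" if "k < m" for k
          using that M by (simp add: rowmul_def sum_distrib_left mult_ac)
        hence "nsq m (rowmul n v ?M) = nsq m (\<lambda>k. of_real (sqrt x) * rowmul n v M k)" by (rule nsq_cong)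
        thus ?thesis using x by (simp add: nsq_scale)
      qed
      have "nsq m (rowmul n v (U * ?M)) = x * nsq m (rowmul n (rowmul n v U) M)" for v
        using nsq_cong[of m "rowmul n v (U * ?M)" "rowmul n (rowmul n v U) ?M"]
          rowmul_mult[OF unitary_groupD(1)[OF U] xM] by (simp add: sc)
      moreover have "(\<integral>\<^sup>+\<omega>. ennreal (exp (nsq m (rowmul n (gvec F \<omega>) (U * ?M)) / 2)) \<partial>gauss F n)
          = (\<integral>\<^sup>+\<omega>. ennreal (exp (nsq m (rowmul n (gvec F \<omega>) ?M) / 2)) \<partial>gauss F n)"
        by (rule gauss_rotation[OF F U xM]) (use F M MF in \<open>auto intro!: Reals_mult\<close>)
      ultimately show "(\<integral>\<^sup>+\<omega>. ?h (rowmul n (gvec F \<omega>) U) \<partial>gauss F n) = ?D"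
        by (simp add: sc)
    qed
    also have "\<dots> = ?D" by (simp add: h.emeasure_space_1)
    finally show "(\<Sum>j. ennreal (pochhammer ?N j / fact j) * ?b j * ennreal (x ^ j))
        = (\<Sum>j. (\<integral>\<^sup>+\<omega>. ennreal ((nsq m (rowmul n (gvec F \<omega>) M) / 2) ^ j / fact j) \<partial>gauss F n) * ennreal (x ^ j))"
      by (simp only: R)
  qed
  from fun_cong[OF this, of j] show ?thesis .
qed

end

section \<open>The spherical integral as an exact power series\<close>

text \<open>The elementary matrix selects a single entry of the product, so only row
  \<open>b\<close> of the first Haar matrix and column \<open>a\<close> of the second
  matter.\<close>

lemma mat_trace_elementary_mult:
  assumes E: "E = mat m n (\<lambda>kl. if kl = (a, b) then 1 else 0)" "a < m" "b < n"
    and A: "A \<in> carrier_mat n n" and M: "M \<in> carrier_mat n m" and B: "B \<in> carrier_mat m m"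
  shows "mat_trace (E * A * M * B) = rowmul m (rowmul n (\<lambda>k. A $$ (b, k)) M) B a"
proof -
  have Ec: "E \<in> carrier_mat m n" by (simp add: E)
  have AM: "A * M \<in> carrier_mat n m" by (rule mult_carrier_mat[OF A M])
  have AMB: "A * M * B \<in> carrier_mat n m" by (rule mult_carrier_mat[OF AM B])
  have "E * A * M * B = E * (A * M * B)"
    by (simp add: assoc_mult_mat[OF Ec A M] assoc_mult_mat[OF Ec AM B])
  hence "mat_trace (E * A * M * B) = (\<Sum>i<m. (E * (A * M * B)) $$ (i, i))"
    using Ec by (simp add: mat_trace_def)
  also have "\<dots> = (\<Sum>i<m. \<Sum>k<n. E $$ (i, k) * (A * M * B) $$ (k, i))"
    by (rule sum.cong) (use index_mult_sum[OF Ec AMB] in auto)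
  also have "\<dots> = (\<Sum>i<m. \<Sum>k<n. if k = b then if i = a then (A * M * B) $$ (b, a) else 0 else 0)"
    by (intro sum.cong) (auto simp: E simp del: index_mult_mat)
  also have "\<dots> = (A * M * B) $$ (b, a)" using E by (simp del: index_mult_mat)
  also have "\<dots> = (\<Sum>l<m. (A * M) $$ (b, l) * B $$ (l, a))"
    by (rule index_mult_sum[OF AM B]) (use E in auto)
  also have "\<dots> = rowmul m (rowmul n (\<lambda>k. A $$ (b, k)) M) B a"
    unfolding rowmul_def by (rule sum.cong) (use index_mult_sum[OF A M E(3)] in auto)
  finally show ?thesis .
qed

lemma pochhammer_eq_power_prod:
  fixes a :: real
  assumes "a > 0"
  shows "pochhammer a j = a ^ j * (\<Prod>i<j. 1 + real i / a)"
proof -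
  have "pochhammer a j = (\<Prod>i<j. a * (1 + real i / a))"
    unfolding pochhammer_prod atLeast0LessThan by (rule prod.cong) (use assms in \<open>auto simp: field_simps\<close>)
  thus ?thesis by (simp add: prod.distrib)
qed

text \<open>The normalisation \<open>sqrt (n * m)\<close> is exactly what cancels the leading powers
  of the two Pochhammer symbols: \<open>4 * (m * \<beta> / 2) * (n * \<beta> / 2) = n * m *
  \<beta>\<^sup>2\<close>. What remains is \<theta> divided by \<beta> and the slowly growing
  product.\<close>

lemma spherical_transform_coefficient:
  fixes n m \<beta> :: nat and \<theta> :: real
  assumes "n > 0" "m > 0" "\<beta> > 0"
  shows "(real (n * m) * \<theta>\<^sup>2) ^ j / (4 ^ j * pochhammer (real (m * \<beta>) / 2) j * pochhammer (real (n * \<beta>) / 2) j)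
    = (\<theta> / \<beta>) ^ (2 * j) / (\<Prod>i<j. (1 + 2 * real i / (n * \<beta>)) * (1 + 2 * real i / (m * \<beta>)))"
proof -
  let ?a = "real (m * \<beta>) / 2" and ?b = "real (n * \<beta>) / 2"
  have pos: "?a > 0" "?b > 0" using assms by auto
  have "(real (n * m) * \<theta>\<^sup>2) ^ j / (4 ^ j * pochhammer ?a j * pochhammer ?b j)
      = (real (n * m) * \<theta>\<^sup>2) ^ j / (4 ^ j * ?a ^ j * ?b ^ j) / ((\<Prod>i<j. 1 + real i / ?a) * (\<Prod>i<j. 1 + real i / ?b))"
    by (simp only: pochhammer_eq_power_prod[OF pos(1)] pochhammer_eq_power_prod[OF pos(2)]) (simp add: mult_ac)
  also have "(real (n * m) * \<theta>\<^sup>2) ^ j / (4 ^ j * ?a ^ j * ?b ^ j) = (real (n * m) * \<theta>\<^sup>2 / (4 * ?a * ?b)) ^ j"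
    by (simp only: power_divide power_mult_distrib)
  also have "real (n * m) * \<theta>\<^sup>2 / (4 * ?a * ?b) = (\<theta> / \<beta>)\<^sup>2"
    using assms by (simp add: field_simps power2_eq_square)
  also have "((\<theta> / \<beta>)\<^sup>2) ^ j = (\<theta> / \<beta>) ^ (2 * j)" by (simp only: power_mult)
  also have "(\<Prod>i<j. 1 + real i / ?a) * (\<Prod>i<j. 1 + real i / ?b) = (\<Prod>i<j. (1 + 2 * real i / (n * \<beta>)) * (1 + 2 * real i / (m * \<beta>)))"
    by (simp add: prod.distrib mult.commute mult.left_commute)
  finally show ?thesis .
qed

lemma one_le_mult: "1 \<le> a \<Longrightarrow> 1 \<le> b \<Longrightarrow> 1 \<le> a * (b :: real)"
  using mult_mono[of 1 a 1 b] by simp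

text \<open>\<open>V\<close> is integrated first, with \<open>U\<close> fixed. One column of
  \<open>V\<close> yields a series in the squared norm of a row of \<open>U\<close> times
  \<open>M\<close>, and the moments of that norm are the Gaussian moments up to the factor
  \<open>fact j / pochhammer\<close>.\<close>

lemma haar_trace_laplace:
  fixes M E :: "complex mat" and \<theta> :: real and c :: "nat \<Rightarrow> real"
  assumes F: "F = \<real> \<or> F = UNIV" and n: "n \<ge> 1"
    and M: "M \<in> carrier_mat n m" and MF: "\<And>i k. i < n \<Longrightarrow> k < m \<Longrightarrow> M $$ (i, k) \<in> F"
    and E: "E \<in> elementary_mats m n" and P: "prob_space P"
    and U: "haar_distributed F n P U" and V: "haar_distributed F m P V"
    and indep: "prob_space.indep_var P (unitary_space F n) U (unitary_space F m) V"
    and s: "s > 0"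
    and fin: "\<And>x. 0 \<le> x \<Longrightarrow> x < s \<Longrightarrow>
      (\<integral>\<^sup>+\<omega>. ennreal (exp (x * nsq m (rowmul n (gvec F \<omega>) M) / 2)) \<partial>gauss F n) \<noteq> \<top>"
    and c0: "\<And>j. 0 \<le> c j"
    and c: "\<And>j. (\<integral>\<^sup>+\<omega>. ennreal ((nsq m (rowmul n (gvec F \<omega>) M) / 2) ^ j / fact j) \<partial>gauss F n) = ennreal (c j)"
  shows "(\<integral>\<^sup>+\<omega>. ennreal (exp (sqrt (real n * real m) * \<theta> * Re (mat_trace (E * U \<omega> * M * V \<omega>)))) \<partial>P)
    = (\<Sum>j. ennreal (c j * ((\<theta> / card (parts F)) ^ (2 * j)
          / (\<Prod>i<j. (1 + 2 * real i / (n * card (parts F))) * (1 + 2 * real i / (m * card (parts F)))))))"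
proof -
  interpret P: prob_space P by (rule P)
  obtain a b where E': "E = mat m n (\<lambda>kl. if kl = (a, b) then 1 else 0)" and a: "a < m" and b: "b < n"
    using E by (auto simp: elementary_mats_def)
  define r where "r = sqrt (real n * real m) * \<theta>"
  define \<nu> where "\<nu> = distr P (unitary_space F n) U"
  define \<nu>' where "\<nu>' = distr P (unitary_space F m) V"
  have Um [measurable]: "U \<in> measurable P (unitary_space F n)" and h: "is_haar_measure F n \<nu>"
    using U by (auto simp: haar_distributed_def \<nu>_def)
  have Vm [measurable]: "V \<in> measurable P (unitary_space F m)" and h': "is_haar_measure F m \<nu>'"
    using V by (auto simp: haar_distributed_def \<nu>'_def)
  interpret \<nu>: prob_space \<nu> by (rule haar_prob[OF F h])
  interpret \<nu>': prob_space \<nu>' by (rule haar_prob[OF F h'])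
  interpret pair_sigma_finite \<nu> \<nu>' ..
  \<comment> \<open>Independence enters here, as a product law for the pair.\<close>
  have joint: "\<nu> \<Otimes>\<^sub>M \<nu>' = distr P (unitary_space F n \<Otimes>\<^sub>M unitary_space F m) (\<lambda>\<omega>. (U \<omega>, V \<omega>))"
    using indep by (simp add: P.indep_var_distribution_eq \<nu>_def \<nu>'_def)
  have inF: "(\<Sum>i\<in>I. x i * y i) \<in> F" if "\<And>i. i \<in> I \<Longrightarrow> x i \<in> F" "\<And>i. i \<in> I \<Longrightarrow> y i \<in> F"
    for I and x y :: "nat \<Rightarrow> complex"
    using F that by (auto intro!: sum_in_Reals Reals_mult)
  let ?w = "\<lambda>u l. of_real r * rowmul n (\<lambda>k. u $$ (b, k)) M l"
  let ?f = "\<lambda>u v. ennreal (exp (Re (rowmul m (?w u) v a)))"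
  let ?\<beta> = "card (parts F)"
  let ?q = "\<lambda>j. 1 / (4 ^ j * fact j * pochhammer (real (m * ?\<beta>) / 2) j)"
  let ?t = "\<lambda>u. nsq m (rowmul n (\<lambda>k. u $$ (b, k)) M)"
  have meas: "(\<lambda>z. ?f (fst z) (snd z)) \<in> borel_measurable (unitary_space F n \<Otimes>\<^sub>M unitary_space F m)"
  proof -
    have [measurable]: "(\<lambda>z. fst z $$ (b, k)) \<in> borel_measurable (unitary_space F n \<Otimes>\<^sub>M unitary_space F m)" if "k < n" for k
      by (rule measurable_unitary_entry[OF measurable_fst b that])
    have [measurable]: "(\<lambda>z. snd z $$ (l, a)) \<in> borel_measurable (unitary_space F n \<Otimes>\<^sub>M unitary_space F m)" if "l < m" for l
      by (rule measurable_unitary_entry[OF measurable_snd that a])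
    show ?thesis unfolding rowmul_def by measurable
  qed
  have mt: "?t \<in> borel_measurable \<nu>"
  proof -
    have [measurable]: "(\<lambda>u. u $$ (b, k)) \<in> borel_measurable \<nu>" if "k < n" for k
      by (rule measurable_haar_entry[OF F h b that])
    show ?thesis unfolding rowmul_def by measurable
  qed
  have "(\<integral>\<^sup>+\<omega>. ennreal (exp (r * Re (mat_trace (E * U \<omega> * M * V \<omega>)))) \<partial>P)
      = (\<integral>\<^sup>+\<omega>. ?f (U \<omega>) (V \<omega>) \<partial>P)"
  proof (rule nn_integral_cong)
    fix \<omega> assume w: "\<omega> \<in> space P"
    have "U \<omega> \<in> carrier_mat n n" "V \<omega> \<in> carrier_mat m m"
      using measurable_space[OF Um w] measurable_space[OF Vm w]
      by (auto simp: space_unitary_space dest: unitary_groupD(1))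
    thus "ennreal (exp (r * Re (mat_trace (E * U \<omega> * M * V \<omega>)))) = ?f (U \<omega>) (V \<omega>)"
      by (simp add: mat_trace_elementary_mult[OF E' a b _ M] rowmul_scale)
  qed
  also have "\<dots> = (\<integral>\<^sup>+z. ?f (fst z) (snd z) \<partial>(\<nu> \<Otimes>\<^sub>M \<nu>'))"
    unfolding joint by (subst nn_integral_distr) (use meas in auto)
  also have "\<dots> = (\<integral>\<^sup>+u. \<integral>\<^sup>+v. ?f u v \<partial>\<nu>' \<partial>\<nu>)"
  proof -
    have "(\<lambda>z. ?f (fst z) (snd z)) \<in> borel_measurable (\<nu> \<Otimes>\<^sub>M \<nu>')"
      using meas unfolding joint by simp
    from \<nu>'.nn_integral_fst[OF this] show ?thesis by simp
  qed
  also have "\<dots> = (\<integral>\<^sup>+u. (\<Sum>j. ennreal (?t u ^ j) * ennreal ((r\<^sup>2) ^ j * ?q j)) \<partial>\<nu>)"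
  proof (rule nn_integral_cong)
    fix u assume "u \<in> space \<nu>"
    hence u: "u \<in> unitary_group F n" by (simp add: space_haar[OF F h])
    have wF: "?w u l \<in> F" if "l < m" for l
    proof -
      have "rowmul n (\<lambda>k. u $$ (b, k)) M l \<in> F"
        unfolding rowmul_def by (rule inF) (use unitary_groupD(4)[OF u b] MF that in auto)
      thus ?thesis using F by (auto intro!: Reals_mult)
    qed
    have "?f u = (\<lambda>v. ennreal (exp (Re (rowmul m (?w u) v a))))" ..
    hence "(\<integral>\<^sup>+v. ?f u v \<partial>\<nu>') = (\<Sum>j. ennreal (nsq m (?w u) ^ j) * ennreal (?q j))"
      using haar_col_laplace[OF F h' a wF] by simp
    also have "\<dots> = (\<Sum>j. ennreal (?t u ^ j) * ennreal ((r\<^sup>2) ^ j * ?q j))"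
    proof (rule suminf_cong)
      fix j
      have "nsq m (?w u) ^ j = ?t u ^ j * (r\<^sup>2) ^ j"
        by (simp add: nsq_scale power_mult_distrib mult.commute)
      thus "ennreal (nsq m (?w u) ^ j) * ennreal (?q j) = ennreal (?t u ^ j) * ennreal ((r\<^sup>2) ^ j * ?q j)"
        by (simp add: ennreal_mult pochhammer_nonneg_real mult.assoc del: times_divide_eq_right times_divide_eq_left)
    qed
    finally show "(\<integral>\<^sup>+v. ?f u v \<partial>\<nu>') = (\<Sum>j. ennreal (?t u ^ j) * ennreal ((r\<^sup>2) ^ j * ?q j))" .
  qed
  also have "\<dots> = (\<Sum>j. \<integral>\<^sup>+u. ennreal (?t u ^ j) * ennreal ((r\<^sup>2) ^ j * ?q j) \<partial>\<nu>)"
    by (rule nn_integral_suminf) (use mt in measurable)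
  also have "\<dots> = (\<Sum>j. (\<integral>\<^sup>+u. ennreal (?t u ^ j) \<partial>\<nu>) * ennreal ((r\<^sup>2) ^ j * ?q j))"
    by (intro suminf_cong nn_integral_multc) (use mt in measurable)
  also have "\<dots> = (\<Sum>j. ennreal (c j * ((\<theta> / ?\<beta>) ^ (2 * j)
          / (\<Prod>i<j. (1 + 2 * real i / (n * ?\<beta>)) * (1 + 2 * real i / (m * ?\<beta>))))))"
  proof (rule suminf_cong)
    fix j
    have \<beta>: "?\<beta> > 0" using F by (auto simp: UNIV_bool)
    let ?p = "pochhammer (real (n * ?\<beta>) / 2) j" and ?p' = "pochhammer (real (m * ?\<beta>) / 2) j"
    have pp: "?p > 0" "?p' > 0" using n a \<beta> by (auto intro!: pochhammer_pos)
    have fp: "0 \<le> fact j / ?p" "0 \<le> ?p / fact j" using pp(1) by simp_all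
    have "fact j / ?p * (?p / fact j) = 1" using pp(1) by simp
    hence "(\<integral>\<^sup>+u. ennreal (?t u ^ j) \<partial>\<nu>) = ennreal (fact j / ?p) * (ennreal (?p / fact j) * (\<integral>\<^sup>+u. ennreal (?t u ^ j) \<partial>\<nu>))"
      by (simp only: mult.assoc[symmetric] ennreal_mult[OF fp, symmetric] ennreal_1 mult_1_left)
    also have "\<dots> = ennreal (fact j / ?p) * ennreal (c j)"
      by (simp only: haar_row_moment[OF F h b M MF s fin] c)
    also have "\<dots> = ennreal (fact j / ?p * c j)" using fp c0 by (intro ennreal_mult[symmetric]) auto
    finally have "(\<integral>\<^sup>+u. ennreal (?t u ^ j) \<partial>\<nu>) * ennreal ((r\<^sup>2) ^ j * ?q j)
        = ennreal (fact j / ?p * c j) * ennreal ((r\<^sup>2) ^ j * ?q j)" by (rule arg_cong)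
    also have "\<dots> = ennreal (fact j / ?p * c j * ((r\<^sup>2) ^ j * ?q j))"
      using fp c0 pp by (intro ennreal_mult[symmetric] mult_nonneg_nonneg) auto
    also have "fact j / ?p * c j * ((r\<^sup>2) ^ j * ?q j) = c j * ((r\<^sup>2) ^ j / (4 ^ j * ?p' * ?p))"
      by simp
    also have "(r\<^sup>2) ^ j / (4 ^ j * ?p' * ?p)
        = (\<theta> / ?\<beta>) ^ (2 * j) / (\<Prod>i<j. (1 + 2 * real i / (n * ?\<beta>)) * (1 + 2 * real i / (m * ?\<beta>)))"
    proof -
      have "r\<^sup>2 = real (n * m) * \<theta>\<^sup>2" by (simp add: r_def power_mult_distrib)
      thus ?thesis using spherical_transform_coefficient[of n m ?\<beta> \<theta> j] n a \<beta> by (simp only:)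
    qed
    finally show "(\<integral>\<^sup>+u. ennreal (?t u ^ j) \<partial>\<nu>) * ennreal ((r\<^sup>2) ^ j * ?q j)
        = ennreal (c j * ((\<theta> / ?\<beta>) ^ (2 * j) / (\<Prod>i<j. (1 + 2 * real i / (n * ?\<beta>)) * (1 + 2 * real i / (m * ?\<beta>)))))" .
  qed
  finally show ?thesis by (simp only: r_def)
qed

text \<open>Passes from extended to real numbers and eliminates the Gaussian vectors. What is kept
  is that one sequence \<open>c\<close> generates the determinant and, damped by the products, the
  expectation.\<close>

lemma haar_trace_laplace_expansion:
  fixes M E :: "complex mat"
  assumes F: "F = \<real> \<or> F = UNIV" and n: "n \<ge> 1"
    and M: "M \<in> carrier_mat n m" and MF: "elements_mat M \<subseteq> F"
    and E: "E \<in> elementary_mats m n" and P: "prob_space P"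
    and U: "haar_distributed F n P U" and V: "haar_distributed F m P V"
    and indep: "prob_space.indep_var P (unitary_space F n) U (unitary_space F m) V"
  obtains e c :: "nat \<Rightarrow> real" where "\<And>k. k < n \<Longrightarrow> 0 \<le> e k"
    "singular_values M = image_mset (\<lambda>k. sqrt (e k)) (mset_set {..<n})"
    "\<And>j. 0 \<le> c j"
    "\<And>x. 0 \<le> x \<Longrightarrow> (\<And>k. k < n \<Longrightarrow> x * e k < 1) \<Longrightarrow>
      (\<lambda>j. c j * x ^ j) sums (\<Prod>k<n. (1 - x * e k) powr (- card (parts F) / 2))"
    "\<And>\<theta>. (\<And>k. k < n \<Longrightarrow> (\<theta> / card (parts F))\<^sup>2 * e k < 1) \<Longrightarrow>
      (\<lambda>j. c j * ((\<theta> / card (parts F)) ^ (2 * j)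
          / (\<Prod>i<j. (1 + 2 * real i / (n * card (parts F))) * (1 + 2 * real i / (m * card (parts F))))))
      sums prob_space.expectation P
        (\<lambda>\<omega>. exp (sqrt (real n * real m) * \<theta> * Re (mat_trace (E * U \<omega> * M * V \<omega>))))"
proof -
  interpret P: prob_space P by (rule P)
  have MF': "M $$ (i, k) \<in> F" if "i < n" "k < m" for i k
    using MF elements_matI[OF M that refl] by auto
  let ?\<beta> = "card (parts F)"
  let ?X = "\<lambda>\<omega>. nsq m (rowmul n (gvec F \<omega>) M)"
  obtain e where e: "\<And>k. k < n \<Longrightarrow> 0 \<le> e k"
    and sv: "singular_values M = image_mset (\<lambda>k. sqrt (e k)) (mset_set {..<n})"
    and D: "\<And>x. 0 \<le> x \<Longrightarrow> (\<And>k. k < n \<Longrightarrow> x * e k < 1) \<Longrightarrow>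
      (\<integral>\<^sup>+\<omega>. ennreal (exp (x * ?X \<omega> / 2)) \<partial>gauss F n) = ennreal (\<Prod>k<n. (1 - x * e k) powr (- ?\<beta> / 2))"
    using gauss_exp_quadratic[OF F M MF'] by blast
  \<comment> \<open>The sum dominates every \<open>e k\<close>; the added 1 keeps the quotient
    defined and the resulting bound strict.\<close>
  define s where "s = 1 / (1 + (\<Sum>k<n. e k))"
  have e_sum: "(\<Sum>k<n. e k) \<ge> 0" by (rule sum_nonneg) (use e in auto)
  have s: "s > 0" using e_sum by (simp add: s_def)
  have small: "x * e k < 1" if "0 \<le> x" "x < s" "k < n" for x k
  proof -
    have "e k \<le> (\<Sum>k<n. e k)" by (rule member_le_sum) (use e that in auto)
    hence "x * e k \<le> x * (\<Sum>k<n. e k)" using that by (intro mult_left_mono) auto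
    also have "\<dots> \<le> s * (\<Sum>k<n. e k)" using that e_sum by (intro mult_right_mono) auto
    also have "\<dots> < 1" using e_sum by (simp add: s_def)
    finally show ?thesis .
  qed
  have fin: "(\<integral>\<^sup>+\<omega>. ennreal (exp (x * ?X \<omega> / 2)) \<partial>gauss F n) \<noteq> \<top>" if "0 \<le> x" "x < s" for x
    using D[OF that(1) small[OF that]] by simp
  let ?c = "\<lambda>j. \<integral>\<^sup>+\<omega>. ennreal ((?X \<omega> / 2) ^ j / fact j) \<partial>gauss F n"
  have ser: "(\<integral>\<^sup>+\<omega>. ennreal (exp (x * ?X \<omega> / 2)) \<partial>gauss F n) = (\<Sum>j. ?c j * ennreal (x ^ j))" if "0 \<le> x" for x
    using nn_integral_exp_series[of "\<lambda>\<omega>. ?X \<omega> / 2" "gauss F n" x] that by simp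
  have cfin: "?c j \<noteq> \<top>" for j
  proof
    assume "?c j = \<top>"
    hence "?c j * ennreal ((s / 2) ^ j) = \<top>" using s by (simp add: ennreal_top_mult)
    moreover have "?c j * ennreal ((s / 2) ^ j) \<le> (\<Sum>j. ?c j * ennreal ((s / 2) ^ j))"
      using sum_le_suminf[of "\<lambda>j. ?c j * ennreal ((s / 2) ^ j)" "{j}"] by simp
    ultimately show False using fin[of "s / 2"] ser[of "s / 2"] s by (simp add: top_unique)
  qed
  define c where "c = (\<lambda>j. enn2real (?c j))"
  have c: "?c j = ennreal (c j)" for j using cfin[of j] by (simp add: c_def less_top)
  have c0: "0 \<le> c j" for j by (simp add: c_def)
  have sums: "(\<lambda>j. c j * x ^ j) sums (\<Prod>k<n. (1 - x * e k) powr (- ?\<beta> / 2))"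
    if x: "0 \<le> x" "\<And>k. k < n \<Longrightarrow> x * e k < 1" for x
  proof -
    have eq: "(\<Sum>j. ennreal (c j * x ^ j)) = ennreal (\<Prod>k<n. (1 - x * e k) powr (- ?\<beta> / 2))"
      using D[OF x] ser[OF x(1)] x(1) c0 by (simp add: c ennreal_mult)
    have nn: "0 \<le> c j * x ^ j" for j using c0 x by simp
    have "summable (\<lambda>j. c j * x ^ j)"
      by (rule summable_suminf_not_top[OF nn]) (simp add: eq)
    moreover have "(\<Sum>j. c j * x ^ j) = (\<Prod>k<n. (1 - x * e k) powr (- ?\<beta> / 2))"
      using eq suminf_ennreal2[OF nn \<open>summable _\<close>] suminf_nonneg[OF \<open>summable _\<close> nn]
      by (simp add: prod_nonneg)
    ultimately show ?thesis by (metis summable_sums)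
  qed
  show thesis
  proof (rule that[OF e sv c0 sums])
    fix \<theta> :: real
    assume \<theta>: "\<And>k. k < n \<Longrightarrow> (\<theta> / ?\<beta>)\<^sup>2 * e k < 1"
    let ?w = "\<lambda>j. \<Prod>i<j. (1 + 2 * real i / (n * ?\<beta>)) * (1 + 2 * real i / (m * ?\<beta>))"
    let ?Z = "\<lambda>\<omega>. exp (sqrt (real n * real m) * \<theta> * Re (mat_trace (E * U \<omega> * M * V \<omega>)))"
    have w1: "?w j \<ge> 1" for j
      by (rule prod_ge_1) (rule one_le_mult, auto)
    have nn: "0 \<le> c j * ((\<theta> / ?\<beta>) ^ (2 * j) / ?w j)" for j
      using w1[of j] c0[of j] by (intro mult_nonneg_nonneg divide_nonneg_nonneg) (auto simp: power_mult)
    \<comment> \<open>The products are at least 1, so the determinant series at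
      \<open>(\<theta> / \<beta>)\<^sup>2\<close> dominates.\<close>
    have sm: "summable (\<lambda>j. c j * ((\<theta> / ?\<beta>) ^ (2 * j) / ?w j))"
    proof (rule summable_comparison_test')
      show "summable (\<lambda>j. c j * ((\<theta> / ?\<beta>)\<^sup>2) ^ j)" using sums[of "(\<theta> / ?\<beta>)\<^sup>2"] \<theta> by (auto simp: sums_iff)
      fix j
      have "(\<theta> / ?\<beta>) ^ (2 * j) / ?w j \<le> (\<theta> / ?\<beta>) ^ (2 * j) / 1"
        by (rule divide_left_mono) (use w1[of j] in \<open>auto simp: power_mult\<close>)
      hence "c j * ((\<theta> / ?\<beta>) ^ (2 * j) / ?w j) \<le> c j * (\<theta> / ?\<beta>) ^ (2 * j)"
        using c0[of j] by (intro mult_left_mono) auto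
      thus "norm (c j * ((\<theta> / ?\<beta>) ^ (2 * j) / ?w j)) \<le> c j * ((\<theta> / ?\<beta>)\<^sup>2) ^ j"
        using nn[of j] by (simp only: real_norm_def abs_of_nonneg power_mult)
    qed
    have mZ: "?Z \<in> borel_measurable P"
    proof -
      obtain a b where E': "E = mat m n (\<lambda>kl. if kl = (a, b) then 1 else 0)" and a: "a < m" and b: "b < n"
        using E by (auto simp: elementary_mats_def)
      have Um: "U \<in> measurable P (unitary_space F n)" and Vm: "V \<in> measurable P (unitary_space F m)"
        using U V by (auto simp: haar_distributed_def)
      have [measurable]: "(\<lambda>\<omega>. U \<omega> $$ (b, k)) \<in> borel_measurable P" if "k < n" for k
        by (rule measurable_unitary_entry[OF Um b that])
      have [measurable]: "(\<lambda>\<omega>. V \<omega> $$ (l, a)) \<in> borel_measurable P" if "l < m" for l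
        by (rule measurable_unitary_entry[OF Vm that a])
      have "(\<lambda>\<omega>. exp (sqrt (real n * real m) * \<theta> * Re (rowmul m (rowmul n (\<lambda>k. U \<omega> $$ (b, k)) M) (V \<omega>) a))) \<in> borel_measurable P"
        unfolding rowmul_def by measurable
      also have "?this \<longleftrightarrow> ?thesis"
      proof (rule measurable_cong)
        fix \<omega> assume w: "\<omega> \<in> space P"
        have "U \<omega> \<in> carrier_mat n n" "V \<omega> \<in> carrier_mat m m"
          using measurable_space[OF Um w] measurable_space[OF Vm w]
          by (auto simp: space_unitary_space dest: unitary_groupD(1))
        thus "exp (sqrt (real n * real m) * \<theta> * Re (rowmul m (rowmul n (\<lambda>k. U \<omega> $$ (b, k)) M) (V \<omega>) a)) = ?Z \<omega>"
          by (simp add: mat_trace_elementary_mult[OF E' a b _ M])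
      qed
      finally show ?thesis .
    qed
    have "P.expectation ?Z = enn2real (\<integral>\<^sup>+\<omega>. ennreal (?Z \<omega>) \<partial>P)"
      by (rule integral_eq_nn_integral[OF mZ]) simp
    also have "\<dots> = enn2real (\<Sum>j. ennreal (c j * ((\<theta> / ?\<beta>) ^ (2 * j) / ?w j)))"
      by (simp only: haar_trace_laplace[OF F n M MF' E P U V indep s fin c0 c])
    also have "\<dots> = (\<Sum>j. c j * ((\<theta> / ?\<beta>) ^ (2 * j) / ?w j))"
      using suminf_ennreal2[OF nn sm] suminf_nonneg[OF sm nn] by simp
    finally show "(\<lambda>j. c j * ((\<theta> / ?\<beta>) ^ (2 * j) / ?w j)) sums P.expectation ?Z"
      using summable_sums[OF sm] by simp
  qed
qed

section \<open>Bounds for tilted power series\<close>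

text \<open>The logarithm of the product of the factors \<open>T_rect l (2 * real i / N)\<close> is
  \<open>N / 2\<close> times a Riemann sum of this integral. For \<open>l \<ge> 0\<close> the
  integrand increases on the nonnegative axis, so \<open>W_rect l\<close> is convex there.\<close>

definition W_rect :: "real \<Rightarrow> real \<Rightarrow> real" where
  "W_rect l y = integral {0..y} (\<lambda>u. ln (T_rect l u))"

lemma T_rect_ge_1: "0 \<le> l \<Longrightarrow> 0 \<le> y \<Longrightarrow> 1 \<le> T_rect l y"
  unfolding T_rect_def by (rule one_le_mult) auto

lemma T_rect_mono:
  assumes "0 \<le> l" "0 \<le> y" "y \<le> y'"
  shows "T_rect l y \<le> T_rect l y'"
  unfolding T_rect_def using assms by (intro mult_mono add_right_mono mult_left_mono) auto

lemma ln_T_rect_mono: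
  assumes "0 \<le> l" "0 \<le> y" "y \<le> y'"
  shows "ln (T_rect l y) \<le> ln (T_rect l y')"
  using T_rect_mono[OF assms] T_rect_ge_1[of l y] assms by (subst ln_le_cancel_iff) auto

lemma ln_T_rect: "0 \<le> l \<Longrightarrow> 0 \<le> y \<Longrightarrow> ln (T_rect l y) = ln (1 + l * y) + ln (1 + y)"
proof -
  assume "0 \<le> l" "0 \<le> y"
  hence "1 + l * y > 0" "1 + y > 0" by (auto intro: add_pos_nonneg)
  thus ?thesis by (simp add: T_rect_def ln_mult add.commute)
qed

lemma ln_add_one_diff_le:
  fixes a b :: real
  assumes "0 \<le> a" "a \<le> b"
  shows "ln (1 + b) - ln (1 + a) \<le> b - a"
proof -
  have "ln (1 + b) - ln (1 + a) = ln ((1 + b) / (1 + a))" using assms by (simp add: ln_div)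
  also have "\<dots> \<le> (1 + b) / (1 + a) - 1" by (rule ln_le_minus_one) (use assms in auto)
  also have "\<dots> = (b - a) / (1 + a)" using assms by (simp add: field_simps)
  also have "\<dots> \<le> (b - a) / 1" by (rule divide_left_mono) (use assms in auto)
  finally show ?thesis by simp
qed

lemma ln_T_rect_lipschitz:
  assumes l: "0 \<le> l" "l \<le> 1" and y: "0 \<le> y" "y \<le> y'"
  shows "ln (T_rect l y') - ln (T_rect l y) \<le> 2 * (y' - y)"
proof -
  have "ln (1 + l * y') - ln (1 + l * y) \<le> l * y' - l * y"
    by (rule ln_add_one_diff_le) (use l y in \<open>auto intro: mult_left_mono\<close>)
  also have "\<dots> \<le> y' - y" using l y mult_right_mono[of l 1 "y' - y"] by (simp add: algebra_simps)
  finally have "ln (1 + l * y') - ln (1 + l * y) \<le> y' - y" .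
  moreover have "ln (1 + y') - ln (1 + y) \<le> y' - y" by (rule ln_add_one_diff_le) (use y in auto)
  ultimately show ?thesis using l y by (simp add: ln_T_rect)
qed

lemma continuous_on_ln_T_rect:
  assumes "0 \<le> l"
  shows "continuous_on {0..b} (\<lambda>u. ln (T_rect l u))"
proof -
  have "T_rect l u \<noteq> 0" if "u \<in> {0..b}" for u using T_rect_ge_1[of l u] assms that by auto
  thus ?thesis unfolding T_rect_def by (intro continuous_intros) auto
qed

lemma W_rect_diff:
  assumes l: "0 \<le> l" and ab: "0 \<le> a" "a \<le> b"
  shows "(b - a) * ln (T_rect l a) \<le> W_rect l b - W_rect l a"
    and "W_rect l b - W_rect l a \<le> (b - a) * ln (T_rect l b)"
proof -
  let ?g = "\<lambda>u. ln (T_rect l u)"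
  have int: "?g integrable_on {0..b}" by (rule integrable_continuous_real[OF continuous_on_ln_T_rect[OF l]])
  have int': "?g integrable_on {a..b}" by (rule integrable_subinterval_real[OF int]) (use ab in auto)
  have eq: "W_rect l b - W_rect l a = integral {a..b} ?g"
    using Henstock_Kurzweil_Integration.integral_combine[OF ab int] by (simp add: W_rect_def)
  have "integral {a..b} (\<lambda>_. ?g a) \<le> integral {a..b} ?g"
    by (rule integral_le[OF integrable_const_ivl int']) (use l ab in \<open>auto intro: ln_T_rect_mono\<close>)
  thus "(b - a) * ?g a \<le> W_rect l b - W_rect l a" using ab eq by simp
  have "integral {a..b} ?g \<le> integral {a..b} (\<lambda>_. ?g b)"
    by (rule integral_le[OF int' integrable_const_ivl]) (use l ab in \<open>auto intro: ln_T_rect_mono\<close>)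
  thus "W_rect l b - W_rect l a \<le> (b - a) * ?g b" using ab eq by simp
qed

lemma W_rect_0 [simp]: "W_rect l 0 = 0"
  by (simp add: W_rect_def)

lemma W_rect_tangent:
  assumes "0 \<le> l" "0 \<le> y" "0 \<le> y'"
  shows "(y - y') * ln (T_rect l y') \<le> W_rect l y - W_rect l y'"
proof (cases "y \<le> y'")
  case True
  thus ?thesis using W_rect_diff(2)[of l y y'] assms by (simp add: algebra_simps)
next
  case False
  thus ?thesis using W_rect_diff(1)[of l y' y] assms by simp
qed

text \<open>The increment is bounded by the slope at the far end, and that slope differs from the
  one at \<open>y'\<close> by at most \<open>2 * \<bar>y - y'\<bar>\<close>: each of the two factors
  of \<open>T_rect\<close> contributes 1 to the Lipschitz constant.\<close>

lemma W_rect_upper: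
  assumes l: "0 \<le> l" "l \<le> 1" and y: "0 \<le> y" "0 \<le> y'"
  shows "W_rect l y - W_rect l y' \<le> (y - y') * ln (T_rect l y') + 2 * (y - y')\<^sup>2"
proof -
  have 1: "W_rect l y - W_rect l y' \<le> (y - y') * ln (T_rect l y)"
    using W_rect_tangent[of l y' y] l y by (simp add: algebra_simps)
  have "(y - y') * (ln (T_rect l y) - ln (T_rect l y')) \<le> 2 * (y - y')\<^sup>2"
  proof (cases "y' \<le> y")
    case True
    have "(y - y') * (ln (T_rect l y) - ln (T_rect l y')) \<le> (y - y') * (2 * (y - y'))"
      by (rule mult_left_mono[OF ln_T_rect_lipschitz]) (use l y True in auto)
    thus ?thesis by (simp add: power2_eq_square algebra_simps)
  next
    case False
    have "(y' - y) * (ln (T_rect l y') - ln (T_rect l y)) \<le> (y' - y) * (2 * (y' - y))"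
      by (rule mult_left_mono[OF ln_T_rect_lipschitz]) (use l y False in auto)
    thus ?thesis by (simp add: power2_eq_square algebra_simps)
  qed
  thus ?thesis using 1 by (simp add: algebra_simps)
qed

text \<open>The summands increase, so the sum over \<open>i < j\<close> is a left Riemann sum. The
  right Riemann sum runs from 1 to \<open>j\<close>; including the index 0 costs nothing because
  \<open>T_rect l 0 = 1\<close>.\<close>

lemma sum_ln_T_rect_bounds:
  assumes l: "0 \<le> l" and N: "N > 0"
  shows "(\<Sum>i<j. ln (T_rect l (2 * real i / N))) \<le> N / 2 * W_rect l (2 * real j / N)"
    and "N / 2 * W_rect l (2 * real j / N) \<le> (\<Sum>i<Suc j. ln (T_rect l (2 * real i / N)))"
proof -
  have step: "ln (T_rect l (2 * real i / N)) \<le> N / 2 * (W_rect l (2 * real (Suc i) / N) - W_rect l (2 * real i / N))"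
    "N / 2 * (W_rect l (2 * real (Suc i) / N) - W_rect l (2 * real i / N)) \<le> ln (T_rect l (2 * real (Suc i) / N))" for i
  proof -
    have d: "2 * real (Suc i) / N - 2 * real i / N = 2 / N" using N by (simp add: field_simps)
    have o: "0 \<le> 2 * real i / N" "2 * real i / N \<le> 2 * real (Suc i) / N" using N by (auto simp: divide_right_mono)
    have "N / 2 * (2 / N * a) = a" for a using N by simp
    thus "ln (T_rect l (2 * real i / N)) \<le> N / 2 * (W_rect l (2 * real (Suc i) / N) - W_rect l (2 * real i / N))"
      "N / 2 * (W_rect l (2 * real (Suc i) / N) - W_rect l (2 * real i / N)) \<le> ln (T_rect l (2 * real (Suc i) / N))"
      using mult_left_mono[OF W_rect_diff(1)[OF l o], of "N / 2"] mult_left_mono[OF W_rect_diff(2)[OF l o], of "N / 2"] N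
      unfolding d by simp_all
  qed
  show "(\<Sum>i<j. ln (T_rect l (2 * real i / N))) \<le> N / 2 * W_rect l (2 * real j / N)"
  proof (induction j)
    case (Suc j)
    thus ?case using step(1)[of j] by (simp add: algebra_simps)
  qed simp
  show "N / 2 * W_rect l (2 * real j / N) \<le> (\<Sum>i<Suc j. ln (T_rect l (2 * real i / N)))"
  proof (induction j)
    case (Suc j)
    thus ?case using step(2)[of j] by (simp add: algebra_simps)
  qed (simp add: T_rect_def)
qed

text \<open>\<open>A\<close> is \<open>N / 2\<close> times the Legendre transform of
  \<open>W_rect l\<close> at \<open>ln z\<close>, attained at \<open>y\<close>. The extra
  \<open>ln z\<close> pays for the one term by which left and right Riemann sums differ, and
  \<open>4 / N\<close> is \<open>N / 2 * 2 * (2 / N)\<^sup>2\<close>, coming from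
  \<open>W_rect_upper\<close>.\<close>

lemma tilt_exponent_bounds:
  assumes l: "0 \<le> l" "l \<le> 1" and N: "N > 0" and y: "0 \<le> y"
  defines "z \<equiv> T_rect l y"
  defines "f \<equiv> \<lambda>j. real j * ln z - (\<Sum>i<j. ln (T_rect l (2 * real i / N)))"
  defines "A \<equiv> N / 2 * (y * ln z - W_rect l y)"
  shows "f j \<le> A + ln z" and "A - 4 / N * (real j - N / 2 * y)\<^sup>2 \<le> f j"
proof -
  have z: "0 \<le> ln z" using T_rect_ge_1[of l y] l y by (simp add: z_def)
  show "f j \<le> A + ln z"
  proof (cases j)
    case 0
    have "0 \<le> y * ln z - W_rect l y" using W_rect_tangent[of l 0 y] l y by (simp add: z_def)
    hence "0 \<le> A" using N by (simp add: A_def)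
    thus ?thesis using 0 z by (simp add: f_def)
  next
    case (Suc i)
    let ?y = "2 * real i / N"
    have "f j \<le> real j * ln z - N / 2 * W_rect l ?y"
      using sum_ln_T_rect_bounds(2)[OF l(1) N, of i] by (simp add: f_def Suc)
    also have "\<dots> = ln z + N / 2 * (?y * ln z - W_rect l ?y)" using N by (simp add: Suc field_simps)
    also have "\<dots> \<le> ln z + A"
      unfolding A_def using W_rect_tangent[of l ?y y] l y N
      by (intro add_left_mono mult_left_mono) (auto simp: z_def algebra_simps)
    finally show ?thesis by simp
  qed
  let ?y = "2 * real j / N"
  have "A - 4 / N * (real j - N / 2 * y)\<^sup>2 = N / 2 * (y * ln z - W_rect l y - 2 * (?y - y)\<^sup>2)"
    using N by (simp add: A_def power2_eq_square field_simps)
  also have "\<dots> \<le> N / 2 * (?y * ln z - W_rect l ?y)"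
    using W_rect_upper[OF l, of ?y y] y N by (intro mult_left_mono) (auto simp: z_def algebra_simps)
  also have "\<dots> = real j * ln z - N / 2 * W_rect l ?y" using N by (simp add: field_simps)
  also have "\<dots> \<le> f j" using sum_ln_T_rect_bounds(1)[OF l(1) N, of j] by (simp add: f_def)
  finally show "A - 4 / N * (real j - N / 2 * y)\<^sup>2 \<le> f j" .
qed

section \<open>Jensen's inequality and the variance of the weights\<close>

text \<open>The lower bound is Jensen's inequality for the weights \<open>p j / D\<close>, carried
  out by hand: \<open>exp\<close> is replaced by its tangent at the average exponent
  \<open>A - \<kappa> * v\<close>, after which only the mass and the second moment about
  \<open>a\<close> are needed.\<close>

lemma tilted_sum_bounds:
  fixes p f :: "nat \<Rightarrow> real"
  assumes p0: "\<And>j. 0 \<le> p j" and D: "p sums D" and v: "(\<lambda>j. p j * (real j - a)\<^sup>2) sums (D * v)"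
    and Z: "(\<lambda>j. p j * exp (f j)) sums Z"
    and up: "\<And>j. f j \<le> B" and lo: "\<And>j. A - \<kappa> * (real j - a)\<^sup>2 \<le> f j"
  shows "Z \<le> D * exp B" and "D * exp (A - \<kappa> * v) \<le> Z"
proof -
  show "Z \<le> D * exp B"
    by (rule sums_le[OF _ Z sums_mult2[OF D]]) (use p0 up in \<open>auto intro: mult_left_mono\<close>)
  let ?E = "exp (A - \<kappa> * v)"
  have "p j * (?E * (1 + \<kappa> * v)) - (p j * (real j - a)\<^sup>2) * (?E * \<kappa>) \<le> p j * exp (f j)" for j
  proof -
    let ?u = "A - \<kappa> * (real j - a)\<^sup>2 - (A - \<kappa> * v)"
    have "?E * (1 + ?u) \<le> ?E * exp ?u" by (intro mult_left_mono exp_ge_add_one_self) auto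
    also have "\<dots> = exp (A - \<kappa> * (real j - a)\<^sup>2)" by (simp add: mult_exp_exp)
    also have "\<dots> \<le> exp (f j)" using lo by simp
    finally have "p j * (?E * (1 + ?u)) \<le> p j * exp (f j)" using p0 by (intro mult_left_mono)
    thus ?thesis by (simp add: algebra_simps)
  qed
  from sums_le[OF this sums_diff[OF sums_mult2[OF D] sums_mult2[OF v]] Z]
  have "D * (?E * (1 + \<kappa> * v)) - D * v * (?E * \<kappa>) \<le> Z" .
  thus "D * ?E \<le> Z" by (simp add: algebra_simps)
qed

text \<open>Differentiating termwise and multiplying by \<open>x\<close> multiplies each coefficient
  by its index; two applications give first and second moments.\<close>

lemma sums_index_times:
  fixes c :: "nat \<Rightarrow> real"
  assumes s: "\<And>u. 0 < u \<Longrightarrow> u < X \<Longrightarrow> (\<lambda>j. c j * u ^ j) sums G u"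
    and x: "0 < x" "x < X" and d: "(G has_real_derivative G') (at x)"
  shows "(\<lambda>j. real j * c j * x ^ j) sums (x * G')"
proof -
  define K where "K = (x + X) / 2"
  have K: "x < K" "K < X" "0 < K" using x by (auto simp: K_def)
  have sK: "summable (\<lambda>j. c j * K ^ j)" using s[of K] K by (auto simp: sums_iff)
  have "DERIV (\<lambda>u. \<Sum>j. c j * u ^ j) x :> (\<Sum>j. diffs c j * x ^ j)"
    by (rule termdiffs_strong[OF sK]) (use x K in auto)
  moreover have "DERIV (\<lambda>u. \<Sum>j. c j * u ^ j) x :> G'"
    by (rule has_field_derivative_transform_within_open[OF d, of "{0<..<X}"]) (use x s in \<open>auto simp: sums_iff\<close>)
  ultimately have eq: "(\<Sum>j. diffs c j * x ^ j) = G'" by (rule DERIV_unique)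
  have "summable (\<lambda>j. diffs c j * x ^ j)"
    by (rule termdiff_converges[of x K]) (use x K in \<open>auto intro: powser_inside[OF sK]\<close>)
  from diffs_equiv[OF this] have "(\<lambda>j. real j * c j * x ^ (j - Suc 0)) sums G'" by (simp add: eq)
  from sums_mult[OF this, of x] have "(\<lambda>j. x * (real j * c j * x ^ (j - Suc 0))) sums (x * G')" .
  also have "(\<lambda>j. x * (real j * c j * x ^ (j - Suc 0))) = (\<lambda>j. real j * c j * x ^ j)"
  proof
    fix j show "x * (real j * c j * x ^ (j - Suc 0)) = real j * c j * x ^ j" by (cases j) auto
  qed
  finally show ?thesis .
qed

text \<open>Cumulants from the generating function \<open>exp (L u)\<close>: the mean is
  \<open>q\<close>, that is \<open>u\<close> times the derivative of \<open>L\<close>, and the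
  variance is \<open>x\<close> times the derivative \<open>q'\<close> of \<open>q\<close>.\<close>

lemma det_series_variance:
  fixes c e :: "nat \<Rightarrow> real" and b X :: real
  assumes e: "\<And>k. k < n \<Longrightarrow> 0 \<le> e k" "\<And>k x. k < n \<Longrightarrow> 0 \<le> x \<Longrightarrow> x < X \<Longrightarrow> x * e k < 1"
    and s: "\<And>x. 0 \<le> x \<Longrightarrow> x < X \<Longrightarrow> (\<lambda>j. c j * x ^ j) sums (\<Prod>k<n. (1 - x * e k) powr (- b))"
    and x: "0 < x" "x < X"
  shows "(\<lambda>j. c j * x ^ j * (real j - b * (\<Sum>k<n. x * e k / (1 - x * e k)))\<^sup>2) sums
    ((\<Prod>k<n. (1 - x * e k) powr (- b)) * (b * (\<Sum>k<n. x * e k / (1 - x * e k)\<^sup>2)))"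
proof -
  define L where "L = (\<lambda>u. - b * (\<Sum>k<n. ln (1 - u * e k)))"
  define q where "q = (\<lambda>u. b * (\<Sum>k<n. u * e k / (1 - u * e k)))"
  define q' where "q' = (\<lambda>u. b * (\<Sum>k<n. e k / (1 - u * e k)\<^sup>2))"
  have pos: "1 - u * e k > 0" if "0 < u" "u < X" "k < n" for u k using e(2)[of k u] that by simp
  have DL: "(\<Prod>k<n. (1 - u * e k) powr (- b)) = exp (L u)" if "0 < u" "u < X" for u
  proof -
    have "exp (L u) = (\<Prod>k<n. exp (- b * ln (1 - u * e k)))"
      by (simp add: L_def sum_distrib_left exp_sum[symmetric] sum_negf)
    also have "\<dots> = (\<Prod>k<n. (1 - u * e k) powr (- b))"
      by (rule prod.cong) (use pos[OF that] in \<open>auto simp: powr_def less_imp_neq\<close>)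
    finally show ?thesis by simp
  qed
  have s0: "(\<lambda>j. c j * u ^ j) sums exp (L u)" if "0 < u" "u < X" for u
    using s[of u] DL[OF that] that by simp
  have dL: "(L has_real_derivative q u / u) (at u)" if u: "0 < u" "u < X" for u
  proof -
    have "(L has_real_derivative - b * (\<Sum>k<n. (- e k) / (1 - u * e k))) (at u)"
      unfolding L_def using pos[OF u] by (auto intro!: derivative_eq_intros sum.cong simp: divide_inverse)
    also have "- b * (\<Sum>k<n. (- e k) / (1 - u * e k)) = q u / u"
      using u by (simp add: q_def sum_negf sum_divide_distrib sum_distrib_left)
    finally show ?thesis .
  qed
  have dq: "(q has_real_derivative q' u) (at u)" if u: "0 < u" "u < X" for u
  proof -
    have "((\<lambda>u. u * e k / (1 - u * e k)) has_real_derivative e k / (1 - u * e k)\<^sup>2) (at u)" if "k < n" for k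
      using pos[OF u that] by (auto intro!: derivative_eq_intros simp: power2_eq_square field_simps)
    thus ?thesis unfolding q_def q'_def by (intro DERIV_cmult DERIV_sum) auto
  qed
  have dE: "((\<lambda>u. exp (L u)) has_real_derivative exp (L u) * (q u / u)) (at u)" if "0 < u" "u < X" for u
    using dL[OF that] by (auto intro!: derivative_eq_intros)
  have s1: "(\<lambda>j. real j * c j * u ^ j) sums (exp (L u) * q u)" if u: "0 < u" "u < X" for u
    using sums_index_times[OF s0 u dE[OF u]] u by (simp add: mult_ac)
  have "((\<lambda>u. exp (L u) * q u) has_real_derivative exp (L x) * (q x / x) * q x + exp (L x) * q' x) (at x)"
    using DERIV_mult[OF dE[OF x] dq[OF x]] by (simp add: mult.commute)
  from sums_index_times[OF s1 x this]
  have "(\<lambda>j. real j * (real j * c j) * x ^ j) sums (x * (exp (L x) * (q x / x) * q x + exp (L x) * q' x))" .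
  also have "x * (exp (L x) * (q x / x) * q x + exp (L x) * q' x) = exp (L x) * ((q x)\<^sup>2 + x * q' x)"
    using x by (simp add: power2_eq_square algebra_simps)
  finally have s2: "(\<lambda>j. real j * (real j * c j) * x ^ j) sums (exp (L x) * ((q x)\<^sup>2 + x * q' x))" .
  have "(\<lambda>j. real j * (real j * c j) * x ^ j - 2 * q x * (real j * c j * x ^ j) + (q x)\<^sup>2 * (c j * x ^ j))
      sums (exp (L x) * ((q x)\<^sup>2 + x * q' x) - 2 * q x * (exp (L x) * q x) + (q x)\<^sup>2 * exp (L x))"
    by (intro sums_add sums_diff sums_mult s2 s1 s0 x)
  also have "(\<lambda>j. real j * (real j * c j) * x ^ j - 2 * q x * (real j * c j * x ^ j) + (q x)\<^sup>2 * (c j * x ^ j))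
      = (\<lambda>j. c j * x ^ j * (real j - q x)\<^sup>2)"
    by (rule ext) (simp add: power2_eq_square algebra_simps)
  also have "exp (L x) * ((q x)\<^sup>2 + x * q' x) - 2 * q x * (exp (L x) * q x) + (q x)\<^sup>2 * exp (L x)
      = exp (L x) * (x * q' x)"
    by (simp add: power2_eq_square algebra_simps)
  also have "x * q' x = b * (\<Sum>k<n. x * e k / (1 - x * e k)\<^sup>2)"
    by (simp add: q'_def sum_distrib_left mult_ac)
  finally show ?thesis by (simp add: DL[OF x] q_def)
qed

text \<open>
  Writing \<open>\<tau>\<^sup>2 = x z\<close> with \<open>z = T y\<close>, the series is the sum of the \<open>c j * x ^ j\<close>
  times the exponential of a concave function of \<open>j\<close> that is maximal near the mean \<open>N y / 2\<close>
  of the weights \<open>c j * x ^ j\<close>.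
\<close>

lemma log_spherical_transform_bound:
  fixes c e :: "nat \<Rightarrow> real" and b K l :: real
  assumes n: "n \<ge> 1" and b: "b > 0" and l: "0 \<le> l" "l \<le> 1" and K: "K > 0"
    and e: "\<And>k. k < n \<Longrightarrow> 0 \<le> e k" "\<And>k. k < n \<Longrightarrow> e k \<le> K\<^sup>2"
    and c0: "\<And>j. 0 \<le> c j"
    and s: "\<And>x. 0 \<le> x \<Longrightarrow> x < 1 / K\<^sup>2 \<Longrightarrow> (\<lambda>j. c j * x ^ j) sums (\<Prod>k<n. (1 - x * e k) powr (- b))"
    and x: "0 < x" "x < 1 / K\<^sup>2"
  defines "y \<equiv> (\<Sum>k<n. x * e k / (1 - x * e k)) / n"
  defines "z \<equiv> T_rect l y"
  assumes Z: "(\<lambda>j. c j * ((x * z) ^ j / (\<Prod>i<j. T_rect l (2 * real i / (2 * b * n))))) sums Z"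
  shows "Z > 0"
    and "\<bar>ln Z / n - b * ((\<Sum>k<n. - ln (1 - x * e k)) / n + (y * ln z - W_rect l y))\<bar>
      \<le> (2 * (K\<^sup>2 * x / (1 - K\<^sup>2 * x)) + 2 * (K\<^sup>2 * x / (1 - K\<^sup>2 * x)\<^sup>2)) / n"
proof -
  have Kx: "K\<^sup>2 * u < 1" if "u < 1 / K\<^sup>2" for u using that K by (simp add: field_simps)
  have small: "u * e k < 1" if "k < n" "0 \<le> u" "u < 1 / K\<^sup>2" for k u
    using mult_left_mono[OF e(2)[OF that(1)] that(2)] Kx[OF that(3)] by (simp add: mult.commute)
  define d where "d = 1 - K\<^sup>2 * x"
  have d: "0 < d" using Kx[OF x(2)] by (simp add: d_def)
  have de: "d \<le> 1 - x * e k" if "k < n" for k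
    using mult_left_mono[OF e(2)[OF that], of x] x by (simp add: d_def mult.commute)
  have pos: "1 - x * e k > 0" if "k < n" for k using de[OF that] d by simp
  have xe: "0 \<le> x * e k" "x * e k \<le> K\<^sup>2 * x" if "k < n" for k
    using e[OF that] x mult_left_mono[OF e(2)[OF that], of x] by (auto simp: mult.commute)
  \<comment> \<open>For \<open>b = \<beta> / 2\<close> this is \<open>\<beta> * n\<close>, the real
    dimension of the Gaussian vector.\<close>
  define N where "N = 2 * b * n"
  have N: "N > 0" using b n by (simp add: N_def)
  have y0: "0 \<le> y" unfolding y_def using xe(1) pos by (intro divide_nonneg_nonneg sum_nonneg) (auto simp: less_imp_le)
  have yK: "y \<le> K\<^sup>2 * x / d"
  proof -
    have "(\<Sum>k<n. x * e k / (1 - x * e k)) \<le> (\<Sum>k<n. K\<^sup>2 * x / d)"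
      by (rule sum_mono, rule frac_le) (use xe de d x in auto)
    thus ?thesis using n by (simp add: y_def field_simps)
  qed
  have z1: "z \<ge> 1" using T_rect_ge_1[OF l(1) y0] by (simp add: z_def)
  have lnz: "ln z \<le> 2 * (K\<^sup>2 * x / d)"
    using ln_T_rect_lipschitz[OF l order_refl y0] yK by (simp add: z_def T_rect_def)
  define D where "D = (\<Prod>k<n. (1 - x * e k) powr (- b))"
  have D0: "D > 0" unfolding D_def using pos by (intro prod_pos) (auto simp: less_imp_neq)
  define v where "v = b * (\<Sum>k<n. x * e k / (1 - x * e k)\<^sup>2)"
  define f where "f = (\<lambda>j. real j * ln z - (\<Sum>i<j. ln (T_rect l (2 * real i / N))))"
  define A where "A = N / 2 * (y * ln z - W_rect l y)"
  \<comment> \<open>The mean of the weights is the point where the quadratic lower bound of the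
    exponent is centred; \<open>z = T_rect l y\<close> is chosen for this.\<close>
  have a: "b * (\<Sum>k<n. x * e k / (1 - x * e k)) = N / 2 * y" using n by (simp add: N_def y_def)
  have var: "(\<lambda>j. c j * x ^ j * (real j - N / 2 * y)\<^sup>2) sums (D * v)"
    using det_series_variance[where X="1 / K\<^sup>2" and c=c and e=e and b=b and n=n, OF e(1) small s x]
    by (simp add: a D_def v_def)
  have Dsum: "(\<lambda>j. c j * x ^ j) sums D" unfolding D_def by (rule s) (use x in auto)
  have p0: "0 \<le> c j * x ^ j" for j using c0 x by simp
  have "c j * ((x * z) ^ j / (\<Prod>i<j. T_rect l (2 * real i / (2 * b * n)))) = c j * x ^ j * exp (f j)" for j
  proof -
    have T: "T_rect l (2 * real i / N) > 0" for i
      using T_rect_ge_1[OF l(1), of "2 * real i / N"] N by simp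
    have "exp (f j) = exp (real j * ln z) / exp (\<Sum>i<j. ln (T_rect l (2 * real i / N)))"
      by (simp add: f_def exp_diff)
    also have "exp (\<Sum>i<j. ln (T_rect l (2 * real i / N))) = (\<Prod>i<j. T_rect l (2 * real i / N))"
      by (simp add: exp_sum T)
    also have "exp (real j * ln z) = z ^ j" using z1 by (simp add: exp_of_nat_mult)
    finally show ?thesis by (simp add: power_mult_distrib N_def)
  qed
  hence Z': "(\<lambda>j. c j * x ^ j * exp (f j)) sums Z" using Z by simp
  have fb: "f j \<le> A + ln z" "A - 4 / N * (real j - N / 2 * y)\<^sup>2 \<le> f j" for j
    using tilt_exponent_bounds[OF l N y0, of j] by (simp_all add: f_def A_def z_def)
  have up: "Z \<le> D * exp (A + ln z)" and lo: "D * exp (A - 4 / N * v) \<le> Z"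
    using tilted_sum_bounds[OF p0 Dsum var Z' fb] .
  show Z0: "Z > 0" using lo D0 by (meson exp_gt_zero less_le_trans mult_pos_pos)
  have "ln Z \<le> ln (D * exp (A + ln z))" using up Z0 D0 by (subst ln_le_cancel_iff) auto
  hence up': "ln Z \<le> ln D + A + ln z" using D0 by (simp add: ln_mult)
  have "ln (D * exp (A - 4 / N * v)) \<le> ln Z" using lo Z0 D0 by (subst ln_le_cancel_iff) auto
  hence lo': "ln D + A - 4 / N * v \<le> ln Z" using D0 by (simp add: ln_mult)
  \<comment> \<open>The variance grows at most like \<open>n\<close>, and \<open>4 / N\<close>
    compensates it.\<close>
  have vb: "4 / N * v \<le> 2 * (K\<^sup>2 * x / d\<^sup>2)"
  proof -
    have "(\<Sum>k<n. x * e k / (1 - x * e k)\<^sup>2) \<le> (\<Sum>k<n. K\<^sup>2 * x / d\<^sup>2)"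
    proof (rule sum_mono, rule frac_le)
      fix k assume "k \<in> {..<n}"
      thus "d\<^sup>2 \<le> (1 - x * e k)\<^sup>2" using de d by (intro power_mono) auto
    qed (use xe d x in auto)
    also have "\<dots> = n * (K\<^sup>2 * x / d\<^sup>2)" by simp
    finally have "v \<le> b * (n * (K\<^sup>2 * x / d\<^sup>2))" unfolding v_def using b by (intro mult_left_mono) auto
    hence "4 / N * v \<le> 4 / N * (b * (n * (K\<^sup>2 * x / d\<^sup>2)))" using N by (intro mult_left_mono) auto
    also have "\<dots> = 2 * (K\<^sup>2 * x / d\<^sup>2)" using b n by (simp add: N_def)
    finally show ?thesis .
  qed
  have v0: "0 \<le> 2 * (K\<^sup>2 * x / d\<^sup>2)" "0 \<le> 2 * (K\<^sup>2 * x / d)" using x d by (auto intro!: divide_nonneg_pos)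
  have lnD: "ln D = b * (\<Sum>k<n. - ln (1 - x * e k))"
  proof -
    have "ln D = (\<Sum>k<n. ln ((1 - x * e k) powr (- b)))"
      unfolding D_def by (rule ln_prod) (use pos in \<open>auto simp: less_imp_neq\<close>)
    thus ?thesis using pos by (simp add: ln_powr sum_distrib_left sum_negf)
  qed
  let ?c = "b * ((\<Sum>k<n. - ln (1 - x * e k)) / n + (y * ln z - W_rect l y))"
  have "real n * ((\<Sum>k<n. - ln (1 - x * e k)) / n) = (\<Sum>k<n. - ln (1 - x * e k))" using n by simp
  hence "n * ?c = b * (\<Sum>k<n. - ln (1 - x * e k)) + b * n * (y * ln z - W_rect l y)"
    by (simp only: distrib_left mult.left_commute[of "real n" b] mult.assoc)
  hence "ln D + A = n * ?c" by (simp add: lnD A_def N_def)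
  hence "\<bar>ln Z - n * ?c\<bar> \<le> 2 * (K\<^sup>2 * x / d) + 2 * (K\<^sup>2 * x / d\<^sup>2)"
    using up' lo' vb lnz v0 by (simp add: abs_le_iff)
  hence "\<bar>ln Z - n * ?c\<bar> / n \<le> (2 * (K\<^sup>2 * x / d) + 2 * (K\<^sup>2 * x / d\<^sup>2)) / n"
    by (rule divide_right_mono) simp
  moreover have "\<bar>ln Z - n * ?c\<bar> / n = \<bar>ln Z / n - ?c\<bar>"
  proof -
    have "ln Z / n - ?c = (ln Z - n * ?c) / n" using n by (simp add: diff_divide_distrib)
    thus ?thesis by (simp add: abs_divide)
  qed
  ultimately show "\<bar>ln Z / n - ?c\<bar>
      \<le> (2 * (K\<^sup>2 * x / (1 - K\<^sup>2 * x)) + 2 * (K\<^sup>2 * x / (1 - K\<^sup>2 * x)\<^sup>2)) / n"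
    by (simp add: d_def)
qed

section \<open>Uniform convergence of monotone functions\<close>

text \<open>A Dini-type argument in which convergence is known only along moving points
  \<open>s n\<close> tending to \<open>t\<close>. Monotonicity turns the value at such a point into
  a one-sided bound on a whole neighbourhood, and continuity of \<psi> closes the gap.\<close>

lemma uniform_limit_of_monotone:
  fixes g :: "nat \<Rightarrow> real \<Rightarrow> real" and \<psi> :: "real \<Rightarrow> real"
  assumes mono: "\<And>n s t. n \<ge> 1 \<Longrightarrow> 0 \<le> s \<Longrightarrow> s \<le> t \<Longrightarrow> t < R \<Longrightarrow> g n s \<le> g n t"
    and g0: "\<And>n. n \<ge> 1 \<Longrightarrow> g n 0 = \<psi> 0"
    and cont: "continuous_on {0..<R} \<psi>"
    and conv: "\<And>t. 0 < t \<Longrightarrow> t < R \<Longrightarrow> \<exists>s. (\<forall>n\<ge>1. 0 \<le> s n) \<and> s \<longlonglongrightarrow> t \<and> (\<lambda>n. g n (s n)) \<longlonglongrightarrow> \<psi> t"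
    and S: "compact S" "S \<subseteq> {0..<R}"
  shows "uniform_limit S g \<psi> sequentially"
proof (rule uniform_limitI)
  fix \<epsilon> :: real assume \<epsilon>: "\<epsilon> > 0"
  have local: "\<exists>U. open U \<and> t \<in> U \<and> (\<forall>\<^sub>F n in sequentially. \<forall>u\<in>U \<inter> {0..<R}. dist (g n u) (\<psi> u) < \<epsilon>)"
    if t: "0 \<le> t" "t < R" for t
  proof -
    obtain \<delta> where \<delta>: "\<delta> > 0" "\<And>u. 0 \<le> u \<Longrightarrow> u < R \<Longrightarrow> \<bar>u - t\<bar> < \<delta> \<Longrightarrow> \<bar>\<psi> u - \<psi> t\<bar> < \<epsilon> / 4"
    proof -
      have "\<exists>\<delta>>0. \<forall>u\<in>{0..<R}. dist u t < \<delta> \<longrightarrow> dist (\<psi> u) (\<psi> t) < \<epsilon> / 4"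
        using cont[unfolded continuous_on_iff, rule_format, of t "\<epsilon> / 4"] t \<epsilon> by auto
      thus ?thesis using that by (auto simp: dist_real_def)
    qed
    have up: "\<exists>U. open U \<and> t \<in> U \<and> (\<forall>\<^sub>F n in sequentially. \<forall>u\<in>U \<inter> {0..<R}. g n u < \<psi> t + \<epsilon> / 2)"
    proof -
      define t2 where "t2 = t + min \<delta> (R - t) / 2"
      have t2: "t < t2" "t2 < R" "\<bar>t2 - t\<bar> < \<delta>" using \<delta>(1) t by (auto simp: t2_def min_def field_simps)
      obtain s where s: "s \<longlonglongrightarrow> t2" "(\<lambda>n. g n (s n)) \<longlonglongrightarrow> \<psi> t2" using conv[of t2] t t2 by auto
      \<comment> \<open>The midpoint leaves room: arguments below \<open>u2\<close> are eventually
        below \<open>s n\<close>, which tends to \<open>t2\<close>.\<close>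
      define u2 where "u2 = (t + t2) / 2"
      have u2: "t < u2" "u2 < t2" using t2 by (auto simp: u2_def)
      have "\<psi> t2 < \<psi> t + \<epsilon> / 2" using \<delta>(2)[of t2] t t2 \<epsilon> by (auto simp: abs_if split: if_splits)
      hence "\<forall>\<^sub>F n in sequentially. g n (s n) < \<psi> t + \<epsilon> / 2" by (rule order_tendstoD(2)[OF s(2)])
      moreover have "\<forall>\<^sub>F n in sequentially. u2 < s n" by (rule order_tendstoD(1)[OF s(1) u2(2)])
      moreover have "\<forall>\<^sub>F n in sequentially. s n < R" by (rule order_tendstoD(2)[OF s(1) t2(2)])
      moreover have "\<forall>\<^sub>F n in sequentially. n \<ge> 1" by (rule eventually_ge_at_top)
      ultimately have "\<forall>\<^sub>F n in sequentially. \<forall>u\<in>{..<u2} \<inter> {0..<R}. g n u < \<psi> t + \<epsilon> / 2"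
      proof eventually_elim
        case (elim n)
        show ?case
        proof
          fix u assume "u \<in> {..<u2} \<inter> {0..<R}"
          hence "g n u \<le> g n (s n)" using elim by (intro mono) auto
          thus "g n u < \<psi> t + \<epsilon> / 2" using elim by simp
        qed
      qed
      thus ?thesis using u2 by (intro exI[of _ "{..<u2}"]) auto
    qed
    have lo: "\<exists>U. open U \<and> t \<in> U \<and> (\<forall>\<^sub>F n in sequentially. \<forall>u\<in>U \<inter> {0..<R}. \<psi> t - \<epsilon> / 2 < g n u)"
    proof (cases "t = 0")
      \<comment> \<open>There are no points to the left of 0; the common value at 0 replaces
        them.\<close>
      case True
      have "\<forall>\<^sub>F n in sequentially. \<forall>u\<in>UNIV \<inter> {0..<R}. \<psi> t - \<epsilon> / 2 < g n u"
        using eventually_ge_at_top[of 1]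
      proof eventually_elim
        case (elim n)
        show ?case
        proof
          fix u assume "u \<in> UNIV \<inter> {0..<R}"
          hence "g n 0 \<le> g n u" using elim by (intro mono) auto
          thus "\<psi> t - \<epsilon> / 2 < g n u" using g0[OF elim] \<epsilon> True by simp
        qed
      qed
      thus ?thesis by (intro exI[of _ UNIV]) auto
    next
      case False
      define t1 where "t1 = t - min \<delta> t / 2"
      have t1: "0 < t1" "t1 < t" "\<bar>t1 - t\<bar> < \<delta>" using \<delta>(1) t False by (auto simp: t1_def min_def field_simps)
      obtain s where s: "s \<longlonglongrightarrow> t1" "(\<lambda>n. g n (s n)) \<longlonglongrightarrow> \<psi> t1" "\<forall>n\<ge>1. 0 \<le> s n" using conv[of t1] t t1 by auto
      define u1 where "u1 = (t + t1) / 2"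
      have u1: "u1 < t" "t1 < u1" using t1 by (auto simp: u1_def)
      have "\<psi> t - \<epsilon> / 2 < \<psi> t1" using \<delta>(2)[of t1] t t1 \<epsilon> by (auto simp: abs_if split: if_splits)
      hence "\<forall>\<^sub>F n in sequentially. \<psi> t - \<epsilon> / 2 < g n (s n)" by (rule order_tendstoD(1)[OF s(2)])
      moreover have "\<forall>\<^sub>F n in sequentially. s n < u1" by (rule order_tendstoD(2)[OF s(1) u1(2)])
      moreover have "\<forall>\<^sub>F n in sequentially. n \<ge> 1" by (rule eventually_ge_at_top)
      ultimately have "\<forall>\<^sub>F n in sequentially. \<forall>u\<in>{u1<..} \<inter> {0..<R}. \<psi> t - \<epsilon> / 2 < g n u"
      proof eventually_elim
        case (elim n)
        show ?case
        proof
          fix u assume "u \<in> {u1<..} \<inter> {0..<R}"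
          hence "g n (s n) \<le> g n u" using elim s(3) by (intro mono) auto
          thus "\<psi> t - \<epsilon> / 2 < g n u" using elim by simp
        qed
      qed
      thus ?thesis using u1 by (intro exI[of _ "{u1<..}"]) auto
    qed
    from up lo obtain U1 U2 where U: "open U1" "t \<in> U1" "open U2" "t \<in> U2"
      and ev: "\<forall>\<^sub>F n in sequentially. \<forall>u\<in>U1 \<inter> {0..<R}. g n u < \<psi> t + \<epsilon> / 2"
        "\<forall>\<^sub>F n in sequentially. \<forall>u\<in>U2 \<inter> {0..<R}. \<psi> t - \<epsilon> / 2 < g n u" by blast
    let ?U = "U1 \<inter> U2 \<inter> ball t \<delta>"
    have "\<forall>\<^sub>F n in sequentially. \<forall>u\<in>?U \<inter> {0..<R}. dist (g n u) (\<psi> u) < \<epsilon>"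
      using ev
    proof eventually_elim
      case (elim n)
      show ?case
      proof
        fix u assume u: "u \<in> ?U \<inter> {0..<R}"
        hence "\<bar>\<psi> u - \<psi> t\<bar> < \<epsilon> / 4" by (intro \<delta>(2)) (auto simp: dist_real_def)
        moreover have "g n u < \<psi> t + \<epsilon> / 2" "\<psi> t - \<epsilon> / 2 < g n u" using elim u by auto
        ultimately show "dist (g n u) (\<psi> u) < \<epsilon>" using \<epsilon> unfolding dist_real_def abs_less_iff by linarith
      qed
    qed
    thus ?thesis using U \<delta>(1) by (intro exI[of _ ?U]) auto
  qed
  have "\<forall>t\<in>S. \<exists>U. open U \<and> t \<in> U \<and> (\<forall>\<^sub>F n in sequentially. \<forall>u\<in>U \<inter> {0..<R}. dist (g n u) (\<psi> u) < \<epsilon>)"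
  proof
    fix t assume "t \<in> S"
    hence "0 \<le> t" "t < R" using S(2) by auto
    thus "\<exists>U. open U \<and> t \<in> U \<and> (\<forall>\<^sub>F n in sequentially. \<forall>u\<in>U \<inter> {0..<R}. dist (g n u) (\<psi> u) < \<epsilon>)"
      by (rule local)
  qed
  from bchoice[OF this] obtain U where U: "\<forall>t\<in>S. open (U t) \<and> t \<in> U t
      \<and> (\<forall>\<^sub>F n in sequentially. \<forall>u\<in>U t \<inter> {0..<R}. dist (g n u) (\<psi> u) < \<epsilon>)" ..
  obtain C where C: "C \<subseteq> S" "finite C" "S \<subseteq> (\<Union>t\<in>C. U t)"
  proof (rule compactE_image[OF S(1), of S U])
    show "S \<subseteq> (\<Union>t\<in>S. U t)" using U by auto
  qed (use U in auto)
  have "\<forall>\<^sub>F n in sequentially. \<forall>t\<in>C. \<forall>u\<in>U t \<inter> {0..<R}. dist (g n u) (\<psi> u) < \<epsilon>"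
    using C U by (intro eventually_ball_finite) auto
  thus "\<forall>\<^sub>F n in sequentially. \<forall>u\<in>S. dist (g n u) (\<psi> u) < \<epsilon>"
  proof eventually_elim
    case (elim n)
    show ?case
    proof
      fix u assume "u \<in> S"
      moreover from this obtain t where "t \<in> C" "u \<in> U t" using C(3) by blast
      ultimately show "dist (g n u) (\<psi> u) < \<epsilon>" using elim S(2) by auto
    qed
  qed
qed

section \<open>The limit function\<close>

definition log_potential :: "real measure \<Rightarrow> real \<Rightarrow> real" where
  "log_potential \<mu> x = (LINT t|\<mu>. - ln (1 - t\<^sup>2 * x))"

definition saddle_value :: "real \<Rightarrow> real measure \<Rightarrow> real \<Rightarrow> real" where
  "saddle_value l \<mu> x = log_potential \<mu> x + (M_sq \<mu> x * ln (T_rect l (M_sq \<mu> x)) - W_rect l (M_sq \<mu> x))"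

text \<open>
  After multiplying out, this is the nonnegativity of the relative entropy of two Bernoulli laws
  with parameters \<open>p\<close> and \<open>q\<close>.
\<close>

lemma log_convexity_bound:
  fixes u x x' :: real
  assumes u: "0 \<le> u" and x: "0 < x" "u * x < 1" and x': "0 < x'" "u * x' < 1"
  shows "u * x / (1 - u * x) * (ln x' - ln x) \<le> - ln (1 - u * x') - (- ln (1 - u * x))"
proof (cases "u = 0")
  case False
  hence u: "u > 0" using u by simp
  define p q where "p = u * x" and "q = u * x'"
  have pq: "0 < p" "p < 1" "0 < q" "q < 1" using u x x' by (auto simp: p_def q_def)
  have a: "ln ((1 - q) / (1 - p)) \<le> (1 - q) / (1 - p) - 1" by (rule ln_le_minus_one) (use pq in auto)
  have b: "ln (q / p) \<le> q / p - 1" by (rule ln_le_minus_one) (use pq in auto)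
  have "(1 - p) * ln ((1 - q) / (1 - p)) + p * ln (q / p) \<le> (1 - p) * ((1 - q) / (1 - p) - 1) + p * (q / p - 1)"
    using a b pq by (intro add_mono mult_left_mono) auto
  also have "\<dots> = 0" using pq by (simp add: field_simps)
  finally have "(1 - p) * (ln (1 - q) - ln (1 - p)) + p * (ln q - ln p) \<le> 0" using pq by (simp add: ln_div)
  hence "p / (1 - p) * (ln q - ln p) \<le> - ln (1 - q) - (- ln (1 - p))" using pq by (simp add: field_simps)
  moreover have "ln q - ln p = ln x' - ln x" using u x x' by (simp add: p_def q_def ln_mult)
  ultimately show ?thesis by (simp add: p_def q_def)
qed simp

text \<open>The support at \<open>x\<close> bounds the increment from below and the support at
  \<open>t\<close> bounds it from above. The two bounds differ by
  \<open>(Y t - Y x) * (g t - g x)\<close>, which is of lower order because \<open>Y\<close> is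
  continuous at \<open>x\<close>.\<close>

lemma has_real_derivative_from_supports:
  fixes \<psi> Y g :: "real \<Rightarrow> real"
  assumes supp: "\<And>s t. a < s \<Longrightarrow> s < b \<Longrightarrow> a < t \<Longrightarrow> t < b \<Longrightarrow> Y s * (g t - g s) \<le> \<psi> t - \<psi> s"
    and x: "a < x" "x < b" and Y: "isCont Y x" and g: "(g has_real_derivative g') (at x)"
  shows "(\<psi> has_real_derivative Y x * g') (at x)"
proof -
  let ?q = "\<lambda>t. (g t - g x) / (t - x)"
  have gq: "(?q \<longlongrightarrow> g') (at x)" using g by (simp add: has_field_derivative_iff)
  have "((\<lambda>t. \<bar>Y t - Y x\<bar> * \<bar>?q t\<bar>) \<longlongrightarrow> \<bar>Y x - Y x\<bar> * \<bar>g'\<bar>) (at x)"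
    using Y by (intro tendsto_intros gq) (auto simp: isCont_def)
  hence z: "((\<lambda>t. \<bar>Y t - Y x\<bar> * \<bar>?q t\<bar>) \<longlongrightarrow> 0) (at x)" by simp
  have "((\<lambda>t. (\<psi> t - \<psi> x) / (t - x) - Y x * ?q t) \<longlongrightarrow> 0) (at x)"
  proof (rule Lim_null_comparison[OF _ z])
    have "\<forall>\<^sub>F t in at x. t \<in> {a<..<b}" by (rule eventually_at_in_open') (use x in auto)
    moreover have "\<forall>\<^sub>F t in at x. t \<noteq> x" by (rule eventually_neq_at_within)
    ultimately show "\<forall>\<^sub>F t in at x. norm ((\<psi> t - \<psi> x) / (t - x) - Y x * ?q t) \<le> \<bar>Y t - Y x\<bar> * \<bar>?q t\<bar>"
    proof eventually_elim
      case (elim t)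
      have 1: "0 \<le> \<psi> t - \<psi> x - Y x * (g t - g x)" using supp[of x t] x elim by auto
      have "\<psi> t - \<psi> x - Y x * (g t - g x) \<le> (Y t - Y x) * (g t - g x)"
        using supp[of t x] x elim by (auto simp: algebra_simps)
      hence "\<bar>\<psi> t - \<psi> x - Y x * (g t - g x)\<bar> \<le> \<bar>(Y t - Y x) * (g t - g x)\<bar>" using 1 by linarith
      hence "\<bar>\<psi> t - \<psi> x - Y x * (g t - g x)\<bar> / \<bar>t - x\<bar> \<le> \<bar>(Y t - Y x) * (g t - g x)\<bar> / \<bar>t - x\<bar>"
        by (rule divide_right_mono) simp
      moreover have "(\<psi> t - \<psi> x) / (t - x) - Y x * ?q t = (\<psi> t - \<psi> x - Y x * (g t - g x)) / (t - x)"
        by (simp only: diff_divide_distrib[of "\<psi> t - \<psi> x"] times_divide_eq_right)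
      ultimately show ?case by (simp add: abs_mult)
    qed
  qed
  from tendsto_add[OF this tendsto_mult[OF tendsto_const[of "Y x"] gq]]
  show ?thesis by (simp add: has_field_derivative_iff)
qed

locale bounded_law = real_distribution \<mu> for \<mu> :: "real measure" +
  fixes K l :: real
  assumes K_pos: "K > 0" and AE_bound: "AE t in \<mu>. \<bar>t\<bar> \<le> K" and l_nonneg: "0 \<le> l" and l_le_1: "l \<le> 1"
begin

section \<open>Transforms of a law with bounded support\<close>

lemma AE_sq: "AE t in \<mu>. t\<^sup>2 \<le> K\<^sup>2"
  using AE_bound by (rule AE_mp) (intro AE_I2 impI, metis abs_le_square_iff abs_of_pos K_pos)

lemma K2x: "x < 1 / K\<^sup>2 \<Longrightarrow> K\<^sup>2 * x < 1"
  using K_pos by (simp add: field_simps)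

lemma sq_mult_le:
  assumes "t\<^sup>2 \<le> K\<^sup>2" "0 \<le> x" "x < 1 / K\<^sup>2"
  shows "t\<^sup>2 * x \<le> K\<^sup>2 * x" "t\<^sup>2 * x < 1" "1 - K\<^sup>2 * x \<le> 1 - t\<^sup>2 * x"
  using mult_right_mono[OF assms(1,2)] K2x[OF assms(3)] by auto

lemma ratio_bound:
  assumes "t\<^sup>2 \<le> K\<^sup>2" "0 \<le> x" "x < 1 / K\<^sup>2"
  shows "0 \<le> t\<^sup>2 * x / (1 - t\<^sup>2 * x)" "t\<^sup>2 * x / (1 - t\<^sup>2 * x) \<le> K\<^sup>2 * x / (1 - K\<^sup>2 * x)"
  using sq_mult_le[OF assms] assms K2x[OF assms(3)] by (auto intro!: frac_le divide_nonneg_nonneg)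

lemma neg_ln_bound:
  assumes "t\<^sup>2 \<le> K\<^sup>2" "0 \<le> x" "x < 1 / K\<^sup>2"
  shows "0 \<le> - ln (1 - t\<^sup>2 * x)" "- ln (1 - t\<^sup>2 * x) \<le> t\<^sup>2 * x / (1 - t\<^sup>2 * x)"
proof -
  have p: "0 < 1 - t\<^sup>2 * x" using sq_mult_le[OF assms] by simp
  show "0 \<le> - ln (1 - t\<^sup>2 * x)" using p assms by simp
  have "- ln (1 - t\<^sup>2 * x) = ln (1 / (1 - t\<^sup>2 * x))" using p by (simp add: ln_div)
  also have "\<dots> \<le> 1 / (1 - t\<^sup>2 * x) - 1" by (rule ln_le_minus_one) (use p in auto)
  also have "\<dots> = t\<^sup>2 * x / (1 - t\<^sup>2 * x)" using p by (simp add: field_simps)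
  finally show "- ln (1 - t\<^sup>2 * x) \<le> t\<^sup>2 * x / (1 - t\<^sup>2 * x)" .
qed

lemma integrable_M:
  assumes "0 \<le> x" "x < 1 / K\<^sup>2"
  shows "integrable \<mu> (\<lambda>t. t\<^sup>2 * x / (1 - t\<^sup>2 * x))"
proof (rule integrable_const_bound[where B="K\<^sup>2 * x / (1 - K\<^sup>2 * x)"])
  show "AE t in \<mu>. norm (t\<^sup>2 * x / (1 - t\<^sup>2 * x)) \<le> K\<^sup>2 * x / (1 - K\<^sup>2 * x)"
    using AE_sq
  proof eventually_elim
    case (elim t)
    thus ?case using ratio_bound[OF elim assms] by (simp only: real_norm_def abs_of_nonneg)
  qed
qed measurable

lemma integrable_log_potential:
  assumes "0 \<le> x" "x < 1 / K\<^sup>2"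
  shows "integrable \<mu> (\<lambda>t. - ln (1 - t\<^sup>2 * x))"
proof (rule integrable_const_bound[where B="K\<^sup>2 * x / (1 - K\<^sup>2 * x)"])
  show "AE t in \<mu>. norm (- ln (1 - t\<^sup>2 * x)) \<le> K\<^sup>2 * x / (1 - K\<^sup>2 * x)"
    using AE_sq
  proof eventually_elim
    case (elim t)
    thus ?case using ratio_bound(2)[OF elim assms] neg_ln_bound[OF elim assms] by (simp only: real_norm_def abs_of_nonneg)
  qed
qed measurable

lemma M_sq_bounds:
  assumes "0 \<le> x" "x < 1 / K\<^sup>2"
  shows "0 \<le> M_sq \<mu> x" "M_sq \<mu> x \<le> K\<^sup>2 * x / (1 - K\<^sup>2 * x)"
proof -
  show "0 \<le> M_sq \<mu> x" unfolding M_sq_def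
    by (rule integral_nonneg_AE, use AE_sq in eventually_elim) (use ratio_bound[OF _ assms] in auto)
  have "M_sq \<mu> x \<le> (LINT t|\<mu>. K\<^sup>2 * x / (1 - K\<^sup>2 * x))"
    unfolding M_sq_def
    by (rule integral_mono_AE[OF integrable_M[OF assms] integrable_const], use AE_sq in eventually_elim)
      (use ratio_bound[OF _ assms] in auto)
  thus "M_sq \<mu> x \<le> K\<^sup>2 * x / (1 - K\<^sup>2 * x)" by (simp add: prob_space[simplified])
qed

lemma M_sq_mono:
  assumes "0 \<le> x" "x \<le> x'" "x' < 1 / K\<^sup>2"
  shows "M_sq \<mu> x \<le> M_sq \<mu> x'"
  unfolding M_sq_def
proof (rule integral_mono_AE[OF integrable_M integrable_M])
  show "AE t in \<mu>. t\<^sup>2 * x / (1 - t\<^sup>2 * x) \<le> t\<^sup>2 * x' / (1 - t\<^sup>2 * x')"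
    using AE_sq
  proof eventually_elim
    case (elim t)
    have "t\<^sup>2 * x \<le> t\<^sup>2 * x'" using assms by (intro mult_left_mono) auto
    thus ?case using sq_mult_le[OF elim, of x'] assms by (intro frac_le) auto
  qed
qed (use assms in auto)

text \<open>The difference quotients of the integrand are bounded uniformly up to \<open>r\<close>.
  Since the bound degenerates as \<open>r\<close> approaches \<open>1 / K\<^sup>2\<close>,
  continuity is obtained on the half-open interval by moving \<open>r\<close>.\<close>

lemma M_sq_lipschitz:
  assumes r: "r < 1 / K\<^sup>2" and x: "0 \<le> x" "x \<le> x'" "x' \<le> r"
  shows "M_sq \<mu> x' - M_sq \<mu> x \<le> K\<^sup>2 / (1 - K\<^sup>2 * r)\<^sup>2 * (x' - x)"
proof -
  let ?d = "1 - K\<^sup>2 * r"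
  have d: "0 < ?d" using K2x[OF r] by simp
  have X: "0 \<le> x'" "x' < 1 / K\<^sup>2" "x < 1 / K\<^sup>2" using x r by auto
  have "M_sq \<mu> x' - M_sq \<mu> x = (LINT t|\<mu>. t\<^sup>2 * x' / (1 - t\<^sup>2 * x') - t\<^sup>2 * x / (1 - t\<^sup>2 * x))"
    unfolding M_sq_def by (rule Bochner_Integration.integral_diff[symmetric]) (use X x in \<open>auto intro: integrable_M\<close>)
  also have "\<dots> \<le> (LINT t|\<mu>. K\<^sup>2 / ?d\<^sup>2 * (x' - x))"
  proof (rule integral_mono_AE)
    show "integrable \<mu> (\<lambda>t. t\<^sup>2 * x' / (1 - t\<^sup>2 * x') - t\<^sup>2 * x / (1 - t\<^sup>2 * x))"
      by (intro Bochner_Integration.integrable_diff integrable_M) (use X x in auto)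
    show "AE t in \<mu>. t\<^sup>2 * x' / (1 - t\<^sup>2 * x') - t\<^sup>2 * x / (1 - t\<^sup>2 * x) \<le> K\<^sup>2 / ?d\<^sup>2 * (x' - x)"
      using AE_sq
    proof eventually_elim
      case (elim t)
      have r0: "0 \<le> r" using x by simp
      have "t\<^sup>2 * x' \<le> K\<^sup>2 * r" "t\<^sup>2 * x \<le> K\<^sup>2 * r"
        using elim x by (auto intro!: mult_mono)
      hence a: "?d \<le> 1 - t\<^sup>2 * x'" "?d \<le> 1 - t\<^sup>2 * x" by auto
      have "t\<^sup>2 * x' / (1 - t\<^sup>2 * x') - t\<^sup>2 * x / (1 - t\<^sup>2 * x) = t\<^sup>2 * (x' - x) / ((1 - t\<^sup>2 * x') * (1 - t\<^sup>2 * x))"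
        using a d by (simp add: field_simps)
      also have "\<dots> \<le> K\<^sup>2 * (x' - x) / (?d * ?d)"
        using a d elim x by (intro frac_le mult_right_mono mult_mono) auto
      finally show ?case by (simp add: power2_eq_square)
    qed
  qed auto
  finally show ?thesis by (simp add: prob_space[simplified])
qed

lemma continuous_on_M_sq: "continuous_on {0..<1 / K\<^sup>2} (M_sq \<mu>)"
  unfolding continuous_on_eq_continuous_within
proof
  fix x assume x: "x \<in> {0..<1 / K\<^sup>2}"
  define r where "r = (x + 1 / K\<^sup>2) / 2"
  have r: "x < r" "r < 1 / K\<^sup>2" using x by (auto simp: r_def)
  define C where "C = K\<^sup>2 / (1 - K\<^sup>2 * r)\<^sup>2"
  have "C-lipschitz_on {0..r} (M_sq \<mu>)"
  proof (rule lipschitz_onI)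
    fix y z assume yz: "y \<in> {0..r}" "z \<in> {0..r}"
    show "dist (M_sq \<mu> y) (M_sq \<mu> z) \<le> C * dist y z"
    proof (cases "y \<le> z")
      case True
      thus ?thesis using M_sq_lipschitz[of r y z] M_sq_mono[of y z] yz r by (simp add: dist_real_def C_def)
    next
      case False
      thus ?thesis using M_sq_lipschitz[of r z y] M_sq_mono[of z y] yz r by (simp add: dist_real_def C_def)
    qed
  qed (simp add: C_def)
  hence "continuous_on {0..r} (M_sq \<mu>)" by (rule lipschitz_on_continuous_on)
  hence "continuous (at x within {0..r}) (M_sq \<mu>)" using x r by (auto simp: continuous_on_eq_continuous_within)
  also have "at x within {0..r} = at x within {0..<1 / K\<^sup>2}"
    by (rule at_within_nhd[of x "{..<r}"]) (use x r in auto)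
  finally show "continuous (at x within {0..<1 / K\<^sup>2}) (M_sq \<mu>)" .
qed

lemma M_sq_0 [simp]: "M_sq \<mu> 0 = 0" and log_potential_0 [simp]: "log_potential \<mu> 0 = 0"
  by (simp_all add: M_sq_def log_potential_def)

lemma log_potential_bounds:
  assumes "0 \<le> x" "x < 1 / K\<^sup>2"
  shows "0 \<le> log_potential \<mu> x" "log_potential \<mu> x \<le> M_sq \<mu> x"
proof -
  show "0 \<le> log_potential \<mu> x" unfolding log_potential_def
    by (rule integral_nonneg_AE, use AE_sq in eventually_elim) (use neg_ln_bound[OF _ assms] in auto)
  show "log_potential \<mu> x \<le> M_sq \<mu> x"
    unfolding log_potential_def M_sq_def
    by (rule integral_mono_AE[OF integrable_log_potential[OF assms] integrable_M[OF assms]], use AE_sq in eventually_elim)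
      (use neg_ln_bound[OF _ assms] in auto)
qed

text \<open>Integrating \<open>log_convexity_bound\<close> shows that the potential is convex as a
  function of \<open>ln x\<close>, with supporting slope \<open>M_sq \<mu> x\<close>.\<close>

lemma log_potential_support:
  assumes x: "0 < x" "x < 1 / K\<^sup>2" and x': "0 < x'" "x' < 1 / K\<^sup>2"
  shows "M_sq \<mu> x * (ln x' - ln x) \<le> log_potential \<mu> x' - log_potential \<mu> x"
proof -
  have I: "integrable \<mu> (\<lambda>t. t\<^sup>2 * x / (1 - t\<^sup>2 * x))" "integrable \<mu> (\<lambda>t. - ln (1 - t\<^sup>2 * x))"
    "integrable \<mu> (\<lambda>t. - ln (1 - t\<^sup>2 * x'))"
    by (rule integrable_M integrable_log_potential; use x x' in simp)+
  have "M_sq \<mu> x * (ln x' - ln x) = (LINT t|\<mu>. t\<^sup>2 * x / (1 - t\<^sup>2 * x) * (ln x' - ln x))"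
    unfolding M_sq_def by (rule integral_mult_left_zero[symmetric])
  also have "\<dots> \<le> (LINT t|\<mu>. - ln (1 - t\<^sup>2 * x') - (- ln (1 - t\<^sup>2 * x)))"
  proof (rule integral_mono_AE)
    show "AE t in \<mu>. t\<^sup>2 * x / (1 - t\<^sup>2 * x) * (ln x' - ln x) \<le> - ln (1 - t\<^sup>2 * x') - (- ln (1 - t\<^sup>2 * x))"
      using AE_sq
    proof eventually_elim
      case (elim t)
      show ?case by (rule log_convexity_bound) (use sq_mult_le(2)[OF elim] x x' in auto)
    qed
  qed (intro integrable_mult_left Bochner_Integration.integrable_diff I)+
  also have "\<dots> = log_potential \<mu> x' - log_potential \<mu> x"
    unfolding log_potential_def by (rule Bochner_Integration.integral_diff[OF I(3,2)])
  finally show ?thesis .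
qed

section \<open>The function \<open>H\<close> and its inverse\<close>

abbreviation "H \<equiv> H_rect l \<mu>"

lemma T_M_ge_1: "0 \<le> x \<Longrightarrow> x < 1 / K\<^sup>2 \<Longrightarrow> 1 \<le> T_rect l (M_sq \<mu> x)"
  by (rule T_rect_ge_1[OF l_nonneg M_sq_bounds(1)])

text \<open>Through the intermediate value theorem this puts every number in
  \<open>{0..<1 / K\<^sup>2}\<close> into the range of \<open>H\<close>.\<close>

lemma H_ge: "0 \<le> x \<Longrightarrow> x < 1 / K\<^sup>2 \<Longrightarrow> x \<le> H x"
  using mult_left_mono[OF T_M_ge_1[of x], of x] by (simp add: H_rect_def)

lemma H_strict_mono:
  assumes "0 \<le> x" "x < x'" "x' < 1 / K\<^sup>2"
  shows "H x < H x'"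
proof -
  have "T_rect l (M_sq \<mu> x) \<le> T_rect l (M_sq \<mu> x')"
    by (rule T_rect_mono[OF l_nonneg M_sq_bounds(1) M_sq_mono]) (use assms in auto)
  hence "H x \<le> x * T_rect l (M_sq \<mu> x')" using assms by (simp add: H_rect_def mult_left_mono)
  also have "\<dots> < x' * T_rect l (M_sq \<mu> x')"
    using T_M_ge_1[of x'] assms by (intro mult_strict_right_mono) auto
  finally show ?thesis by (simp add: H_rect_def)
qed

lemma inj_on_H: "inj_on H {0..<1 / K\<^sup>2}"
proof (rule inj_onI)
  fix x y assume "x \<in> {0..<1 / K\<^sup>2}" "y \<in> {0..<1 / K\<^sup>2}" "H x = H y"
  thus "x = y" using H_strict_mono[of x y] H_strict_mono[of y x] by (cases x y rule: linorder_cases) auto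
qed

lemma continuous_on_H: "continuous_on {0..<1 / K\<^sup>2} H"
  unfolding H_rect_def T_rect_def by (intro continuous_intros continuous_on_M_sq)

definition "H_inv s = the_inv_into {0..<1 / K\<^sup>2} H s"

lemma H_inv_H: "0 \<le> x \<Longrightarrow> x < 1 / K\<^sup>2 \<Longrightarrow> H_inv (H x) = x"
  unfolding H_inv_def by (rule the_inv_into_f_f[OF inj_on_H]) auto

lemma H_preimage:
  assumes "0 \<le> s" "s < 1 / K\<^sup>2"
  obtains x where "0 \<le> x" "x \<le> s" "H x = s"
proof -
  have "\<exists>x\<ge>0. x \<le> s \<and> H x = s"
  proof (rule IVT')
    show "H 0 \<le> s" using assms by (simp add: H_rect_def)
    show "s \<le> H s" by (rule H_ge) (use assms in auto)
    show "continuous_on {0..s} H" by (rule continuous_on_subset[OF continuous_on_H]) (use assms in auto)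
  qed (use assms in auto)
  thus ?thesis using that by blast
qed

lemma H_inv_facts:
  assumes "0 \<le> s" "s < 1 / K\<^sup>2"
  shows "0 \<le> H_inv s" "H_inv s \<le> s" "H_inv s < 1 / K\<^sup>2" "H (H_inv s) = s"
proof -
  obtain x where x: "0 \<le> x" "x \<le> s" "H x = s" using H_preimage[OF assms] by blast
  have "H_inv s = x" using H_inv_H[of x] x assms by simp
  thus "0 \<le> H_inv s" "H_inv s \<le> s" "H_inv s < 1 / K\<^sup>2" "H (H_inv s) = s" using x assms by auto
qed

lemma H_inv_pos:
  assumes "0 < s" "s < 1 / K\<^sup>2"
  shows "0 < H_inv s"
proof -
  have "H_inv s \<noteq> 0" using H_inv_facts(4)[of s] assms by (auto simp: H_rect_def)
  thus ?thesis using H_inv_facts(1)[of s] assms by simp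
qed

lemma isCont_on_interior:
  assumes "continuous_on {0..<1 / K\<^sup>2} f" "0 < x" "x < 1 / K\<^sup>2"
  shows "isCont f x"
proof -
  have "continuous_on {0<..<1 / K\<^sup>2} f" by (rule continuous_on_subset[OF assms(1)]) auto
  thus ?thesis using assms(2,3) by (auto simp: continuous_on_eq_continuous_at)
qed

lemma isCont_H_inv:
  assumes s: "0 < s" "s < 1 / K\<^sup>2"
  shows "isCont H_inv s"
proof -
  define x where "x = H_inv s"
  have x: "0 < x" "x < 1 / K\<^sup>2" "H x = s" using H_inv_pos[OF s] H_inv_facts[of s] s by (auto simp: x_def)
  define a b where "a = x / 2" and "b = (x + 1 / K\<^sup>2) / 2"
  have ab: "0 < a" "a < x" "x < b" "b < 1 / K\<^sup>2" using x by (auto simp: a_def b_def)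
  have "isCont H_inv (H x)"
  proof (rule isCont_inverse_function2[OF ab(2,3)])
    fix z assume z: "a \<le> z" "z \<le> b"
    show "H_inv (H z) = z" by (rule H_inv_H) (use z ab in auto)
    show "isCont H z" by (rule isCont_on_interior[OF continuous_on_H]) (use z ab in auto)
  qed
  thus ?thesis by (simp add: x)
qed

text \<open>
  The function \<open>log_potential x + y * (s - ln x) - W_rect l y\<close> is maximal in \<open>y\<close> and minimal in
  \<open>x\<close> at the saddle point with \<open>s = ln (H x)\<close> and \<open>y = M_sq x\<close>. Hence the saddle value has the
  supporting slope \<open>y\<close> as a function of \<open>s\<close>, and its derivative is found without differentiating
  \<open>M_sq\<close>.
\<close>

lemma saddle_value_support:
  assumes x: "0 < x" "x < 1 / K\<^sup>2" and x': "0 < x'" "x' < 1 / K\<^sup>2"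
  shows "M_sq \<mu> x * (ln (H x') - ln (H x)) \<le> saddle_value l \<mu> x' - saddle_value l \<mu> x"
proof -
  let ?m = "M_sq \<mu> x" and ?m' = "M_sq \<mu> x'"
  have m: "0 \<le> ?m" "0 \<le> ?m'" using M_sq_bounds(1) x x' by auto
  have t: "0 < T_rect l ?m" "0 < T_rect l ?m'" using T_M_ge_1[of x] T_M_ge_1[of x'] x x' by auto
  have "?m * (ln x' - ln x) \<le> log_potential \<mu> x' - log_potential \<mu> x" by (rule log_potential_support[OF x x'])
  moreover have "(?m - ?m') * ln (T_rect l ?m') \<le> W_rect l ?m - W_rect l ?m'"
    by (rule W_rect_tangent[OF l_nonneg m])
  moreover have "ln (H x') - ln (H x) = (ln x' - ln x) + (ln (T_rect l ?m') - ln (T_rect l ?m))"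
    using t x x' by (simp add: H_rect_def ln_mult)
  ultimately have "?m * (ln (H x') - ln (H x)) \<le> log_potential \<mu> x' - log_potential \<mu> x + ?m * (ln (T_rect l ?m') - ln (T_rect l ?m))"
    by (simp only: distrib_left)
  with \<open>(?m - ?m') * ln (T_rect l ?m') \<le> W_rect l ?m - W_rect l ?m'\<close>
  show ?thesis by (simp add: saddle_value_def algebra_simps)
qed

lemma saddle_value_bounds:
  assumes "0 \<le> x" "x < 1 / K\<^sup>2"
  shows "0 \<le> saddle_value l \<mu> x" "saddle_value l \<mu> x \<le> M_sq \<mu> x + 2 * (M_sq \<mu> x)\<^sup>2"
proof -
  let ?m = "M_sq \<mu> x"
  have m: "0 \<le> ?m" by (rule M_sq_bounds(1)[OF assms])
  have 1: "0 \<le> ?m * ln (T_rect l ?m) - W_rect l ?m"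
    using W_rect_tangent[OF l_nonneg, of 0 ?m] m by simp
  have 2: "0 \<le> W_rect l ?m"
    using W_rect_tangent[OF l_nonneg m, of 0] by (simp add: T_rect_def)
  have "ln (T_rect l ?m) \<le> 2 * ?m"
    using ln_T_rect_lipschitz[OF l_nonneg l_le_1 order_refl m] by (simp add: T_rect_def)
  hence "?m * ln (T_rect l ?m) \<le> ?m * (2 * ?m)" by (rule mult_left_mono[OF _ m])
  thus "0 \<le> saddle_value l \<mu> x" "saddle_value l \<mu> x \<le> M_sq \<mu> x + 2 * (M_sq \<mu> x)\<^sup>2"
    using 1 2 log_potential_bounds[OF assms] by (auto simp: saddle_value_def power2_eq_square)
qed

section \<open>The limit and its integral representation\<close>

text \<open>The supporting slope of the saddle value refers to
  \<open>ln (\<tau>\<^sup>2) = 2 * ln \<tau>\<close>; halving makes it the slope with respect to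
  \<open>ln \<tau>\<close>.\<close>

definition "limit_fun \<tau> = saddle_value l \<mu> (H_inv (\<tau>\<^sup>2)) / 2"

lemma sq_less: "0 \<le> \<tau> \<Longrightarrow> \<tau> < 1 / K \<Longrightarrow> \<tau>\<^sup>2 < 1 / K\<^sup>2"
  using power_strict_mono[of \<tau> "1 / K" 2] by (simp add: power_divide)

lemma isCont_Y:
  assumes "0 < \<tau>" "\<tau> < 1 / K"
  shows "isCont (\<lambda>\<tau>. M_sq \<mu> (H_inv (\<tau>\<^sup>2))) \<tau>"
proof -
  have s: "0 < \<tau>\<^sup>2" "\<tau>\<^sup>2 < 1 / K\<^sup>2" using sq_less[of \<tau>] assms by auto
  have "isCont (\<lambda>\<tau>. H_inv (\<tau>\<^sup>2)) \<tau>"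
    by (rule isCont_o2[where f="\<lambda>\<tau>. \<tau>\<^sup>2" and g=H_inv, OF _ isCont_H_inv[OF s]]) (intro continuous_intros)
  moreover have "isCont (M_sq \<mu>) (H_inv (\<tau>\<^sup>2))"
    by (rule isCont_on_interior[OF continuous_on_M_sq H_inv_pos[OF s] H_inv_facts(3)]) (use s in auto)
  ultimately show ?thesis by (rule isCont_o2)
qed

text \<open>The supports hold in the coordinate \<open>ln \<tau>\<close>, so the only function
  differentiated is \<open>ln\<close>; of \<open>H_inv\<close> and \<open>M_sq\<close> just
  continuity is used.\<close>

lemma limit_fun_deriv:
  assumes \<tau>: "0 < \<tau>" "\<tau> < 1 / K"
  shows "(limit_fun has_real_derivative M_sq \<mu> (H_inv (\<tau>\<^sup>2)) / \<tau>) (at \<tau>)"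
proof -
  have "(limit_fun has_real_derivative M_sq \<mu> (H_inv (\<tau>\<^sup>2)) * (1 / \<tau>)) (at \<tau>)"
  proof (rule has_real_derivative_from_supports[of 0 "1 / K" "\<lambda>\<tau>. M_sq \<mu> (H_inv (\<tau>\<^sup>2))" ln])
    fix s t :: real assume st: "0 < s" "s < 1 / K" "0 < t" "t < 1 / K"
    have s2: "0 < s\<^sup>2" "s\<^sup>2 < 1 / K\<^sup>2" and t2: "0 < t\<^sup>2" "t\<^sup>2 < 1 / K\<^sup>2" using sq_less[of s] sq_less[of t] st by auto
    have "M_sq \<mu> (H_inv (s\<^sup>2)) * (ln (H (H_inv (t\<^sup>2))) - ln (H (H_inv (s\<^sup>2)))) \<le> saddle_value l \<mu> (H_inv (t\<^sup>2)) - saddle_value l \<mu> (H_inv (s\<^sup>2))"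
      by (rule saddle_value_support) (use s2 t2 H_inv_pos H_inv_facts(3) in auto)
    moreover have "H (H_inv (t\<^sup>2)) = t\<^sup>2" "H (H_inv (s\<^sup>2)) = s\<^sup>2" using H_inv_facts(4) s2 t2 by auto
    ultimately show "M_sq \<mu> (H_inv (s\<^sup>2)) * (ln t - ln s) \<le> limit_fun t - limit_fun s"
      using st by (simp add: limit_fun_def ln_realpow field_simps)
  qed (use \<tau> isCont_Y[OF \<tau>] in \<open>auto intro!: derivative_eq_intros\<close>)
  thus ?thesis by simp
qed

lemma limit_fun_0: "limit_fun 0 = 0"
proof -
  have "H_inv 0 = 0" using H_inv_facts(1,2)[of 0] K_pos by simp
  thus ?thesis by (simp add: limit_fun_def saddle_value_def)
qed

lemma limit_fun_bound:
  assumes "0 \<le> \<tau>" "\<tau> < 1 / K"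
  defines "B \<equiv> K\<^sup>2 * \<tau>\<^sup>2 / (1 - K\<^sup>2 * \<tau>\<^sup>2)"
  shows "0 \<le> limit_fun \<tau>" "limit_fun \<tau> \<le> B + 2 * B\<^sup>2"
proof -
  have s: "0 \<le> \<tau>\<^sup>2" "\<tau>\<^sup>2 < 1 / K\<^sup>2" using sq_less[of \<tau>] assms by auto
  note X = H_inv_facts[OF s]
  have "M_sq \<mu> (H_inv (\<tau>\<^sup>2)) \<le> M_sq \<mu> (\<tau>\<^sup>2)" by (rule M_sq_mono[OF X(1,2) s(2)])
  also have "\<dots> \<le> B" unfolding B_def by (rule M_sq_bounds(2)[OF s])
  finally have m: "M_sq \<mu> (H_inv (\<tau>\<^sup>2)) \<le> B" .
  have m0: "0 \<le> M_sq \<mu> (H_inv (\<tau>\<^sup>2))" by (rule M_sq_bounds(1)[OF X(1,3)])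
  have "(M_sq \<mu> (H_inv (\<tau>\<^sup>2)))\<^sup>2 \<le> B\<^sup>2" by (rule power_mono[OF m m0])
  thus "0 \<le> limit_fun \<tau>" "limit_fun \<tau> \<le> B + 2 * B\<^sup>2"
    using saddle_value_bounds[OF X(1,3)] m m0 zero_le_power2[of B] unfolding limit_fun_def by linarith+
qed

lemma limit_fun_tendsto_0: "(limit_fun \<longlongrightarrow> 0) (at_right 0)"
proof (rule tendsto_sandwich[of "\<lambda>_. 0"])
  let ?B = "\<lambda>\<tau> :: real. K\<^sup>2 * \<tau>\<^sup>2 / (1 - K\<^sup>2 * \<tau>\<^sup>2)"
  have ev: "\<forall>\<^sub>F \<tau> in at_right 0. \<tau> \<in> {0<..<1 / K}"
    using K_pos by (intro eventually_at_right_real) auto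
  show "\<forall>\<^sub>F \<tau> in at_right 0. 0 \<le> limit_fun \<tau>"
    using ev by eventually_elim (auto intro: limit_fun_bound)
  show "\<forall>\<^sub>F \<tau> in at_right 0. limit_fun \<tau> \<le> ?B \<tau> + 2 * (?B \<tau>)\<^sup>2"
    using ev by eventually_elim (auto intro: limit_fun_bound)
  have "((\<lambda>\<tau>. ?B \<tau> + 2 * (?B \<tau>)\<^sup>2) \<longlongrightarrow> K\<^sup>2 * 0\<^sup>2 / (1 - K\<^sup>2 * 0\<^sup>2) + 2 * (K\<^sup>2 * 0\<^sup>2 / (1 - K\<^sup>2 * 0\<^sup>2))\<^sup>2) (at_right 0)"
    by (intro tendsto_intros) auto
  thus "((\<lambda>\<tau>. ?B \<tau> + 2 * (?B \<tau>)\<^sup>2) \<longlongrightarrow> 0) (at_right 0)" by simp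
qed simp

lemma continuous_on_limit_fun: "continuous_on {0..<1 / K} limit_fun"
  unfolding continuous_on_eq_continuous_within
proof
  fix \<tau> assume \<tau>: "\<tau> \<in> {0..<1 / K}"
  show "continuous (at \<tau> within {0..<1 / K}) limit_fun"
  proof (cases "\<tau> = 0")
    case True
    have "at 0 within {0..<1 / K} = at_right (0 :: real)"
      by (rule at_within_nhd[of 0 "{..<1 / K}"]) (use K_pos in auto)
    thus ?thesis using limit_fun_tendsto_0 by (simp add: True continuous_within limit_fun_0)
  next
    case False
    hence "isCont limit_fun \<tau>" using limit_fun_deriv[of \<tau>] \<tau> by (intro DERIV_isCont) auto
    thus ?thesis by (rule continuous_at_imp_continuous_at_within)
  qed
qed

lemma inj_on_T_rect: "inj_on (T_rect l) {-1..}"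
proof -
  have "T_rect l y < T_rect l y'" if y: "-1 \<le> y" "y < y'" for y y'
  proof -
    \<comment> \<open>The case of negative \<open>y'\<close> uses \<open>l \<le> 1\<close> together
      with \<open>y' > -1\<close>.\<close>
    have p: "l * y' + 1 > 0"
    proof (cases "y' \<ge> 0")
      case True thus ?thesis using l_nonneg by (intro add_nonneg_pos) auto
    next
      case False
      have "- y' < 1" using y by simp
      moreover have "l * (- y') \<le> 1 * (- y')" using l_le_1 False by (intro mult_right_mono) auto
      ultimately show ?thesis by simp
    qed
    have "(l * y + 1) * (y + 1) \<le> (l * y' + 1) * (y + 1)"
      using y l_nonneg by (intro mult_right_mono add_right_mono mult_left_mono) auto
    also have "\<dots> < (l * y' + 1) * (y' + 1)" using p y by (intro mult_strict_left_mono) auto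
    finally show ?thesis by (simp add: T_rect_def)
  qed
  thus ?thesis by (intro inj_onI) (metis atLeast_iff less_irrefl linorder_less_linear)
qed

text \<open>\<open>H x = s\<close> says that \<open>s / x\<close> equals
  \<open>T_rect l (M_sq \<mu> x)\<close>, so inverting \<open>T_rect l\<close> leaves
  \<open>M_sq \<mu> x\<close>.\<close>

lemma rect_R_eq:
  assumes "0 < s" "s < 1 / K\<^sup>2"
  shows "rect_R K l \<mu> s = M_sq \<mu> (H_inv s)"
proof -
  have X: "0 < H_inv s" "H_inv s < 1 / K\<^sup>2" "H (H_inv s) = s" using H_inv_pos[OF assms] H_inv_facts[of s] assms by auto
  have "s / H_inv s = T_rect l (M_sq \<mu> (H_inv s))" using X by (simp add: H_rect_def field_simps)
  hence "rect_R K l \<mu> s = the_inv_into {-1..} (T_rect l) (T_rect l (M_sq \<mu> (H_inv s)))"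
    using assms by (simp add: rect_R_def H_inv_def)
  also have "\<dots> = M_sq \<mu> (H_inv s)"
    by (rule the_inv_into_f_f[OF inj_on_T_rect]) (use M_sq_bounds(1)[of "H_inv s"] X in auto)
  finally show ?thesis .
qed

text \<open>The integral is treated as improper at 0, where the quotient is formally 0/0. For a
  nonnegative integrand, one-sided limits of the antiderivative suffice.\<close>

lemma integral_rect_R:
  assumes \<tau>: "0 \<le> \<tau>" "\<tau> < 1 / K"
  shows "(LBINT t=0..\<tau>. rect_R K l \<mu> (t\<^sup>2) / t) = limit_fun \<tau>"
proof (cases "\<tau> = 0")
  case True
  thus ?thesis by (simp add: limit_fun_0 zero_ereal_def)
next
  case False
  let ?f = "\<lambda>t. rect_R K l \<mu> (t\<^sup>2) / t"
  have eq: "?f t = M_sq \<mu> (H_inv (t\<^sup>2)) / t" if "0 < t" "t < 1 / K" for t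
    using rect_R_eq[of "t\<^sup>2"] sq_less[of t] that by simp
  have "(LBINT t=ereal 0..ereal \<tau>. ?f t) = limit_fun \<tau> - 0"
  proof (rule interval_integral_FTC_nonneg(2))
    show "ereal 0 < ereal \<tau>" using False \<tau> by simp
    fix t assume t: "ereal 0 < ereal t" "ereal t < ereal \<tau>"
    hence t': "0 < t" "t < 1 / K" using \<tau> by auto
    show "DERIV limit_fun t :> ?f t" using limit_fun_deriv[OF t'] by (simp add: eq[OF t'])
    have "isCont (\<lambda>t. M_sq \<mu> (H_inv (t\<^sup>2)) / t) t"
      using t' by (intro continuous_divide isCont_Y continuous_ident) auto
    moreover have "\<forall>\<^sub>F u in nhds t. ?f u = M_sq \<mu> (H_inv (u\<^sup>2)) / u"
    proof (rule eventually_nhds_in_open[of "{0<..<1 / K}", THEN eventually_mono])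
      fix u assume "u \<in> {0<..<1 / K}" thus "?f u = M_sq \<mu> (H_inv (u\<^sup>2)) / u" using eq by simp
    qed (use t' in auto)
    ultimately show "isCont ?f t" by (rule iffD2[OF isCont_cong, rotated])
  next
    show "AE x in lborel. ereal 0 < ereal x \<longrightarrow> ereal x < ereal \<tau> \<longrightarrow> 0 \<le> ?f x"
    proof (intro AE_I2 impI)
      fix x assume "ereal 0 < ereal x" "ereal x < ereal \<tau>"
      hence x: "0 < x" "x < 1 / K" using \<tau> by auto
      have s: "0 \<le> x\<^sup>2" "x\<^sup>2 < 1 / K\<^sup>2" using sq_less[of x] x by auto
      show "0 \<le> ?f x" using M_sq_bounds(1)[OF H_inv_facts(1,3)[OF s]] x by (simp add: eq[OF x])
    qed
    show "((limit_fun \<circ> real_of_ereal) \<longlongrightarrow> 0) (at_right (ereal 0))"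
      unfolding ereal_tendsto_simps1 by (rule limit_fun_tendsto_0)
    have "isCont limit_fun \<tau>" using limit_fun_deriv[of \<tau>] \<tau> False by (intro DERIV_isCont) auto
    hence "(limit_fun \<longlongrightarrow> limit_fun \<tau>) (at_left \<tau>)"
      unfolding isCont_def by (rule tendsto_within_subset) simp
    thus "((limit_fun \<circ> real_of_ereal) \<longlongrightarrow> limit_fun \<tau>) (at_left (ereal \<tau>))"
      unfolding ereal_tendsto_simps1 .
  qed
  thus ?thesis by (simp add: zero_ereal_def)
qed

text \<open>The integrand is odd, so the oriented integral is even in its upper limit.\<close>

lemma integral_rect_R_abs:
  assumes "\<bar>\<tau>\<bar> < 1 / K"
  shows "(LBINT t=0..\<tau>. rect_R K l \<mu> (t\<^sup>2) / t) = limit_fun \<bar>\<tau>\<bar>"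
proof (cases "0 \<le> \<tau>")
  case True
  thus ?thesis using integral_rect_R[of \<tau>] assms by simp
next
  case False
  let ?f = "\<lambda>t. rect_R K l \<mu> (t\<^sup>2) / t"
  have "(LBINT t=ereal 0..ereal \<tau>. ?f t) = (LBINT t=- ereal \<tau>..- ereal 0. - ?f t)"
    by (subst interval_integral_reflect) simp
  also have "\<dots> = (LBINT t=ereal 0..ereal (- \<tau>). ?f t)"
    by (subst interval_integral_endpoints_reverse) (simp add: zero_ereal_def[symmetric] interval_lebesgue_integral_uminus)
  also have "\<dots> = limit_fun (- \<tau>)" using integral_rect_R[of "- \<tau>"] False assms by (simp add: zero_ereal_def)
  finally show ?thesis using False by (simp add: zero_ereal_def)
qed

end

subsection \<open>Convergence of singular laws\<close>

lemma real_distribution_singular_law: "real_distribution (singular_law A)"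
proof -
  interpret prob_space "singular_law A"
    unfolding singular_law_def by (rule prob_space.prob_space_distr[OF prob_space_measure_pmf]) simp
  show ?thesis by unfold_locales (simp add: singular_law_def)
qed

lemma integral_singular_law:
  fixes h :: "real \<Rightarrow> real" and n :: nat
  assumes n: "n \<ge> 1" and sv: "singular_values A = image_mset f (mset_set {..<n})"
    and h: "h \<in> borel_measurable borel"
  shows "integral\<^sup>L (singular_law A) h = (\<Sum>k<n. h (f k)) / n"
proof -
  have ne: "{..<n} \<noteq> {}" using n by (simp add: lessThan_empty_iff)
  have "integral\<^sup>L (singular_law A) h = measure_pmf.expectation (pmf_of_multiset (singular_values A)) h"
    unfolding singular_law_def by (subst integral_distr) (use h in auto)
  also have "pmf_of_multiset (singular_values A) = map_pmf f (pmf_of_set {..<n})"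
    unfolding sv by (rule map_pmf_of_set[symmetric]) (use ne in auto)
  also have "measure_pmf.expectation \<dots> h = (\<Sum>k<n. h (f k)) / n"
    by (simp add: integral_pmf_of_set[OF ne finite_lessThan])
  finally show ?thesis .
qed

text \<open>Weak convergence tests only bounded continuous functions on the whole line, whereas
  \<open>h\<close> is continuous merely on \<open>{0..K\<^sup>2}\<close>. Clipping the absolute
  value at \<open>K\<close> produces such a test function and changes neither the empirical sums
  nor, by the first claim, the integral against \<mu>.\<close>

lemma weak_conv_bounded_support:
  fixes h :: "real \<Rightarrow> real" and e :: "nat \<Rightarrow> nat \<Rightarrow> real"
  assumes K: "K > 0" and \<mu>: "real_distribution \<mu>"
    and conv: "weak_conv_m (\<lambda>n. singular_law (M n)) \<mu>"
    and sv: "\<And>n. n \<ge> 1 \<Longrightarrow> singular_values (M n) = image_mset (\<lambda>k. sqrt (e n k)) (mset_set {..<n})"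
    and e: "\<And>n k. n \<ge> 1 \<Longrightarrow> k < n \<Longrightarrow> 0 \<le> e n k" "\<And>n k. n \<ge> 1 \<Longrightarrow> k < n \<Longrightarrow> e n k \<le> K\<^sup>2"
  shows "AE t in \<mu>. \<bar>t\<bar> \<le> K"
    and "continuous_on {0..K\<^sup>2} h \<Longrightarrow> h \<in> borel_measurable borel \<Longrightarrow> (\<lambda>n. (\<Sum>k<n. h (e n k)) / n) \<longlonglongrightarrow> (LINT t|\<mu>. h (t\<^sup>2))"
proof -
  interpret \<mu>: real_distribution \<mu> by (rule \<mu>)
  have lim: "(\<lambda>n. (\<Sum>k<n. f (sqrt (e n k))) / n) \<longlonglongrightarrow> integral\<^sup>L \<mu> f"
    if c: "\<And>x. isCont f x" and B: "\<And>x. norm (f x) \<le> B" for f :: "real \<Rightarrow> real" and B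
  proof -
    have "(\<lambda>n. integral\<^sup>L (singular_law (M n)) f) \<longlonglongrightarrow> integral\<^sup>L \<mu> f"
      by (rule weak_conv_imp_integral_bdd_continuous_conv[OF real_distribution_singular_law \<mu> conv c B])
    moreover have "\<forall>\<^sub>F n in sequentially. integral\<^sup>L (singular_law (M n)) f = (\<Sum>k<n. f (sqrt (e n k))) / n"
      using eventually_ge_at_top[of 1]
    proof eventually_elim
      case (elim n)
      have "f \<in> borel_measurable borel"
        using c by (intro borel_measurable_continuous_onI continuous_at_imp_continuous_on) auto
      thus ?case using integral_singular_law[OF elim sv[OF elim]] by simp
    qed
    ultimately show ?thesis by (rule Lim_transform_eventually)
  qed
  have sK: "sqrt (e n k) \<le> K" if "n \<ge> 1" "k < n" for n k
    using real_sqrt_le_mono[OF e(2)[OF that]] K by simp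
  show AE: "AE t in \<mu>. \<bar>t\<bar> \<le> K"
  proof -
    \<comment> \<open>Positive exactly outside \<open>{-K..K}\<close>, so a vanishing integral rules
      out mass there.\<close>
    let ?f = "\<lambda>t :: real. min 1 (max 0 (\<bar>t\<bar> - K))"
    have "(\<lambda>n. (\<Sum>k<n. ?f (sqrt (e n k))) / n) \<longlonglongrightarrow> integral\<^sup>L \<mu> ?f"
      by (rule lim[of _ 1]) (auto intro!: continuous_intros)
    moreover have "(\<lambda>n. (\<Sum>k<n. ?f (sqrt (e n k))) / n) = (\<lambda>_. 0)"
    proof
      fix n
      show "(\<Sum>k<n. ?f (sqrt (e n k))) / real n = 0"
        by (cases "n \<ge> 1") (use sK e in \<open>auto intro!: sum.neutral\<close>)
    qed
    ultimately have "integral\<^sup>L \<mu> ?f = 0" by (simp add: LIMSEQ_const_iff)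
    moreover have "integrable \<mu> ?f" by (rule \<mu>.integrable_const_bound[of _ 1]) auto
    ultimately have "AE t in \<mu>. ?f t = 0" by (subst (asm) integral_nonneg_eq_0_iff_AE) auto
    thus ?thesis by eventually_elim (auto simp: min_def max_def split: if_splits)
  qed
  assume h: "continuous_on {0..K\<^sup>2} h" and hm [measurable]: "h \<in> borel_measurable borel"
  let ?c = "\<lambda>t :: real. (min \<bar>t\<bar> K)\<^sup>2"
  have cr: "?c t \<in> {0..K\<^sup>2}" for t using K by (auto intro!: power_mono)
  have hc: "continuous_on UNIV (\<lambda>t. h (?c t))"
    by (rule continuous_on_compose2[OF h]) (use cr in \<open>auto intro!: continuous_intros\<close>)
  obtain B where B: "\<And>u. u \<in> {0..K\<^sup>2} \<Longrightarrow> norm (h u) \<le> B"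
    using compact_imp_bounded[OF compact_continuous_image[OF h compact_Icc]] unfolding bounded_iff by blast
  have "(\<lambda>n. (\<Sum>k<n. h (?c (sqrt (e n k)))) / n) \<longlonglongrightarrow> (LINT t|\<mu>. h (?c t))"
    by (rule lim[of _ B]) (use hc B cr in \<open>auto simp: continuous_on_eq_continuous_at\<close>)
  moreover have "(\<Sum>k<n. h (?c (sqrt (e n k)))) / n = (\<Sum>k<n. h (e n k)) / n" for n
  proof (cases "n \<ge> 1")
    case True
    have "?c (sqrt (e n k)) = e n k" if "k < n" for k
      using sK[OF True that] e(1)[OF True that] by (simp add: min_def)
    thus ?thesis by simp
  qed simp
  moreover have "(LINT t|\<mu>. h (?c t)) = (LINT t|\<mu>. h (t\<^sup>2))"
  proof (rule integral_cong_AE)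
    show "AE t in \<mu>. h (?c t) = h (t\<^sup>2)" using AE by eventually_elim (simp add: min_def)
  qed measurable
  ultimately show "(\<lambda>n. (\<Sum>k<n. h (e n k)) / n) \<longlonglongrightarrow> (LINT t|\<mu>. h (t\<^sup>2))" by simp
qed

section \<open>The limit of spherical integrals\<close>

text \<open>The parameter occurs only in the factor \<open>1 + l * u\<close>, whose logarithm is
  Lipschitz in \<open>l\<close> with constant \<open>u\<close>, and \<open>u\<close> is at most
  \<open>y\<close>.\<close>

lemma W_rect_diff_parameter:
  assumes l: "0 \<le> l" "0 \<le> l'" and y: "0 \<le> y"
  shows "\<bar>W_rect l' y - W_rect l y\<bar> \<le> \<bar>l' - l\<bar> * y\<^sup>2"
proof -
  have c: "continuous_on {0..y} (\<lambda>u. ln (T_rect a u))" if "0 \<le> a" for a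
    by (rule continuous_on_ln_T_rect[OF that])
  have "norm (integral {0..y} (\<lambda>u. ln (T_rect l' u) - ln (T_rect l u))) \<le> \<bar>l' - l\<bar> * y * (y - 0)"
  proof (rule integral_bound[OF y])
    show "continuous_on {0..y} (\<lambda>u. ln (T_rect l' u) - ln (T_rect l u))"
      by (intro continuous_on_diff c l)
    fix u assume u: "u \<in> {0..y}"
    have d: "ln (1 + b * u) - ln (1 + a * u) \<le> \<bar>b - a\<bar> * u" if "0 \<le> a" "a \<le> b" for a b
      using ln_add_one_diff_le[of "a * u" "b * u"] that u by (auto simp: mult_right_mono algebra_simps)
    have m: "ln (1 + a * u) \<le> ln (1 + b * u)" if "0 \<le> a" "a \<le> b" for a b
      using that u by (subst ln_le_cancel_iff) (auto intro: mult_right_mono add_pos_nonneg)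
    have "\<bar>ln (1 + l' * u) - ln (1 + l * u)\<bar> \<le> \<bar>l' - l\<bar> * u"
    proof (cases "l \<le> l'")
      case True
      thus ?thesis using d[of l l'] m[of l l'] l by simp
    next
      case False
      thus ?thesis using d[of l' l] m[of l' l] l by (simp add: abs_minus_commute)
    qed
    also have "\<dots> \<le> \<bar>l' - l\<bar> * y" using u by (intro mult_left_mono) auto
    finally show "norm (ln (T_rect l' u) - ln (T_rect l u)) \<le> \<bar>l' - l\<bar> * y"
      using u l by (simp add: ln_T_rect)
  qed
  moreover have "integral {0..y} (\<lambda>u. ln (T_rect l' u) - ln (T_rect l u)) = W_rect l' y - W_rect l y"
    unfolding W_rect_def
    by (rule Henstock_Kurzweil_Integration.integral_diff; intro integrable_continuous_real c l)
  ultimately show ?thesis by (simp add: power2_eq_square)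
qed

lemma tendsto_T_rect:
  assumes "(l' \<longlongrightarrow> l) A" "(y' \<longlongrightarrow> y) A"
  shows "((\<lambda>n. T_rect (l' n) (y' n)) \<longlongrightarrow> T_rect l y) A"
  unfolding T_rect_def by (intro tendsto_intros assms)

text \<open>Both arguments move. Tangent and quadratic bounds at the fixed point \<open>y\<close>
  control the second one, \<open>W_rect_diff_parameter\<close> the first.\<close>

lemma tendsto_W_rect:
  fixes l' y' :: "nat \<Rightarrow> real"
  assumes l': "l' \<longlonglongrightarrow> l" "\<And>n. 0 \<le> l' n" "\<And>n. l' n \<le> 1" and l: "0 \<le> l"
    and y': "y' \<longlonglongrightarrow> y" "\<And>n. 0 \<le> y' n" and y: "0 \<le> y"
  shows "(\<lambda>n. W_rect (l' n) (y' n)) \<longlonglongrightarrow> W_rect l y"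
proof -
  have T: "(\<lambda>n. ln (T_rect (l' n) y)) \<longlonglongrightarrow> ln (T_rect l y)"
    using T_rect_ge_1[OF l y] by (intro tendsto_ln tendsto_T_rect l' tendsto_const) auto
  have lo: "(\<lambda>n. W_rect l y + (y' n - y) * ln (T_rect (l' n) y) - \<bar>l' n - l\<bar> * y\<^sup>2)
      \<longlonglongrightarrow> W_rect l y + (y - y) * ln (T_rect l y) - \<bar>l - l\<bar> * y\<^sup>2"
    by (intro tendsto_intros T l' y')
  have up: "(\<lambda>n. W_rect l y + (y' n - y) * ln (T_rect (l' n) y) + 2 * (y' n - y)\<^sup>2 + \<bar>l' n - l\<bar> * y\<^sup>2)
      \<longlonglongrightarrow> W_rect l y + (y - y) * ln (T_rect l y) + 2 * (y - y)\<^sup>2 + \<bar>l - l\<bar> * y\<^sup>2"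
    by (intro tendsto_intros T l' y')
  have b: "W_rect l y + (y' n - y) * ln (T_rect (l' n) y) - \<bar>l' n - l\<bar> * y\<^sup>2 \<le> W_rect (l' n) (y' n)"
    "W_rect (l' n) (y' n) \<le> W_rect l y + (y' n - y) * ln (T_rect (l' n) y) + 2 * (y' n - y)\<^sup>2 + \<bar>l' n - l\<bar> * y\<^sup>2"
    for n
    using W_rect_tangent[OF l'(2) y'(2) y, of n n] W_rect_upper[OF l'(2,3) y'(2) y, of n n]
      W_rect_diff_parameter[OF l l'(2) y, of n] by linarith+
  show ?thesis
    by (rule tendsto_sandwich[of "\<lambda>n. W_rect l y + (y' n - y) * ln (T_rect (l' n) y) - \<bar>l' n - l\<bar> * y\<^sup>2" _ _
        "\<lambda>n. W_rect l y + (y' n - y) * ln (T_rect (l' n) y) + 2 * (y' n - y)\<^sup>2 + \<bar>l' n - l\<bar> * y\<^sup>2"])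
      (use lo up b in auto)
qed

lemma card_parts: "F = \<real> \<and> \<beta> = 1 \<or> F = UNIV \<and> \<beta> = 2 \<Longrightarrow> real (card (parts F)) = \<beta>"
  by (auto simp: UNIV_bool)

text \<open>For a target \<open>t\<close>, the point \<open>x\<close> with
  \<open>H x = t\<^sup>2\<close> is kept fixed. The estimate at stage \<open>n\<close> then holds
  not at \<open>t\<close> but at \<open>s n = sqrt (x * z n)\<close>, where \<open>z n\<close> comes
  from the empirical singular values and the ratio at that stage; \<open>s n\<close> tends to
  \<open>t\<close>, which is the form of convergence that \<open>uniform_limit_of_monotone\<close>
  accepts.\<close>

lemma spherical_series_uniform_limit:
  fixes c e :: "nat \<Rightarrow> nat \<Rightarrow> real" and Z :: "nat \<Rightarrow> real \<Rightarrow> real" and m :: "nat \<Rightarrow> nat" and \<beta> l K :: real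
  assumes \<beta>: "\<beta> > 0" and m_ge: "\<And>n. n \<ge> 1 \<Longrightarrow> n \<le> m n" and l: "0 \<le> l" "l \<le> 1"
    and ratio: "(\<lambda>n. real n / real (m n)) \<longlonglongrightarrow> l" and K: "K > 0"
    and \<mu>: "real_distribution \<mu>" and conv: "weak_conv_m (\<lambda>n. singular_law (M n)) \<mu>"
    and sv: "\<And>n. n \<ge> 1 \<Longrightarrow> singular_values (M n) = image_mset (\<lambda>k. sqrt (e n k)) (mset_set {..<n})"
    and e: "\<And>n k. n \<ge> 1 \<Longrightarrow> k < n \<Longrightarrow> 0 \<le> e n k" "\<And>n k. n \<ge> 1 \<Longrightarrow> k < n \<Longrightarrow> e n k \<le> K\<^sup>2"
    and c0: "\<And>n j. n \<ge> 1 \<Longrightarrow> 0 \<le> c n j"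
    and D: "\<And>n x. n \<ge> 1 \<Longrightarrow> 0 \<le> x \<Longrightarrow> x < 1 / K\<^sup>2 \<Longrightarrow>
      (\<lambda>j. c n j * x ^ j) sums (\<Prod>k<n. (1 - x * e n k) powr (- (\<beta> / 2)))"
    and Z: "\<And>n \<tau>. n \<ge> 1 \<Longrightarrow> \<bar>\<tau>\<bar> < 1 / K \<Longrightarrow>
      (\<lambda>j. c n j * ((\<tau>\<^sup>2) ^ j / (\<Prod>i<j. T_rect (real n / real (m n)) (2 * real i / (\<beta> * n))))) sums Z n \<tau>"
    and S: "compact S" "S \<subseteq> {- 1 / K<..<1 / K}"
  shows "uniform_limit S (\<lambda>n \<tau>. ln (Z n \<tau>) / n) (\<lambda>\<tau>. \<beta> * (LBINT t=0..\<tau>. rect_R K l \<mu> (t\<^sup>2) / t)) sequentially"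
proof -
  note wc = weak_conv_bounded_support[OF K \<mu> conv sv e]
  interpret bounded_law \<mu> K l
    by (intro bounded_law.intro bounded_law_axioms.intro \<mu> K wc(1) l)
  define l' where "l' = (\<lambda>n. real n / real (m n))"
  have l': "0 \<le> l' n" "l' n \<le> 1" for n
    using m_ge[of n] by (cases "n \<ge> 1"; simp add: l'_def divide_le_eq)+
  define w where "w = (\<lambda>n j. \<Prod>i<j. T_rect (l' n) (2 * real i / (\<beta> * n)))"
  have w1: "1 \<le> w n j" for n j
    unfolding w_def using \<beta> l' by (intro prod_ge_1 T_rect_ge_1) auto
  have Zs: "(\<lambda>j. c n j * ((\<tau>\<^sup>2) ^ j / w n j)) sums Z n \<tau>" if "n \<ge> 1" "\<bar>\<tau>\<bar> < 1 / K" for n \<tau>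
    using Z[OF that] by (simp add: w_def l'_def)
  \<comment> \<open>Only even powers occur, which reduces everything to nonnegative
    arguments.\<close>
  have Z_abs: "Z n \<bar>\<tau>\<bar> = Z n \<tau>" if "n \<ge> 1" "\<bar>\<tau>\<bar> < 1 / K" for n \<tau>
    using sums_unique2[OF Zs[of n "\<bar>\<tau>\<bar>"] _] Zs[of n \<tau>] that by simp
  have c_0: "c n 0 = 1" if "n \<ge> 1" for n
    using sums_unique2[OF powser_sums_zero D[of n 0]] that K by simp
  have Z_0: "Z n 0 = 1" if n: "n \<ge> 1" for n
  proof -
    have "(\<lambda>j. c n j * ((0\<^sup>2) ^ j / w n j)) = (\<lambda>j. c n j / w n j * 0 ^ j)" by (rule ext) simp
    hence "(\<lambda>j. c n j / w n j * 0 ^ j) sums Z n 0" using Zs[of n 0] n K by simp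
    from sums_unique2[OF powser_sums_zero this] show ?thesis by (simp add: c_0[OF n] w_def)
  qed
  have Z_mono: "Z n s \<le> Z n t" if "n \<ge> 1" "0 \<le> s" "s \<le> t" "t < 1 / K" for n s t
  proof (rule sums_le[OF _ Zs Zs])
    fix j
    have "(s\<^sup>2) ^ j \<le> (t\<^sup>2) ^ j" using that by (intro power_mono) auto
    thus "c n j * ((s\<^sup>2) ^ j / w n j) \<le> c n j * ((t\<^sup>2) ^ j / w n j)"
      using c0[OF that(1)] w1[of n j] by (intro mult_left_mono divide_right_mono) auto
  qed (use that in auto)
  have Z_ge_1: "1 \<le> Z n s" if "n \<ge> 1" "0 \<le> s" "s < 1 / K" for n s
    using Z_mono[of n 0 s] Z_0[of n] that by simp
  let ?g = "\<lambda>n \<tau>. ln (Z n \<tau>) / real n"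
  let ?\<psi> = "\<lambda>\<tau>. \<beta> * limit_fun \<tau>"
  let ?S = "abs ` S"
  have uni: "uniform_limit ?S ?g ?\<psi> sequentially"
  proof (rule uniform_limit_of_monotone[where R="1 / K"])
    fix n s t assume "n \<ge> (1 :: nat)" "0 \<le> s" "s \<le> t" "t < 1 / K"
    hence "ln (Z n s) \<le> ln (Z n t)" using Z_ge_1[of n s] Z_mono[of n s t] by (subst ln_le_cancel_iff) auto
    thus "?g n s \<le> ?g n t" by (rule divide_right_mono) simp
  next
    fix n assume "n \<ge> (1 :: nat)" thus "?g n 0 = ?\<psi> 0" by (simp add: Z_0 limit_fun_0)
  next
    show "continuous_on {0..<1 / K} ?\<psi>" by (intro continuous_intros continuous_on_limit_fun)
  next
    show "compact ?S" by (intro compact_continuous_image continuous_intros S)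
    show "?S \<subseteq> {0..<1 / K}" using S(2) by (auto simp: abs_less_iff)
  next
    fix t :: real assume t: "0 < t" "t < 1 / K"
    have t2: "0 < t\<^sup>2" "t\<^sup>2 < 1 / K\<^sup>2" using sq_less[of t] t by auto
    define x where "x = H_inv (t\<^sup>2)"
    have x: "0 < x" "x < 1 / K\<^sup>2" "H x = t\<^sup>2" using H_inv_pos[OF t2] H_inv_facts[of "t\<^sup>2"] t2 by (auto simp: x_def)
    define y where "y = (\<lambda>n. (\<Sum>k<n. x * e n k / (1 - x * e n k)) / real n)"
    define z where "z = (\<lambda>n. T_rect (l' n) (y n))"
    have xu: "x * u < 1" if "u \<le> K\<^sup>2" for u
      using mult_left_mono[OF that, of x] x(1) K2x[OF x(2)] mult.commute[of "K\<^sup>2" x] by linarith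
    have y_lim: "y \<longlonglongrightarrow> M_sq \<mu> x"
    proof -
      have "(\<lambda>n. (\<Sum>k<n. x * e n k / (1 - x * e n k)) / n) \<longlonglongrightarrow> (LINT t|\<mu>. x * t\<^sup>2 / (1 - x * t\<^sup>2))"
        by (rule wc(2)) (use xu in \<open>auto intro!: continuous_intros simp: less_imp_neq\<close>)
      thus ?thesis by (simp add: y_def M_sq_def mult.commute)
    qed
    have L_lim: "(\<lambda>n. (\<Sum>k<n. - ln (1 - x * e n k)) / real n) \<longlonglongrightarrow> log_potential \<mu> x"
    proof -
      have "(\<lambda>n. (\<Sum>k<n. - ln (1 - x * e n k)) / n) \<longlonglongrightarrow> (LINT t|\<mu>. - ln (1 - x * t\<^sup>2))"
        by (rule wc(2)) (use xu in \<open>auto intro!: continuous_intros simp: less_imp_neq\<close>)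
      thus ?thesis by (simp add: log_potential_def mult.commute)
    qed
    have y0: "0 \<le> y n" for n
    proof (cases "n \<ge> 1")
      case True
      thus ?thesis unfolding y_def using e[OF True] xu x
        by (intro divide_nonneg_nonneg sum_nonneg) (auto simp: less_imp_le)
    next
      case False
      hence "n = 0" by simp
      thus ?thesis by (simp add: y_def)
    qed
    have M0: "0 \<le> M_sq \<mu> x" using M_sq_bounds(1) x by simp
    have lim_l: "l' \<longlonglongrightarrow> l" using ratio by (simp add: l'_def)
    have z_lim: "z \<longlonglongrightarrow> T_rect l (M_sq \<mu> x)"
      unfolding z_def by (intro tendsto_T_rect lim_l y_lim)
    have z1: "1 \<le> z n" for n unfolding z_def by (rule T_rect_ge_1[OF l'(1) y0])
    define s where "s = (\<lambda>n. sqrt (x * z n))"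
    have s_lim: "s \<longlonglongrightarrow> t"
    proof -
      have "s \<longlonglongrightarrow> sqrt (x * T_rect l (M_sq \<mu> x))" unfolding s_def by (intro tendsto_intros z_lim)
      also have "x * T_rect l (M_sq \<mu> x) = t\<^sup>2" using x(3) by (simp add: H_rect_def)
      finally show ?thesis using t by simp
    qed
    let ?c = "\<lambda>n. \<beta> / 2 * ((\<Sum>k<n. - ln (1 - x * e n k)) / n + (y n * ln (z n) - W_rect (l' n) (y n)))"
    let ?C = "2 * (K\<^sup>2 * x / (1 - K\<^sup>2 * x)) + 2 * (K\<^sup>2 * x / (1 - K\<^sup>2 * x)\<^sup>2)"
    have c_lim: "?c \<longlonglongrightarrow> \<beta> / 2 * saddle_value l \<mu> x"
      unfolding saddle_value_def using T_M_ge_1[of x] x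
      by (intro tendsto_intros L_lim y_lim z_lim tendsto_W_rect lim_l l' l y0 M0) auto
    \<comment> \<open>Eventually \<open>s n < 1 / K\<close>, where the series for \<open>Z\<close>
      is available.\<close>
    have "\<forall>\<^sub>F n in sequentially. norm (?g n (s n) - ?c n) \<le> ?C / n"
      using eventually_ge_at_top[of 1] order_tendstoD(2)[OF s_lim t(2)]
    proof eventually_elim
      case (elim n)
      have s0: "0 \<le> s n" unfolding s_def using x z1[of n] by simp
      have s2: "(s n)\<^sup>2 = x * z n" unfolding s_def using x z1[of n] by simp
      have "(\<lambda>j. c n j * ((x * z n) ^ j / (\<Prod>i<j. T_rect (l' n) (2 * real i / (2 * (\<beta> / 2) * n))))) sums Z n (s n)"
        using Zs[of n "s n"] elim s0 by (simp add: s2 w_def)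
      from log_spherical_transform_bound(2)[OF elim(1) _ l' K e(1)[OF elim(1)] e(2)[OF elim(1)] c0[OF elim(1)]
          D[OF elim(1)] x(1,2) this[unfolded z_def y_def]] \<beta>
      show ?case by (simp add: z_def y_def)
    qed
    moreover have "(\<lambda>n. ?C / real n) \<longlonglongrightarrow> 0" by (rule lim_const_over_n)
    ultimately have "(\<lambda>n. ?g n (s n) - ?c n) \<longlonglongrightarrow> 0" by (rule Lim_null_comparison)
    from tendsto_add[OF this c_lim] have "(\<lambda>n. ?g n (s n)) \<longlonglongrightarrow> \<beta> / 2 * saddle_value l \<mu> x" by simp
    also have "\<beta> / 2 * saddle_value l \<mu> x = ?\<psi> t" by (simp add: limit_fun_def x_def)
    finally have "(\<lambda>n. ?g n (s n)) \<longlonglongrightarrow> ?\<psi> t" .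
    moreover have "0 \<le> s n" for n unfolding s_def using x(1) z1[of n] by simp
    ultimately show "\<exists>s. (\<forall>n\<ge>1. 0 \<le> s n) \<and> s \<longlonglongrightarrow> t \<and> (\<lambda>n. ?g n (s n)) \<longlonglongrightarrow> ?\<psi> t"
      using s_lim by blast
  qed
  show ?thesis
  proof (rule uniform_limitI)
    fix \<epsilon> :: real assume "\<epsilon> > 0"
    from uniform_limitD[OF uni this] eventually_ge_at_top[of 1]
    show "\<forall>\<^sub>F n in sequentially. \<forall>\<tau>\<in>S. dist (ln (Z n \<tau>) / n) (\<beta> * (LBINT t=0..\<tau>. rect_R K l \<mu> (t\<^sup>2) / t)) < \<epsilon>"
    proof eventually_elim
      case (elim n)
      show ?case
      proof
        fix \<tau> assume \<tau>: "\<tau> \<in> S"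
        hence b: "\<bar>\<tau>\<bar> < 1 / K" using S(2) by (auto simp: abs_less_iff)
        have "dist (?g n \<bar>\<tau>\<bar>) (?\<psi> \<bar>\<tau>\<bar>) < \<epsilon>" using elim(1) \<tau> by auto
        thus "dist (ln (Z n \<tau>) / n) (\<beta> * (LBINT t=0..\<tau>. rect_R K l \<mu> (t\<^sup>2) / t)) < \<epsilon>"
          by (simp only: Z_abs[OF elim(2) b] integral_rect_R_abs[OF b])
      qed
    qed
  qed
qed

theorem theorem1p2:
  fixes F :: "complex set" and \<beta> l K :: real and m :: "nat \<Rightarrow> nat"
    and M E :: "nat \<Rightarrow> complex mat" and \<mu> :: "real measure"
    and P :: "nat \<Rightarrow> 'w measure" and U V :: "nat \<Rightarrow> 'w \<Rightarrow> complex mat"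
  assumes field: "F = \<real> \<and> \<beta> = 1 \<or> F = UNIV \<and> \<beta> = 2"
    and m_ge: "\<And>n. n \<ge> 1 \<Longrightarrow> n \<le> m n"
    and l_range: "0 \<le> l" "l \<le> 1"
    and ratio: "(\<lambda>n. real n / real (m n)) \<longlonglongrightarrow> l"
    and l_zero: "l = 0 \<Longrightarrow> \<exists>\<alpha>::real. \<alpha> < 2 \<and> (\<forall>\<^sub>F n in sequentially. real (m n) \<le> real n powr \<alpha>)"
    and K_pos: "K > 0"
    and M_carrier: "\<And>n. n \<ge> 1 \<Longrightarrow> M n \<in> carrier_mat n (m n)"
    and M_entries: "\<And>n. n \<ge> 1 \<Longrightarrow> elements_mat (M n) \<subseteq> F"
    and M_bound: "\<And>n s. n \<ge> 1 \<Longrightarrow> s \<in># singular_values (M n) \<Longrightarrow> s < K"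
    and \<mu>_distr: "real_distribution \<mu>"
    and law_conv: "weak_conv_m (\<lambda>n. singular_law (M n)) \<mu>"
    and E_elem: "\<And>n. n \<ge> 1 \<Longrightarrow> E n \<in> elementary_mats (m n) n"
    and P_prob: "\<And>n. n \<ge> 1 \<Longrightarrow> prob_space (P n)"
    and U_haar: "\<And>n. n \<ge> 1 \<Longrightarrow> haar_distributed F n (P n) (U n)"
    and V_haar: "\<And>n. n \<ge> 1 \<Longrightarrow> haar_distributed F (m n) (P n) (V n)"
    and UV_indep: "\<And>n. n \<ge> 1 \<Longrightarrow>
      prob_space.indep_var (P n) (unitary_space F n) (U n) (unitary_space F (m n)) (V n)"
  shows "\<forall>S. compact S \<and> S \<subseteq> {- \<beta> / K<..<\<beta> / K} \<longrightarrow>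
    uniform_limit S
      (\<lambda>n \<theta>. 1 / real n * ln (prob_space.expectation (P n)
         (\<lambda>\<omega>. exp (sqrt (real n * real (m n)) * \<theta> *
                  Re (mat_trace (E n * U n \<omega> * M n * V n \<omega>))))))
      (\<lambda>\<theta>. \<beta> * (LBINT t=0..\<theta> / \<beta>. rect_R K l \<mu> (t\<^sup>2) / t))
      sequentially"
proof (intro allI impI)
  fix S assume S: "compact S \<and> S \<subseteq> {- \<beta> / K<..<\<beta> / K}"
  have F: "F = \<real> \<or> F = UNIV" and \<beta>: "\<beta> > 0" and card: "real (card (parts F)) = \<beta>"
    using field card_parts[OF field] by auto
  define Z where "Z = (\<lambda>n \<theta>. prob_space.expectation (P n)
         (\<lambda>\<omega>. exp (sqrt (real n * real (m n)) * \<theta> * Re (mat_trace (E n * U n \<omega> * M n * V n \<omega>)))))"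
  let ?w = "\<lambda>n j. \<Prod>i<j. (1 + 2 * real i / (n * card (parts F))) * (1 + 2 * real i / (m n * card (parts F)))"
  \<comment> \<open>Bundles everything known about the eigenvalues and coefficients at one
    \<open>n\<close>, so that a single choice yields both sequences.\<close>
  define Q where "Q = (\<lambda>n (e, c). (\<forall>k<n. 0 \<le> e k)
    \<and> singular_values (M n) = image_mset (\<lambda>k. sqrt (e k)) (mset_set {..<n})
    \<and> (\<forall>j. (0 :: real) \<le> c j)
    \<and> (\<forall>x\<ge>0. (\<forall>k<n. x * e k < 1) \<longrightarrow> (\<lambda>j. c j * x ^ j) sums (\<Prod>k<n. (1 - x * e k) powr (- card (parts F) / 2)))
    \<and> (\<forall>\<theta>. (\<forall>k<n. (\<theta> / card (parts F))\<^sup>2 * e k < 1) \<longrightarrow>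
        (\<lambda>j. c j * ((\<theta> / card (parts F)) ^ (2 * j) / ?w n j)) sums Z n \<theta>))"
  have "\<forall>n\<in>{1..}. \<exists>ec. Q n ec"
  proof
    fix n :: nat assume "n \<in> {1..}"
    hence n: "n \<ge> 1" by simp
    show "\<exists>ec. Q n ec"
    proof (rule haar_trace_laplace_expansion[OF F n M_carrier[OF n] M_entries[OF n] E_elem[OF n] P_prob[OF n]
          U_haar[OF n] V_haar[OF n] UV_indep[OF n]])
      fix e c :: "nat \<Rightarrow> real"
      assume "\<And>k. k < n \<Longrightarrow> 0 \<le> e k"
        "singular_values (M n) = image_mset (\<lambda>k. sqrt (e k)) (mset_set {..<n})" "\<And>j. 0 \<le> c j"
        "\<And>x. 0 \<le> x \<Longrightarrow> (\<And>k. k < n \<Longrightarrow> x * e k < 1) \<Longrightarrow>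
          (\<lambda>j. c j * x ^ j) sums (\<Prod>k<n. (1 - x * e k) powr (- card (parts F) / 2))"
        "\<And>\<theta>. (\<And>k. k < n \<Longrightarrow> (\<theta> / card (parts F))\<^sup>2 * e k < 1) \<Longrightarrow>
          (\<lambda>j. c j * ((\<theta> / card (parts F)) ^ (2 * j) / ?w n j)) sums prob_space.expectation (P n)
            (\<lambda>\<omega>. exp (sqrt (real n * real (m n)) * \<theta> * Re (mat_trace (E n * U n \<omega> * M n * V n \<omega>))))"
      hence "Q n (e, c)" unfolding Q_def Z_def prod.case by blast
      thus ?thesis ..
    qed
  qed
  from bchoice[OF this] obtain ec where ec: "\<forall>n\<in>{1..}. Q n (ec n)" ..
  define e where "e = (\<lambda>n. fst (ec n))"
  define c where "c = (\<lambda>n. snd (ec n))"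
  have Q: "Q n (e n, c n)" if "n \<ge> 1" for n using ec that by (simp add: e_def c_def)
  have e0: "0 \<le> e n k" if "n \<ge> 1" "k < n" for n k using Q[OF that(1)] that(2) by (simp add: Q_def)
  have sv: "singular_values (M n) = image_mset (\<lambda>k. sqrt (e n k)) (mset_set {..<n})" if "n \<ge> 1" for n
    using Q[OF that] by (simp add: Q_def)
  have eK: "e n k \<le> K\<^sup>2" if "n \<ge> 1" "k < n" for n k
  proof -
    have "sqrt (e n k) \<in># singular_values (M n)" using sv[OF that(1)] that(2) by simp
    hence "sqrt (e n k) < K" by (rule M_bound[OF that(1)])
    hence "(sqrt (e n k))\<^sup>2 \<le> K\<^sup>2" using e0[OF that] by (intro power_mono) auto
    thus ?thesis using e0[OF that] by simp
  qed
  have small: "x * e n k < 1" if "n \<ge> 1" "k < n" "0 \<le> x" "x < 1 / K\<^sup>2" for n k x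
  proof -
    have "x * e n k \<le> x * K\<^sup>2" using eK[OF that(1,2)] that(3) by (rule mult_left_mono)
    also have "\<dots> < 1" using that(4) K_pos by (simp add: field_simps)
    finally show ?thesis .
  qed
  \<comment> \<open>The substitution \<open>\<theta> = \<beta> * \<tau>\<close> turns the interval
    into \<open>{- 1 / K<..<1 / K}\<close> and the upper limit of integration into \<tau>.\<close>
  let ?S = "(\<lambda>\<theta>. \<theta> / \<beta>) ` S"
  have "uniform_limit ?S (\<lambda>n \<tau>. ln (Z n (\<beta> * \<tau>)) / n) (\<lambda>\<tau>. \<beta> * (LBINT t=0..\<tau>. rect_R K l \<mu> (t\<^sup>2) / t)) sequentially"
  proof (rule spherical_series_uniform_limit[OF \<beta> m_ge l_range ratio K_pos \<mu>_distr law_conv sv e0 eK])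
    fix n j assume "n \<ge> (1 :: nat)" thus "0 \<le> c n j" using Q by (simp add: Q_def)
  next
    fix n :: nat and x :: real assume n: "n \<ge> 1" and x: "0 \<le> x" "x < 1 / K\<^sup>2"
    have "(\<lambda>j. c n j * x ^ j) sums (\<Prod>k<n. (1 - x * e n k) powr (- real (card (parts F)) / 2))"
      using Q[OF n] small[OF n _ x] x by (simp add: Q_def)
    thus "(\<lambda>j. c n j * x ^ j) sums (\<Prod>k<n. (1 - x * e n k) powr (- (\<beta> / 2)))" by (simp add: card)
  next
    fix n :: nat and \<tau> :: real assume n: "n \<ge> 1" and \<tau>: "\<bar>\<tau>\<bar> < 1 / K"
    have "\<bar>\<tau>\<bar>\<^sup>2 < (1 / K)\<^sup>2" using \<tau> by (intro power_strict_mono) auto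
    hence t2: "\<tau>\<^sup>2 < 1 / K\<^sup>2" by (simp add: power_divide)
    have "(\<lambda>j. c n j * ((\<theta> / card (parts F)) ^ (2 * j) / ?w n j)) sums Z n \<theta>"
      if "\<forall>k<n. (\<theta> / card (parts F))\<^sup>2 * e n k < 1" for \<theta>
      using Q[OF n] that unfolding Q_def prod.case by blast
    moreover have "\<forall>k<n. (\<beta> * \<tau> / card (parts F))\<^sup>2 * e n k < 1"
      using small[OF n _ _ t2] \<beta> by (simp add: card)
    ultimately have "(\<lambda>j. c n j * ((\<beta> * \<tau> / card (parts F)) ^ (2 * j) / ?w n j)) sums Z n (\<beta> * \<tau>)" .
    moreover have "(\<beta> * \<tau> / card (parts F)) ^ (2 * j) = (\<tau>\<^sup>2) ^ j" for j
      using \<beta> by (simp add: card power_mult)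
    \<comment> \<open>The step \<open>2 * i / (m * \<beta>)\<close> is the ratio
      \<open>n / m\<close> times \<open>2 * i / (\<beta> * n)\<close>, so the two Pochhammer factors
      are the two factors of \<open>T_rect\<close> at the finite ratio.\<close>
    moreover have "?w n j = (\<Prod>i<j. T_rect (real n / real (m n)) (2 * real i / (\<beta> * n)))" for j
    proof (rule prod.cong[OF refl])
      fix i
      have "2 * real i / real (n * card (parts F)) = 2 * real i / (\<beta> * n)"
        by (simp add: card mult.commute)
      moreover have "2 * real i / real (m n * card (parts F)) = real n / real (m n) * (2 * real i / (\<beta> * n))"
        using n \<beta> by (simp add: card field_simps)
      ultimately show "(1 + 2 * real i / real (n * card (parts F))) * (1 + 2 * real i / real (m n * card (parts F)))
          = T_rect (real n / real (m n)) (2 * real i / (\<beta> * n))"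
        by (simp only: T_rect_def add.commute mult.commute)
    qed
    ultimately show "(\<lambda>j. c n j * ((\<tau>\<^sup>2) ^ j / (\<Prod>i<j. T_rect (real n / real (m n)) (2 * real i / (\<beta> * n)))))
        sums Z n (\<beta> * \<tau>)" by (simp only:)
  next
    show "compact ?S" by (intro compact_continuous_image continuous_intros) (use S \<beta> in auto)
    show "?S \<subseteq> {- 1 / K<..<1 / K}"
    proof
      fix \<tau> assume "\<tau> \<in> ?S"
      then obtain \<theta> where \<theta>: "\<theta> \<in> S" "\<tau> = \<theta> / \<beta>" by auto
      hence "- \<beta> / K < \<theta>" "\<theta> < \<beta> / K" using S by auto
      hence "- \<beta> / K / \<beta> < \<tau>" "\<tau> < \<beta> / K / \<beta>" using divide_strict_right_mono[OF _ \<beta>] unfolding \<theta>(2) by blast+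
      thus "\<tau> \<in> {- 1 / K<..<1 / K}" using \<beta> by simp
    qed
  qed
  hence "uniform_limit S (\<lambda>n \<theta>. ln (Z n (\<beta> * (\<theta> / \<beta>))) / n)
      (\<lambda>\<theta>. \<beta> * (LBINT t=0..\<theta> / \<beta>. rect_R K l \<mu> (t\<^sup>2) / t)) sequentially"
    unfolding uniform_limit_iff by simp
  thus "uniform_limit S (\<lambda>n \<theta>. 1 / real n * ln (prob_space.expectation (P n)
         (\<lambda>\<omega>. exp (sqrt (real n * real (m n)) * \<theta> * Re (mat_trace (E n * U n \<omega> * M n * V n \<omega>))))))
      (\<lambda>\<theta>. \<beta> * (LBINT t=0..\<theta> / \<beta>. rect_R K l \<mu> (t\<^sup>2) / t)) sequentially"
    using \<beta> by (simp add: Z_def)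
qed

end
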